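(* Let $M$ be a smooth $n$-manifold and let $G\colon M\to\mathcal G(\mathbb H^{n+1})$ be an immersion. Then $G$ is Lagrangian (i.e. $G^*\Omega=0$) if and only if for every $p\in M$ there exist a neighbourhood $U$ of $p$ and an immersion $\sigma\colon U\to\mathbb H^{n+1}$ such that $G|_U=G_\sigma$ is the Gauss map of $\sigma$ (with respect to some orientation of $U$).
   Context: Hyperboloid model: $\mathbb R^{n+1,1}$ is $\mathbb R^{n+2}$ with $\langle x,y\rangle=\sum_{i=1}^{n+1}x_iy_i-x_{n+2}y_{n+2}$, and $\mathbb H^{n+1}=\{x:\langle x,x\rangle=-1,\ x_{n+2}>0\}$ with the induced metric and a fixed orientation; $T^1\mathbb H^{n+1}=\{(x,v):x\in\mathbb H^{n+1},\langle x,v\rangle=0,\langle v,v\rangle=1\}\subset\mathbb R^{n+1,1}\times\mathbb R^{n+1,1}$. $\mathcal G(\mathbb H^{n+1})$ is the $2n$-manifold of maximal oriented unparametrized geodesics of $\mathbb H^{n+1}$, and $\mathrm p\colon T^1\mathbb H^{n+1}\to\mathcal G(\mathbb H^{n+1})$ sends $(x,v)$ to the oriented geodesic through $x$ with velocity $v$. It is a principal $\mathbb R$-bundle for the geodesic flow $\varphi_t(x,v)=(\cosh(t)x+\sinh(t)v,\sinh(t)x+\cosh(t)v)$, whose infinitesimal generator is $\chi_{(x,v)}=(v,x)$. For $w\in T_x\mathbb H^{n+1}$ with $w\perp v$ put $w^{\mathcal H}=(w,0)$, $w^{\mathcal V}=(0,w)$. Then $T_{(x,v)}T^1\mathbb H^{n+1}=\mathrm{Span}(\chi)\oplus\{w^{\mathcal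 H}\}\oplus\{w^{\mathcal V}\}$. The para-Sasaki metric $g$ on $T^1\mathbb H^{n+1}$ makes these three summands mutually orthogonal, with $g(\chi,\chi)=1$, $g(w_1^{\mathcal H},w_2^{\mathcal H})=\langle w_1,w_2\rangle$, $g(w_1^{\mathcal V},w_2^{\mathcal V})=-\langle w_1,w_2\rangle$. On $\chi^\perp$ let $J(w^{\mathcal H})=w^{\mathcal V}$, $J(w^{\mathcal V})=w^{\mathcal H}$. Since $g$ and $J$ are invariant under $\varphi_t$ and $d\mathrm p\colon\chi^\perp_{(x,v)}\to T_{\mathrm p(x,v)}\mathcal G(\mathbb H^{n+1})$ is an isomorphism, $g|_{\chi^\perp}$ and $J$ descend to a pseudo-Riemannian metric $\mathbb G$ of signature $(n,n)$ and a tensor $\mathbb J$ with $\mathbb J^2=\mathrm{id}$ on $\mathcal G(\mathbb H^{n+1})$; $\Omega(X,Y)=\mathbb G(X,\mathbb JY)$ is a symplectic form. Gauss map: for an immersion $\sigma$ of an oriented $n$-manifold $U$ into $\mathbb H^{n+1}$ with unit normal field $\nu$ compatible with the orientations of $U$ and $\mathbb H^{n+1}$ (for a fixed convention), $\zeta_\sigma(p)=(\sigma(p),\nu(p))\in T^1\mathbb H^{n+1}$ and $G_\sigma=\mathrm p\circ\zeta_\sigma$. *)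

theory Defs
  imports "HOL-Analysis.Analysis"
begin

section \<open>Smooth maps and smooth manifolds\<close>

text \<open>Derivatives are taken at points of the set, so these notions are meant for open sets of a
  Euclidean space.  There, existence and continuity of all iterated directional derivatives up to
  order \<open>k\<close> is the usual class \<open>C\<^sup>k\<close>.\<close>

primrec Ck_on ::
    "nat \<Rightarrow> ('a::euclidean_space \<Rightarrow> 'b::euclidean_space) \<Rightarrow> 'a set \<Rightarrow> bool" where
  "Ck_on 0 f S \<longleftrightarrow> continuous_on S f"
| "Ck_on (Suc k) f S \<longleftrightarrow> (\<forall>x\<in>S. f differentiable (at x)) \<and>
     (\<forall>v. Ck_on k (\<lambda>x. frechet_derivative f (at x) v) S)"

definition smooth_on ::
    "('a::euclidean_space \<Rightarrow> 'b::euclidean_space) \<Rightarrow> 'a set \<Rightarrow> bool" where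
  "smooth_on f S \<longleftrightarrow> (\<forall>k. Ck_on k f S)"

text \<open>Smoothness on a subset that need not be open, for instance an embedded submanifold:
  \<open>f\<close> is locally the restriction of a smooth function.\<close>

definition smooth_on_subset ::
    "('a::euclidean_space \<Rightarrow> 'b::euclidean_space) \<Rightarrow> 'a set \<Rightarrow> bool" where
  "smooth_on_subset f S \<longleftrightarrow>
     (\<forall>z\<in>S. \<exists>N F. open N \<and> z \<in> N \<and> smooth_on F N \<and> (\<forall>y\<in>S \<inter> N. F y = f y))"

text \<open>A chart is a domain together with a coordinate map.  Coordinate maps are total functions
  in HOL; only their values on the domain matter.\<close>

type_synonym ('a, 'e) chart = "'a set \<times> ('a \<Rightarrow> 'e)"

definition smooth_atlas ::
    "'a topology \<Rightarrow> ('a, 'e::euclidean_space) chart set \<Rightarrow> bool" where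
  "smooth_atlas X A \<longleftrightarrow>
     (\<Union>(U, \<phi>)\<in>A. U) = topspace X \<and>
     (\<forall>(U, \<phi>)\<in>A. openin X U \<and> open (\<phi> ` U) \<and>
        homeomorphic_map (subtopology X U) (top_of_set (\<phi> ` U)) \<phi>) \<and>
     (\<forall>(U, \<phi>)\<in>A. \<forall>(V, \<psi>)\<in>A. smooth_on (\<psi> \<circ> inv_into U \<phi>) (\<phi> ` (U \<inter> V)))"

definition smooth_manifold ::
    "'a topology \<Rightarrow> ('a, 'e::euclidean_space) chart set \<Rightarrow> bool" where
  "smooth_manifold X A \<longleftrightarrow> Hausdorff_space X \<and> second_countable X \<and> smooth_atlas X A"

definition restrict_atlas ::
    "('a, 'e) chart set \<Rightarrow> 'a set \<Rightarrow> ('a, 'e) chart set" where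
  "restrict_atlas A U = (\<lambda>(V, \<phi>). (U \<inter> V, \<phi>)) ` A"

definition euclidean_atlas :: "('e, 'e::euclidean_space) chart set" where
  "euclidean_atlas = {(UNIV, id)}"

definition smooth_map ::
    "'a topology \<Rightarrow> ('a, 'e::euclidean_space) chart set \<Rightarrow>
     'b topology \<Rightarrow> ('b, 'f::euclidean_space) chart set \<Rightarrow> ('a \<Rightarrow> 'b) \<Rightarrow> bool" where
  "smooth_map X A Y B f \<longleftrightarrow> continuous_map X Y f \<and>
     (\<forall>(U, \<phi>)\<in>A. \<forall>(V, \<psi>)\<in>B. smooth_on (\<psi> \<circ> f \<circ> inv_into U \<phi>) (\<phi> ` {p \<in> U. f p \<in> V}))"

text \<open>The differential of \<open>f\<close> at \<open>p\<close> in the coordinates \<open>\<phi>\<close> (with domain \<open>U\<close>)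
  and \<open>\<psi>\<close>.\<close>

definition chart_deriv ::
    "'a set \<Rightarrow> ('a \<Rightarrow> 'e::euclidean_space) \<Rightarrow> ('b \<Rightarrow> 'f::euclidean_space) \<Rightarrow>
     ('a \<Rightarrow> 'b) \<Rightarrow> 'a \<Rightarrow> 'e \<Rightarrow> 'f" where
  "chart_deriv U \<phi> \<psi> f p = frechet_derivative (\<psi> \<circ> f \<circ> inv_into U \<phi>) (at (\<phi> p))"

definition immersion ::
    "'a topology \<Rightarrow> ('a, 'e::euclidean_space) chart set \<Rightarrow>
     'b topology \<Rightarrow> ('b, 'f::euclidean_space) chart set \<Rightarrow> ('a \<Rightarrow> 'b) \<Rightarrow> bool" where
  "immersion X A Y B f \<longleftrightarrow> smooth_map X A Y B f \<and>
     (\<forall>(U, \<phi>)\<in>A. \<forall>(V, \<psi>)\<in>B. \<forall>p\<in>U. f p \<in> V \<longrightarrow> inj (chart_deriv U \<phi> \<psi> f p))"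

text \<open>An orientation is given by an atlas of the same smooth structure whose transition maps
  have positive Jacobian determinant.\<close>

definition orientation ::
    "'a topology \<Rightarrow> ('a, real^'n) chart set \<Rightarrow> ('a, real^'n) chart set \<Rightarrow> bool" where
  "orientation X A B \<longleftrightarrow> smooth_atlas X B \<and> smooth_atlas X (A \<union> B) \<and>
     (\<forall>(U, \<phi>)\<in>B. \<forall>(V, \<psi>)\<in>B. \<forall>p\<in>U \<inter> V. det (matrix (chart_deriv U \<phi> \<psi> id p)) > 0)"


section \<open>The hyperboloid model and its unit tangent bundle\<close>

text \<open>With \<open>n\<close> the cardinality of \<open>'n\<close>, the \<open>n + 2\<close> coordinates are indexed by the sum type
  \<open>'n + 2\<close>; the elements of the numeral type \<open>2\<close> are \<open>1\<close> and \<open>2\<close>, so the last two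
  coordinates have the indices \<open>Inr 1\<close> and \<open>Inr 2\<close>.\<close>

type_synonym 'n minkowski = "real ^ ('n + 2)"

definition mink :: "'n::finite minkowski \<Rightarrow> 'n minkowski \<Rightarrow> real" where
  "mink x y = (\<Sum>i\<in>UNIV - {Inr 2}. x $ i * y $ i) - x $ Inr 2 * y $ Inr 2"

definition hyperboloid :: "'n::finite minkowski set" where
  "hyperboloid = {x. mink x x = -1 \<and> x $ Inr 2 > 0}"

definition unit_tangent :: "('n::finite minkowski \<times> 'n minkowski) set" where
  "unit_tangent = {(x, v). x \<in> hyperboloid \<and> mink x v = 0 \<and> mink v v = 1}"

definition geod_flow ::
    "real \<Rightarrow> 'n::finite minkowski \<times> 'n minkowski \<Rightarrow> 'n minkowski \<times> 'n minkowski" where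
  "geod_flow t = (\<lambda>(x, v). (cosh t *\<^sub>R x + sinh t *\<^sub>R v, sinh t *\<^sub>R x + cosh t *\<^sub>R v))"

definition flow_gen :: "'n::finite minkowski \<times> 'n minkowski \<Rightarrow> 'n minkowski \<times> 'n minkowski" where
  "flow_gen = (\<lambda>(x, v). (v, x))"

text \<open>The vectors of \<open>T\<^sub>x\<close> of the hyperboloid that are orthogonal to \<open>v\<close>.\<close>

definition perp :: "'n::finite minkowski \<times> 'n minkowski \<Rightarrow> 'n minkowski set" where
  "perp = (\<lambda>(x, v). {w. mink x w = 0 \<and> mink v w = 0})"

definition hor :: "'n::finite minkowski \<Rightarrow> 'n minkowski \<times> 'n minkowski" where
  "hor w = (w, 0)"

definition ver :: "'n::finite minkowski \<Rightarrow> 'n minkowski \<times> 'n minkowski" where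
  "ver w = (0, w)"

definition tangent_T1 ::
    "'n::finite minkowski \<times> 'n minkowski \<Rightarrow> ('n minkowski \<times> 'n minkowski) set" where
  "tangent_T1 z = {s *\<^sub>R flow_gen z + hor w1 + ver w2 | s w1 w2. w1 \<in> perp z \<and> w2 \<in> perp z}"

text \<open>The coefficients of \<open>X = s \<chi> + w\<^sub>1\<^sup>H + w\<^sub>2\<^sup>V\<close> are read off
  from \<open>\<chi> = (v, x)\<close> and \<open>mink v v = 1\<close>; see \<open>decomposition_parts\<close> and
  \<open>para_sasaki_decomposition\<close> below.\<close>

definition flow_part ::
    "'n::finite minkowski \<times> 'n minkowski \<Rightarrow> 'n minkowski \<times> 'n minkowski \<Rightarrow> real" where
  "flow_part z X = mink (fst X) (snd z)"

definition hor_part ::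
    "'n::finite minkowski \<times> 'n minkowski \<Rightarrow> 'n minkowski \<times> 'n minkowski \<Rightarrow> 'n minkowski" where
  "hor_part z X = fst X - flow_part z X *\<^sub>R snd z"

definition ver_part ::
    "'n::finite minkowski \<times> 'n minkowski \<Rightarrow> 'n minkowski \<times> 'n minkowski \<Rightarrow> 'n minkowski" where
  "ver_part z X = snd X - flow_part z X *\<^sub>R fst z"

definition para_sasaki ::
    "'n::finite minkowski \<times> 'n minkowski \<Rightarrow>
     'n minkowski \<times> 'n minkowski \<Rightarrow> 'n minkowski \<times> 'n minkowski \<Rightarrow> real" where
  "para_sasaki z X Y = flow_part z X * flow_part z Y
     + mink (hor_part z X) (hor_part z Y) - mink (ver_part z X) (ver_part z Y)"

definition flow_perp ::
    "'n::finite minkowski \<times> 'n minkowski \<Rightarrow> ('n minkowski \<times> 'n minkowski) set" where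
  "flow_perp z = {X \<in> tangent_T1 z. para_sasaki z X (flow_gen z) = 0}"

text \<open>On \<open>flow_perp z\<close>, exchanging the two components sends \<open>hor w1 + ver w2\<close> to
  \<open>ver w1 + hor w2\<close>.\<close>

definition para_J :: "'n::finite minkowski \<times> 'n minkowski \<Rightarrow> 'n minkowski \<times> 'n minkowski" where
  "para_J X = (snd X, fst X)"

lemma mink_add_left: "mink (x + y) z = mink x z + mink y z"
  by (simp add: mink_def algebra_simps sum.distrib)

lemma mink_scaleR_left: "mink (c *\<^sub>R x) z = c * mink x z"
  by (simp add: mink_def algebra_simps sum_distrib_left)

lemma mink_commute: "mink x y = mink y x"
  by (simp add: mink_def mult.commute)

lemma decomposition_parts:
  fixes z :: "'n::finite minkowski \<times> 'n minkowski" and w1 w2 :: "'n minkowski" and s :: real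
  assumes "z \<in> unit_tangent" "w1 \<in> perp z"
  defines "X \<equiv> s *\<^sub>R flow_gen z + hor w1 + ver w2"
  shows "flow_part z X = s" "hor_part z X = w1" "ver_part z X = w2"
proof -
  obtain x v where z: "z = (x, v)" by (cases z)
  have "mink v v = 1" "mink w1 v = 0"
    using assms by (auto simp: z unit_tangent_def perp_def mink_commute)
  then show "flow_part z X = s"
    by (simp add: X_def z flow_part_def flow_gen_def hor_def ver_def
        mink_add_left mink_scaleR_left)
  then show "hor_part z X = w1" "ver_part z X = w2"
    unfolding hor_part_def ver_part_def
    by (simp_all add: X_def z flow_gen_def hor_def ver_def)
qed

lemma para_sasaki_decomposition:
  fixes z :: "'n::finite minkowski \<times> 'n minkowski"
  assumes "z \<in> unit_tangent" "w1 \<in> perp z" "u1 \<in> perp z"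
  shows "para_sasaki z (s *\<^sub>R flow_gen z + hor w1 + ver w2) (r *\<^sub>R flow_gen z + hor u1 + ver u2)
       = s * r + mink w1 u1 - mink w2 u2"
  using assms by (simp add: para_sasaki_def decomposition_parts)


section \<open>The space of oriented geodesics\<close>

text \<open>A maximal oriented unparametrized geodesic is represented by the set of its unit tangent
  vectors \<open>(x, v)\<close>, that is, by an orbit of the geodesic flow.\<close>

type_synonym 'n geodesic = "('n minkowski \<times> 'n minkowski) set"

definition geod_proj :: "'n::finite minkowski \<times> 'n minkowski \<Rightarrow> 'n geodesic" where
  "geod_proj z = range (\<lambda>t. geod_flow t z)"

definition geodesics :: "'n::finite geodesic set" where
  "geodesics = geod_proj ` unit_tangent"

text \<open>The quotient topology of \<open>geod_proj\<close>.\<close>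

definition geod_top :: "'n::finite geodesic topology" where
  "geod_top = topology (\<lambda>W. W \<subseteq> geodesics \<and>
     openin (top_of_set unit_tangent) {z \<in> unit_tangent. geod_proj z \<in> W})"

lemma openin_geod_top:
  fixes W :: "'n::finite geodesic set"
  shows "openin geod_top W \<longleftrightarrow> W \<subseteq> geodesics \<and>
     openin (top_of_set unit_tangent) {z \<in> unit_tangent. geod_proj z \<in> W}"
proof -
  let ?pre = "\<lambda>W :: 'n geodesic set. {z \<in> unit_tangent. geod_proj z \<in> W}"
  have "istopology (\<lambda>W :: 'n geodesic set. W \<subseteq> geodesics \<and> openin (top_of_set unit_tangent) (?pre W))"
    unfolding istopology_def
  proof (intro conjI allI impI)
    fix S T :: "'n geodesic set"
    assume "S \<subseteq> geodesics \<and> openin (top_of_set unit_tangent) (?pre S)"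
      and "T \<subseteq> geodesics \<and> openin (top_of_set unit_tangent) (?pre T)"
    moreover have "?pre (S \<inter> T) = ?pre S \<inter> ?pre T" by auto
    ultimately show "S \<inter> T \<subseteq> geodesics" "openin (top_of_set unit_tangent) (?pre (S \<inter> T))"
      by auto
  next
    fix \<K> :: "'n geodesic set set"
    assume *: "\<forall>K\<in>\<K>. K \<subseteq> geodesics \<and> openin (top_of_set unit_tangent) (?pre K)"
    then show "\<Union>\<K> \<subseteq> geodesics" by auto
    have "?pre (\<Union>\<K>) = \<Union>(?pre ` \<K>)" by auto
    then show "openin (top_of_set unit_tangent) (?pre (\<Union>\<K>))"
      using * by auto
  qed
  then show ?thesis
    unfolding geod_top_def by (simp add: topology_inverse')
qed

text \<open>The differential at \<open>z\<close> of \<open>geod_proj\<close>, read in the coordinate map \<open>c\<close>.  The derivative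
  within \<open>unit_tangent\<close> is determined only on \<open>tangent_T1 z\<close> and is only used there.\<close>

definition proj_deriv ::
    "('n::finite geodesic \<Rightarrow> (real^'n) \<times> (real^'n)) \<Rightarrow> 'n minkowski \<times> 'n minkowski \<Rightarrow>
     'n minkowski \<times> 'n minkowski \<Rightarrow> (real^'n) \<times> (real^'n)" where
  "proj_deriv c z = frechet_derivative (c \<circ> geod_proj) (at z within unit_tangent)"

text \<open>The (maximal) atlas of the unique smooth structure for which \<open>geod_proj\<close> is a submersion
  from \<open>unit_tangent\<close>: a chart is an injective \<open>c\<close> on an open set such that \<open>c \<circ> geod_proj\<close>
  is a smooth submersion to a space of dimension \<open>2n\<close>.\<close>

definition geod_atlas :: "('n::finite geodesic, (real^'n) \<times> (real^'n)) chart set" where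
  "geod_atlas = {(W, c). openin geod_top W \<and> inj_on c W \<and>
     smooth_on_subset (c \<circ> geod_proj) {z \<in> unit_tangent. geod_proj z \<in> W} \<and>
     (\<forall>z\<in>unit_tangent. geod_proj z \<in> W \<longrightarrow> proj_deriv c z ` tangent_T1 z = UNIV)}"

text \<open>Tangent vectors to the space of geodesics at \<open>l\<close> are represented by their coordinates in
  a chart map \<open>c\<close>.  They are lifted to \<open>flow_perp z\<close> for a point \<open>z\<close> over \<open>l\<close>; by invariance
  under the flow the choice of \<open>z\<close> does not matter.\<close>

definition geod_lift ::
    "('n::finite geodesic \<Rightarrow> (real^'n) \<times> (real^'n)) \<Rightarrow> 'n minkowski \<times> 'n minkowski \<Rightarrow>
     (real^'n) \<times> (real^'n) \<Rightarrow> 'n minkowski \<times> 'n minkowski" where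
  "geod_lift c z a = (THE X. X \<in> flow_perp z \<and> proj_deriv c z X = a)"

definition geod_point :: "'n::finite geodesic \<Rightarrow> 'n minkowski \<times> 'n minkowski" where
  "geod_point l = (SOME z. z \<in> unit_tangent \<and> geod_proj z = l)"

definition geod_metric ::
    "('n::finite geodesic \<Rightarrow> (real^'n) \<times> (real^'n)) \<Rightarrow> 'n geodesic \<Rightarrow>
     (real^'n) \<times> (real^'n) \<Rightarrow> (real^'n) \<times> (real^'n) \<Rightarrow> real" where
  "geod_metric c l a b =
     para_sasaki (geod_point l) (geod_lift c (geod_point l) a) (geod_lift c (geod_point l) b)"

definition geod_J ::
    "('n::finite geodesic \<Rightarrow> (real^'n) \<times> (real^'n)) \<Rightarrow> 'n geodesic \<Rightarrow>
     (real^'n) \<times> (real^'n) \<Rightarrow> (real^'n) \<times> (real^'n)" where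
  "geod_J c l a = proj_deriv c (geod_point l) (para_J (geod_lift c (geod_point l) a))"

definition geod_Omega ::
    "('n::finite geodesic \<Rightarrow> (real^'n) \<times> (real^'n)) \<Rightarrow> 'n geodesic \<Rightarrow>
     (real^'n) \<times> (real^'n) \<Rightarrow> (real^'n) \<times> (real^'n) \<Rightarrow> real" where
  "geod_Omega c l a b = geod_metric c l a (geod_J c l b)"

text \<open>The pullback of \<open>geod_Omega\<close> vanishes.\<close>

definition lagrangian ::
    "('a, 'e::euclidean_space) chart set \<Rightarrow> ('a \<Rightarrow> 'n::finite geodesic) \<Rightarrow> bool" where
  "lagrangian A G \<longleftrightarrow>
     (\<forall>(U, \<phi>)\<in>A. \<forall>(W, c)\<in>geod_atlas. \<forall>p\<in>U. G p \<in> W \<longrightarrow>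
        (\<forall>a b. geod_Omega c (G p) (chart_deriv U \<phi> c G p a) (chart_deriv U \<phi> c G p b) = 0))"


section \<open>Gauss maps\<close>

text \<open>Smooth maps into the embedded submanifold \<open>hyperboloid\<close> are smooth maps into
  \<open>'n minkowski\<close> with values in \<open>hyperboloid\<close>, with the same differential.\<close>

definition hyp_immersion ::
    "'a topology \<Rightarrow> ('a, real^'n::finite) chart set \<Rightarrow> ('a \<Rightarrow> 'n minkowski) \<Rightarrow> bool" where
  "hyp_immersion X A \<sigma> \<longleftrightarrow>
     immersion X A euclidean euclidean_atlas \<sigma> \<and> \<sigma> ` topspace X \<subseteq> hyperboloid"

text \<open>The two orientations of the hyperboloid correspond to \<open>\<epsilon> = 1\<close> and \<open>\<epsilon> = -1\<close>: a basis
  \<open>w\<^sub>1, \<dots>, w\<^sub>n, u\<close> of the tangent space at \<open>x\<close> is positive if \<open>\<epsilon>\<close> times the determinant of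
  \<open>(w\<^sub>1, \<dots>, w\<^sub>n, u, x)\<close> is positive.\<close>

definition positive_basis ::
    "real \<Rightarrow> 'n::finite minkowski \<Rightarrow> ('n \<Rightarrow> 'n minkowski) \<Rightarrow> 'n minkowski \<Rightarrow> bool" where
  "positive_basis \<epsilon> x w u \<longleftrightarrow>
     \<epsilon> * det (\<chi> i j. (case j of Inl k \<Rightarrow> w k | Inr m \<Rightarrow> (if m = 1 then u else x)) $ i) > 0"

text \<open>The convention for the normal: \<open>(\<partial>\<^sub>1\<sigma>, \<dots>, \<partial>\<^sub>n\<sigma>, \<nu>)\<close> is a positive basis for the
  coordinates of every chart in the orientation \<open>B\<close>.\<close>

definition unit_normal_field ::
    "real \<Rightarrow> 'a topology \<Rightarrow> ('a, real^'n::finite) chart set \<Rightarrow> ('a, real^'n) chart set \<Rightarrow>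
     ('a \<Rightarrow> 'n minkowski) \<Rightarrow> ('a \<Rightarrow> 'n minkowski) \<Rightarrow> bool" where
  "unit_normal_field \<epsilon> X A B \<sigma> \<nu> \<longleftrightarrow>
     smooth_map X A euclidean euclidean_atlas \<nu> \<and>
     (\<forall>p\<in>topspace X. (\<sigma> p, \<nu> p) \<in> unit_tangent) \<and>
     (\<forall>(U, \<phi>)\<in>A. \<forall>p\<in>U. \<forall>a. mink (\<nu> p) (chart_deriv U \<phi> id \<sigma> p a) = 0) \<and>
     (\<forall>(U, \<phi>)\<in>B. \<forall>p\<in>U.
        positive_basis \<epsilon> (\<sigma> p) (\<lambda>k. chart_deriv U \<phi> id \<sigma> p (axis k 1)) (\<nu> p))"

definition gauss_map ::
    "('a \<Rightarrow> 'n::finite minkowski) \<Rightarrow> ('a \<Rightarrow> 'n minkowski) \<Rightarrow> 'a \<Rightarrow> 'n geodesic" where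
  "gauss_map \<sigma> \<nu> p = geod_proj (\<sigma> p, \<nu> p)"

end

(* Write a geodesic as zeta = (x, v) up to the geodesic flow.  For a lift zeta = (sigma, nu) of G to the
   unit tangent bundle, the pullback of Omega by G is the exterior derivative of the contact form
   alpha = <d sigma, nu>, and the lift is given by a hypersurface with normal nu exactly when alpha = 0.
   Hence a Gauss map is Lagrangian.  Conversely, if alpha is closed, then locally alpha = df, and flowing
   the lift for the time -f makes the contact form vanish.  The new sigma need not be an immersion, but
   flowing further for all but finitely many constant times makes it one: d sigma and d nu have no common kernel, and
   <d sigma, d nu> is symmetric. *)
theory Submission
  imports Defs
begin

section \<open>Calculus of smooth maps\<close>

text \<open>\<open>geod_Omega\<close> depends on arbitrary choices: a chart of a maximal atlas that
  is specified only by properties, and one point \<open>geod_point\<close> on each orbit. Two facts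
  remove them. The form <X1,Y2> - <X2,Y1> on tangent vectors of the unit tangent bundle vanishes
  along the flow generator and is preserved by the flow, so it computes the pullback of
  \<open>geod_Omega\<close> along any smooth lift. And charts with a smooth section of
  \<open>geod_proj\<close> exist near every geodesic: a geodesic is given by the null directions of
  x + v and x - v, hence by one point in each of two affine slices of the light cone. Without such
  charts there would be neither a lift of G nor content in conditions quantified over
  \<open>geod_atlas\<close>. The time is -f because the contact form takes the value 1 on the
  generator, so flowing for a variable time adds the differential of that time to the form. Constant
  times leave it unchanged, which is why they are free to repair the immersion property. The last
  freedom is a reflection of coordinates, which adapts the orientation of U to the prescribed sign
  \<epsilon>.\<close>

lemma frechet_derivative_eq:
  "(f has_derivative f') (at x) \<Longrightarrow> frechet_derivative f (at x) = f'"
  by (metis frechet_derivative_at)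

text \<open>No differentiability is assumed: \<open>frechet_derivative\<close> is a choice among all
  derivatives, and both functions have the same ones, so even the arbitrary values agree.\<close>

lemma frechet_derivative_cong:
  assumes "open S" "x \<in> S" "\<And>y. y \<in> S \<Longrightarrow> f y = g y"
  shows "frechet_derivative f (at x) = frechet_derivative g (at x)"
  unfolding frechet_derivative_def
  using has_derivative_transform_within_open[OF _ assms(1,2), of f _ UNIV g]
    has_derivative_transform_within_open[OF _ assms(1,2), of g _ UNIV f] assms(3)
  by (metis (no_types, lifting))

lemma Ck_on_cong:
  assumes "open S" "\<And>x. x \<in> S \<Longrightarrow> f x = g x" "Ck_on k f S"
  shows "Ck_on k g S"
  using assms(2,3)
proof (induction k arbitrary: f g)
  case 0
  then show ?case using continuous_on_cong by (metis Ck_on.simps(1))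
next
  case (Suc k)
  have d: "frechet_derivative f (at x) = frechet_derivative g (at x)" if "x \<in> S" for x
    using frechet_derivative_cong[OF assms(1) that Suc.prems(1)] .
  have "g differentiable (at x)" if "x \<in> S" for x
    using Suc.prems that has_derivative_transform_within_open[OF _ assms(1) that, of f _ UNIV g]
    by (metis Ck_on.simps(2) differentiable_def)
  moreover have "Ck_on k (\<lambda>x. frechet_derivative g (at x) v) S" for v
    by (rule Suc.IH[where f = "\<lambda>x. frechet_derivative f (at x) v"]) (use Suc.prems d in auto)
  ultimately show ?case by simp
qed

lemma Ck_on_SucI:
  assumes "open S" "\<And>x. x \<in> S \<Longrightarrow> (f has_derivative f' x) (at x)"
    and "\<And>v. Ck_on k (\<lambda>x. f' x v) S"
  shows "Ck_on (Suc k) f S"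
proof -
  have "Ck_on k (\<lambda>x. frechet_derivative f (at x) v) S" for v
    by (rule Ck_on_cong[OF assms(1) _ assms(3)]) (use frechet_derivative_eq[OF assms(2)] in auto)
  then show ?thesis using assms(2) by (auto simp: differentiable_def)
qed

lemma Ck_on_SucD:
  assumes "Ck_on (Suc k) f S"
  shows "x \<in> S \<Longrightarrow> (f has_derivative frechet_derivative f (at x)) (at x)"
    and "Ck_on k (\<lambda>x. frechet_derivative f (at x) v) S"
  using assms by (auto simp: frechet_derivative_works)

lemma Ck_on_Suc_lower: "Ck_on (Suc k) f S \<Longrightarrow> Ck_on k f S"
proof (induction k arbitrary: f)
  case 0
  then have "f differentiable (at x within S)" if "x \<in> S" for x
    using that by (auto intro: differentiable_at_withinI)
  then show ?case by (simp add: differentiable_imp_continuous_on differentiable_on_def)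
next
  case (Suc k)
  then show ?case by (metis Ck_on.simps(2))
qed

lemma Ck_on_mono: "Ck_on k f S \<Longrightarrow> j \<le> k \<Longrightarrow> Ck_on j f S"
  by (induction k) (auto simp: le_Suc_eq dest: Ck_on_Suc_lower simp del: Ck_on.simps(2))

lemma Ck_on_imp_continuous_on: "Ck_on k f S \<Longrightarrow> continuous_on S f"
  using Ck_on_mono[of k f S 0] by simp

lemma Ck_on_subset: "Ck_on k f S \<Longrightarrow> T \<subseteq> S \<Longrightarrow> Ck_on k f T"
  by (induction k arbitrary: f) (auto intro: continuous_on_subset)

lemma Ck_on_const: "Ck_on k (\<lambda>x. c) S"
  by (induction k arbitrary: c) (auto simp: frechet_derivative_const)

lemma Ck_on_bounded_linear:
  assumes "bounded_linear f" "open S" shows "Ck_on k f S"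
proof (cases k)
  case 0
  then show ?thesis using assms by (simp add: linear_continuous_on)
next
  case (Suc j)
  then show ?thesis
    using Ck_on_SucI[OF assms(2) bounded_linear_imp_has_derivative[OF assms(1)]] Ck_on_const
    by blast
qed

lemma Ck_on_bounded_linear_compose:
  assumes "bounded_linear g" "open S" "Ck_on k f S" shows "Ck_on k (\<lambda>x. g (f x)) S"
  using assms(3)
proof (induction k arbitrary: f)
  case 0
  then show ?case using assms by (simp add: bounded_linear.continuous_on)
next
  case (Suc k)
  show ?case
    by (rule Ck_on_SucI[OF assms(2)
          bounded_linear.has_derivative[OF assms(1) Ck_on_SucD(1)[OF Suc.prems]] Suc.IH])
      (use Ck_on_SucD(2)[OF Suc.prems] in auto)
qed

lemma Ck_on_add:
  assumes "open S" "Ck_on k f S" "Ck_on k g S" shows "Ck_on k (\<lambda>x. f x + g x) S"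
  using assms(2,3)
proof (induction k arbitrary: f g)
  case 0
  then show ?case by (simp add: continuous_on_add)
next
  case (Suc k)
  show ?case
    by (rule Ck_on_SucI[OF assms(1) has_derivative_add[OF Ck_on_SucD(1)[OF Suc.prems(1)]
              Ck_on_SucD(1)[OF Suc.prems(2)]] Suc.IH])
      (use Ck_on_SucD(2)[OF Suc.prems(1)] Ck_on_SucD(2)[OF Suc.prems(2)] in auto)
qed

lemma Ck_on_sum:
  assumes "open S" "\<And>i. i \<in> I \<Longrightarrow> Ck_on k (f i) S"
  shows "Ck_on k (\<lambda>x. \<Sum>i\<in>I. f i x) S"
  using assms(2) by (induction I rule: infinite_finite_induct)
    (auto intro: Ck_on_const Ck_on_add[OF assms(1)])

lemma Ck_on_bounded_bilinear:
  assumes "bounded_bilinear b" "open S" "Ck_on k f S" "Ck_on k g S"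
  shows "Ck_on k (\<lambda>x. b (f x) (g x)) S"
  using assms(3,4)
proof (induction k arbitrary: f g)
  case 0
  then show ?case using bounded_bilinear.continuous_on[OF assms(1)] by auto
next
  case (Suc k)
  show ?case
    by (rule Ck_on_SucI[OF assms(2) bounded_bilinear.FDERIV[OF assms(1)
              Ck_on_SucD(1)[OF Suc.prems(1)] Ck_on_SucD(1)[OF Suc.prems(2)]] Ck_on_add[OF assms(2)]])
      (use Ck_on_SucD(2)[OF Suc.prems(1)] Ck_on_SucD(2)[OF Suc.prems(2)]
        Ck_on_Suc_lower[OF Suc.prems(1)] Ck_on_Suc_lower[OF Suc.prems(2)] Suc.IH in auto)
qed

text \<open>\<open>Ck_on\<close> controls derivatives in fixed directions, but the chain rule
  evaluates the derivative of g in a direction that moves with x. Expanding that direction in the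
  basis leaves a finite sum of products of scalar coefficients with fixed directional derivatives of
  g, to which the induction hypothesis applies.\<close>

lemma Ck_on_compose:
  fixes f :: "'a::euclidean_space \<Rightarrow> 'b::euclidean_space" and g :: "'b \<Rightarrow> 'c::euclidean_space"
  assumes "open S" "open T" "f ` S \<subseteq> T" "Ck_on k g T" "Ck_on k f S"
  shows "Ck_on k (g \<circ> f) S"
  using assms(4,5)
proof (induction k arbitrary: g)
  case 0
  then show ?case using assms(3) by (simp add: continuous_on_compose continuous_on_subset del: comp_apply)
next
  case (Suc k)
  let ?Df = "\<lambda>x. frechet_derivative f (at x)" and ?Dg = "\<lambda>x. frechet_derivative g (at x)"
  have d: "(g \<circ> f has_derivative ?Dg (f x) \<circ> ?Df x) (at x)" if "x \<in> S" for x
    using diff_chain_at[OF Ck_on_SucD(1)[OF Suc.prems(2)] Ck_on_SucD(1)[OF Suc.prems(1)]] that assms(3)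
    by auto
  have e: "(\<Sum>i\<in>Basis. (?Df x v \<bullet> i) *\<^sub>R ?Dg (f x) i) = (?Dg (f x) \<circ> ?Df x) v" if "x \<in> S" for x v
  proof -
    have l: "linear (?Dg (f x))"
      using Ck_on_SucD(1)[OF Suc.prems(1)] that assms(3)
      by (blast intro: has_derivative_linear)
    have "?Dg (f x) (?Df x v) = ?Dg (f x) (\<Sum>i\<in>Basis. (?Df x v \<bullet> i) *\<^sub>R i)"
      by (simp add: euclidean_representation)
    then show ?thesis by (simp add: linear_sum[OF l] linear_scale[OF l])
  qed
  have "Ck_on k (\<lambda>x. (?Dg (f x) \<circ> ?Df x) v) S" for v
  proof (rule Ck_on_cong[OF assms(1) e])
    have "Ck_on k (\<lambda>x. ?Dg (f x) i) S" for i
      using Suc.IH[of "\<lambda>y. ?Dg y i"] Ck_on_SucD(2)[OF Suc.prems(1)] Ck_on_Suc_lower[OF Suc.prems(2)]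
      by (simp add: o_def)
    moreover have "Ck_on k (\<lambda>x. ?Df x v \<bullet> i) S" for i
      by (rule Ck_on_bounded_linear_compose[OF bounded_linear_inner_left assms(1) Ck_on_SucD(2)[OF Suc.prems(2)]])
    ultimately show "Ck_on k (\<lambda>x. \<Sum>i\<in>Basis. (?Df x v \<bullet> i) *\<^sub>R ?Dg (f x) i) S"
      by (intro Ck_on_sum[OF assms(1)] Ck_on_bounded_bilinear[OF bounded_bilinear_scaleR assms(1)])
  qed
  from Ck_on_SucI[OF assms(1) d this] show ?case .
qed

lemma smooth_on_cong:
  "open S \<Longrightarrow> (\<And>x. x \<in> S \<Longrightarrow> f x = g x) \<Longrightarrow> smooth_on f S \<Longrightarrow> smooth_on g S"
  unfolding smooth_on_def using Ck_on_cong by blast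

lemma smooth_on_mono: "smooth_on f S \<Longrightarrow> T \<subseteq> S \<Longrightarrow> smooth_on f T"
  unfolding smooth_on_def using Ck_on_subset by blast

lemma smooth_on_imp_continuous_on: "smooth_on f S \<Longrightarrow> continuous_on S f"
  unfolding smooth_on_def using Ck_on_imp_continuous_on by blast

lemma smooth_on_derivative:
  assumes "smooth_on f S"
  shows smooth_on_has_derivative:
      "x \<in> S \<Longrightarrow> (f has_derivative frechet_derivative f (at x)) (at x)"
    and smooth_on_frechet_derivative: "smooth_on (\<lambda>x. frechet_derivative f (at x) v) S"
  using assms Ck_on_SucD unfolding smooth_on_def by blast+

lemma smooth_onI_derivative:
  assumes "open S" "\<And>x. x \<in> S \<Longrightarrow> (f has_derivative f' x) (at x)" "\<And>v. smooth_on (\<lambda>x. f' x v) S"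
  shows "smooth_on f S"
  unfolding smooth_on_def
proof
  fix k
  have "Ck_on (Suc k) f S"
    using assms(3) by (intro Ck_on_SucI[OF assms(1,2)]) (auto simp: smooth_on_def)
  then show "Ck_on k f S" by (rule Ck_on_Suc_lower)
qed

lemma smooth_on_const: "smooth_on (\<lambda>x. c) S"
  by (simp add: smooth_on_def Ck_on_const)

lemma smooth_on_bounded_linear: "bounded_linear f \<Longrightarrow> open S \<Longrightarrow> smooth_on f S"
  by (simp add: smooth_on_def Ck_on_bounded_linear)

lemma smooth_on_bounded_linear_compose:
  "bounded_linear g \<Longrightarrow> open S \<Longrightarrow> smooth_on f S \<Longrightarrow> smooth_on (\<lambda>x. g (f x)) S"
  by (simp add: smooth_on_def Ck_on_bounded_linear_compose)

lemma smooth_on_add: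
  "open S \<Longrightarrow> smooth_on f S \<Longrightarrow> smooth_on g S \<Longrightarrow> smooth_on (\<lambda>x. f x + g x) S"
  by (simp add: smooth_on_def Ck_on_add)

lemma smooth_on_uminus: "open S \<Longrightarrow> smooth_on f S \<Longrightarrow> smooth_on (\<lambda>x. - f x) S"
  by (rule smooth_on_bounded_linear_compose[OF bounded_linear_minus[OF bounded_linear_ident]])

lemma smooth_on_diff:
  "open S \<Longrightarrow> smooth_on f S \<Longrightarrow> smooth_on g S \<Longrightarrow> smooth_on (\<lambda>x. f x - g x) S"
  using smooth_on_add[of S f "\<lambda>x. - g x"] smooth_on_uminus by auto

lemma smooth_on_bounded_bilinear:
  "bounded_bilinear b \<Longrightarrow> open S \<Longrightarrow> smooth_on f S \<Longrightarrow> smooth_on g S \<Longrightarrow>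
    smooth_on (\<lambda>x. b (f x) (g x)) S"
  by (simp add: smooth_on_def Ck_on_bounded_bilinear)

lemmas smooth_on_scaleR = smooth_on_bounded_bilinear[OF bounded_bilinear_scaleR]

lemma smooth_on_mult:
  fixes f g :: "'a::euclidean_space \<Rightarrow> real"
  shows "open S \<Longrightarrow> smooth_on f S \<Longrightarrow> smooth_on g S \<Longrightarrow> smooth_on (\<lambda>x. f x * g x) S"
  by (rule smooth_on_bounded_bilinear[OF bounded_bilinear_mult])

lemma smooth_on_compose:
  fixes f :: "'a::euclidean_space \<Rightarrow> 'b::euclidean_space" and g :: "'b \<Rightarrow> 'c::euclidean_space"
  assumes "open S" "open T" "f ` S \<subseteq> T" "smooth_on g T" "smooth_on f S"
  shows "smooth_on (g \<circ> f) S"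
  using assms Ck_on_compose unfolding smooth_on_def by blast

lemma smooth_on_Pair:
  fixes f :: "'a::euclidean_space \<Rightarrow> 'b::euclidean_space" and g :: "'a \<Rightarrow> 'c::euclidean_space"
  assumes "open S" "smooth_on f S" "smooth_on g S"
  shows "smooth_on (\<lambda>x. (f x, g x)) S"
proof -
  have "bounded_linear (\<lambda>y::'b. (y, 0::'c))" "bounded_linear (\<lambda>y::'c. (0::'b, y))"
    by (auto intro!: bounded_linear_intros)
  from smooth_on_add[OF assms(1) smooth_on_bounded_linear_compose[OF this(1) assms(1,2)]
      smooth_on_bounded_linear_compose[OF this(2) assms(1,3)]]
  show ?thesis by simp
qed

lemmas smooth_on_fst = smooth_on_bounded_linear_compose[OF bounded_linear_fst]
lemmas smooth_on_snd = smooth_on_bounded_linear_compose[OF bounded_linear_snd]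

section \<open>Smoothness of hyperbolic functions, inverse and square root\<close>

lemma Ck_on_cosh_sinh: "Ck_on k cosh (UNIV :: real set) \<and> Ck_on k sinh (UNIV :: real set)"
proof (induction k)
  case 0
  then show ?case by (auto intro!: continuous_intros)
next
  case (Suc k)
  have c: "((cosh :: real \<Rightarrow> real) has_derivative (\<lambda>v. sinh x * v)) (at x)"
    and s: "((sinh :: real \<Rightarrow> real) has_derivative (\<lambda>v. cosh x * v)) (at x)" for x
    by (auto intro!: derivative_eq_intros)
  have "Ck_on k (\<lambda>x::real. sinh x * v) UNIV" "Ck_on k (\<lambda>x::real. cosh x * v) UNIV" for v
    using Suc by (intro Ck_on_bounded_bilinear[OF bounded_bilinear_mult] Ck_on_const; simp)+
  then show ?case
    using Ck_on_SucI[OF open_UNIV c] Ck_on_SucI[OF open_UNIV s] by blast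
qed

text \<open>The derivative is again a polynomial in \<open>inverse\<close>, which closes the
  induction; for \<open>sqrt\<close> below it is a multiple of \<open>inverse\<close> after
  \<open>sqrt\<close>.\<close>

lemma Ck_on_inverse: "Ck_on k inverse ({0<..} :: real set)"
proof (induction k)
  case 0
  then show ?case by (auto intro!: continuous_intros)
next
  case (Suc k)
  have d: "((inverse :: real \<Rightarrow> real) has_derivative (\<lambda>v. - (inverse x * v * inverse x))) (at x)" if "x \<in> {0<..}" for x
    using that by (auto intro!: has_derivative_inverse')
  have "Ck_on k (\<lambda>x::real. - (inverse x * v * inverse x)) {0<..}" for v
    by (intro Ck_on_bounded_linear_compose[OF bounded_linear_minus[OF bounded_linear_ident]] Ck_on_bounded_bilinear[OF bounded_bilinear_mult]
        Ck_on_const Suc) auto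
  from Ck_on_SucI[OF _ d this] show ?case by simp
qed

lemma Ck_on_sqrt: "Ck_on k sqrt ({0<..} :: real set)"
proof (induction k)
  case 0
  then show ?case by (auto intro!: continuous_intros)
next
  case (Suc k)
  have d: "(sqrt has_derivative (\<lambda>v. inverse (sqrt x) * (v / 2))) (at x)" if "x \<in> {0<..}" for x
    using that by (auto intro!: derivative_eq_intros simp: field_simps)
  have "Ck_on k (inverse \<circ> sqrt) {0<..}"
    by (rule Ck_on_compose[OF _ _ _ Ck_on_inverse Suc]) auto
  then have "Ck_on k (\<lambda>x::real. inverse (sqrt x) * (v / 2)) {0<..}" for v
    by (intro Ck_on_bounded_bilinear[OF bounded_bilinear_mult] Ck_on_const) (auto simp: o_def)
  from Ck_on_SucI[OF _ d this] show ?case by simp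
qed

lemma smooth_on_cosh: "open S \<Longrightarrow> smooth_on f S \<Longrightarrow> smooth_on (\<lambda>x. cosh (f x :: real)) S"
  using smooth_on_compose[of S UNIV f cosh] Ck_on_cosh_sinh by (auto simp: smooth_on_def o_def)

lemma smooth_on_sinh: "open S \<Longrightarrow> smooth_on f S \<Longrightarrow> smooth_on (\<lambda>x. sinh (f x :: real)) S"
  using smooth_on_compose[of S UNIV f sinh] Ck_on_cosh_sinh by (auto simp: smooth_on_def o_def)

lemma smooth_on_inverse:
  "open S \<Longrightarrow> smooth_on f S \<Longrightarrow> (\<And>x. x \<in> S \<Longrightarrow> f x > 0) \<Longrightarrow> smooth_on (\<lambda>x. inverse (f x :: real)) S"
  using smooth_on_compose[of S "{0<..}" f inverse] Ck_on_inverse by (auto simp: smooth_on_def o_def)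

lemma smooth_on_sqrt:
  "open S \<Longrightarrow> smooth_on f S \<Longrightarrow> (\<And>x. x \<in> S \<Longrightarrow> f x > 0) \<Longrightarrow> smooth_on (\<lambda>x. sqrt (f x)) S"
  using smooth_on_compose[of S "{0<..}" f sqrt] Ck_on_sqrt by (auto simp: smooth_on_def o_def)

section \<open>Symmetry of second derivatives and the Poincare lemma\<close>

lemma has_real_derivative_along_line:
  fixes f :: "'a::real_normed_vector \<Rightarrow> real"
  assumes "(f has_derivative f') (at (p + s *\<^sub>R u))"
  shows "((\<lambda>s. f (p + s *\<^sub>R u)) has_real_derivative f' u) (at s)"
proof -
  have "((\<lambda>s. p + s *\<^sub>R u) has_derivative (\<lambda>h. h *\<^sub>R u)) (at s)"
    by (auto intro!: derivative_eq_intros)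
  from diff_chain_at[OF this assms] have "((\<lambda>s. f (p + s *\<^sub>R u)) has_derivative (\<lambda>h. f' (h *\<^sub>R u))) (at s)"
    by (simp add: o_def)
  moreover have "(\<lambda>h. f' (h *\<^sub>R u)) = (*) (f' u)"
    using linear_scale[OF has_derivative_linear[OF assms]] by (auto simp: mult.commute)
  ultimately show ?thesis by (simp add: has_field_derivative_def)
qed

text \<open>The mean value theorem is applied twice: to the difference of f along two sides parallel
  to a, then to its derivative in the direction b. The second difference is symmetric in a and b
  while the order of differentiation on the right is not, and this is the source of the symmetry of
  second derivatives.\<close>

lemma second_difference_mean_value:
  fixes f :: "'a::euclidean_space \<Rightarrow> real"
  assumes f: "Ck_on (Suc (Suc 0)) f S" and "h > 0"
    and S: "\<And>s t. \<lbrakk>0 \<le> s; s \<le> h; 0 \<le> t; t \<le> h\<rbrakk> \<Longrightarrow> x + s *\<^sub>R a + t *\<^sub>R b \<in> S"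
  shows "\<exists>s t. 0 < s \<and> s < h \<and> 0 < t \<and> t < h \<and>
    f (x + h *\<^sub>R a + h *\<^sub>R b) - f (x + h *\<^sub>R a) - f (x + h *\<^sub>R b) + f x =
      h * h * frechet_derivative (\<lambda>y. frechet_derivative f (at y) a) (at (x + s *\<^sub>R a + t *\<^sub>R b)) b"
proof -
  let ?D = "\<lambda>y. frechet_derivative f (at y)"
  have "\<exists>s>0. s < h \<and> (f (x + h *\<^sub>R b + h *\<^sub>R a) - f (x + h *\<^sub>R a)) - (f (x + h *\<^sub>R b + 0 *\<^sub>R a) - f (x + 0 *\<^sub>R a))
      = (h - 0) * (?D (x + h *\<^sub>R b + s *\<^sub>R a) a - ?D (x + s *\<^sub>R a) a)"
  proof (rule MVT2[OF \<open>h > 0\<close>, of "\<lambda>s. f (x + h *\<^sub>R b + s *\<^sub>R a) - f (x + s *\<^sub>R a)"])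
    fix s assume "0 \<le> s" "s \<le> h"
    then have "x + h *\<^sub>R b + s *\<^sub>R a \<in> S" "x + s *\<^sub>R a \<in> S"
      using S[of s h] S[of s 0] \<open>h > 0\<close> by (auto simp: algebra_simps)
    then show "((\<lambda>s. f (x + h *\<^sub>R b + s *\<^sub>R a) - f (x + s *\<^sub>R a)) has_real_derivative
        ?D (x + h *\<^sub>R b + s *\<^sub>R a) a - ?D (x + s *\<^sub>R a) a) (at s)"
      by (intro DERIV_diff has_real_derivative_along_line Ck_on_SucD(1)[OF f])
  qed
  then obtain s where s: "0 < s" "s < h" and
    1: "f (x + h *\<^sub>R a + h *\<^sub>R b) - f (x + h *\<^sub>R a) - f (x + h *\<^sub>R b) + f x
      = h * (?D (x + s *\<^sub>R a + h *\<^sub>R b) a - ?D (x + s *\<^sub>R a) a)"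
    by (auto simp: algebra_simps)
  have "\<exists>t>0. t < h \<and> ?D (x + s *\<^sub>R a + h *\<^sub>R b) a - ?D (x + s *\<^sub>R a + 0 *\<^sub>R b) a
      = (h - 0) * frechet_derivative (\<lambda>y. ?D y a) (at (x + s *\<^sub>R a + t *\<^sub>R b)) b"
  proof (rule MVT2[OF \<open>h > 0\<close>, of "\<lambda>t. ?D (x + s *\<^sub>R a + t *\<^sub>R b) a"])
    fix t assume "0 \<le> t" "t \<le> h"
    then have "x + s *\<^sub>R a + t *\<^sub>R b \<in> S"
      using S[of s t] s by auto
    then show "((\<lambda>t. ?D (x + s *\<^sub>R a + t *\<^sub>R b) a) has_real_derivative
        frechet_derivative (\<lambda>y. ?D y a) (at (x + s *\<^sub>R a + t *\<^sub>R b)) b) (at t)"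
      by (intro has_real_derivative_along_line[where f = "\<lambda>y. ?D y a"] Ck_on_SucD(1)[OF Ck_on_SucD(2)[OF f]])
  qed
  then show ?thesis using s 1 by force
qed

lemma symmetric_second_derivative_real:
  fixes f :: "'a::euclidean_space \<Rightarrow> real"
  assumes "open S" "x \<in> S" and f: "Ck_on (Suc (Suc 0)) f S"
  shows "frechet_derivative (\<lambda>y. frechet_derivative f (at y) a) (at x) b =
         frechet_derivative (\<lambda>y. frechet_derivative f (at y) b) (at x) a"
proof (rule ccontr)
  define P where "P = (\<lambda>a b y. frechet_derivative (\<lambda>y. frechet_derivative f (at y) a) (at y) b)"
  assume "\<not> ?thesis"
  then have "\<bar>P a b x - P b a x\<bar> > 0" (is "?d > 0") by (simp add: P_def)
  have "isCont (P a b) x" "isCont (P b a) x"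
    using Ck_on_imp_continuous_on[OF Ck_on_SucD(2)[OF Ck_on_SucD(2)[OF f]]] assms(1,2)
    unfolding P_def by (auto simp: continuous_on_eq_continuous_at)
  then obtain e1 e2 where e12: "e1 > 0" "\<And>y. dist y x < e1 \<Longrightarrow> dist (P a b y) (P a b x) < ?d / 2"
    "e2 > 0" "\<And>y. dist y x < e2 \<Longrightarrow> dist (P b a y) (P b a x) < ?d / 2"
    using \<open>?d > 0\<close> unfolding continuous_at_eps_delta by (metis half_gt_zero)
  obtain e3 where e3: "e3 > 0" "\<And>y. dist y x < e3 \<Longrightarrow> y \<in> S"
    using assms(1,2) unfolding open_dist by metis
  define e where "e = min e1 (min e2 e3)"
  have e: "e > 0"
    "\<And>y. dist y x < e \<Longrightarrow> dist (P a b y) (P a b x) < ?d / 2 \<and> dist (P b a y) (P b a x) < ?d / 2 \<and> y \<in> S"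
    using e12 e3 by (auto simp: e_def)
  \<comment> \<open>Small enough for the whole parallelogram spanned by h * a and h * b to stay
    within distance e of x; the summand 1 covers a = b = 0.\<close>
  define h where "h = e / (2 * (norm a + norm b + 1))"
  have pos: "norm a + norm b + 1 > 0" by (simp add: add_nonneg_pos)
  then have "h > 0" using e(1) by (simp add: h_def)
  have near: "dist (x + s *\<^sub>R a + t *\<^sub>R b) x < e" if "0 \<le> s" "s \<le> h" "0 \<le> t" "t \<le> h" for s t
  proof -
    have "dist (x + s *\<^sub>R a + t *\<^sub>R b) x \<le> s * norm a + t * norm b"
      using norm_triangle_ineq[of "s *\<^sub>R a" "t *\<^sub>R b"] that by (simp add: dist_norm)
    also have "\<dots> \<le> h * norm a + h * norm b"
      using that by (intro add_mono mult_right_mono) auto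
    also have "\<dots> \<le> h * (norm a + norm b + 1)"
      using \<open>h > 0\<close> by (simp add: algebra_simps)
    also have "\<dots> = e / 2" using pos by (simp add: h_def field_simps)
    also have "\<dots> < e" using e(1) by simp
    finally show ?thesis .
  qed
  obtain s t where st: "0 < s" "s < h" "0 < t" "t < h" "f (x + h *\<^sub>R a + h *\<^sub>R b) - f (x + h *\<^sub>R a) - f (x + h *\<^sub>R b) + f x =
      h * h * P a b (x + s *\<^sub>R a + t *\<^sub>R b)"
    using second_difference_mean_value[OF f \<open>h > 0\<close>, of x a b] near e(2) unfolding P_def by blast
  have near': "dist (x + t *\<^sub>R b + s *\<^sub>R a) x < e" if "0 \<le> s" "s \<le> h" "0 \<le> t" "t \<le> h" for s t
    using near[OF that] by (simp add: algebra_simps)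
  obtain s' t' where st': "0 < s'" "s' < h" "0 < t'" "t' < h" "f (x + h *\<^sub>R b + h *\<^sub>R a) - f (x + h *\<^sub>R b) - f (x + h *\<^sub>R a) + f x =
      h * h * P b a (x + s' *\<^sub>R b + t' *\<^sub>R a)"
    using second_difference_mean_value[OF f \<open>h > 0\<close>, of x b a] near' e(2) unfolding P_def by blast
  have "h * h * P a b (x + s *\<^sub>R a + t *\<^sub>R b) = h * h * P b a (x + s' *\<^sub>R b + t' *\<^sub>R a)"
    using st(5) st'(5) by (simp add: algebra_simps)
  then have "P a b (x + s *\<^sub>R a + t *\<^sub>R b) = P b a (x + s' *\<^sub>R b + t' *\<^sub>R a)"
    using \<open>h > 0\<close> by simp
  moreover have "dist (P a b (x + s *\<^sub>R a + t *\<^sub>R b)) (P a b x) < ?d / 2"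
    "dist (P b a (x + s' *\<^sub>R b + t' *\<^sub>R a)) (P b a x) < ?d / 2"
    using near near' e(2) st(1-4) st'(1-4) by (meson less_imp_le)+
  ultimately show False by (simp add: dist_real_def abs_if split: if_splits)
qed

lemma symmetric_second_derivative:
  fixes f :: "'a::euclidean_space \<Rightarrow> 'b::euclidean_space"
  assumes "open S" "x \<in> S" and f: "Ck_on (Suc (Suc 0)) f S"
  shows "frechet_derivative (\<lambda>y. frechet_derivative f (at y) a) (at x) b =
         frechet_derivative (\<lambda>y. frechet_derivative f (at y) b) (at x) a"
proof (rule euclidean_eqI)
  fix i :: 'b assume "i \<in> Basis"
  have c: "frechet_derivative (\<lambda>y. g y \<bullet> i) (at y) v = frechet_derivative g (at y) v \<bullet> i"
    if "Ck_on (Suc k) g S" "y \<in> S" for g :: "'a \<Rightarrow> 'b" and y v k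
    using frechet_derivative_eq[OF has_derivative_inner_left[OF Ck_on_SucD(1)[OF that]]] by simp
  have "frechet_derivative (\<lambda>y. frechet_derivative f (at y) a) (at x) b \<bullet> i =
      frechet_derivative (\<lambda>y. frechet_derivative (\<lambda>y. f y \<bullet> i) (at y) a) (at x) b" for a b
  proof -
    have "frechet_derivative (\<lambda>y. frechet_derivative f (at y) a) (at x) b \<bullet> i =
      frechet_derivative (\<lambda>y. frechet_derivative f (at y) a \<bullet> i) (at x) b"
      using c[OF Ck_on_SucD(2)[OF f] assms(2)] by simp
    also have "\<dots> = frechet_derivative (\<lambda>y. frechet_derivative (\<lambda>y. f y \<bullet> i) (at y) a) (at x) b"
      by (subst frechet_derivative_cong[OF assms(1,2)]) (use c[OF f] in auto)
    finally show ?thesis .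
  qed
  then show "frechet_derivative (\<lambda>y. frechet_derivative f (at y) a) (at x) b \<bullet> i =
      frechet_derivative (\<lambda>y. frechet_derivative f (at y) b) (at x) a \<bullet> i"
    using symmetric_second_derivative_real[OF assms(1,2)
        Ck_on_bounded_linear_compose[OF bounded_linear_inner_left assms(1) f]]
    by simp
qed

text \<open>The primitive integrates the form along the segment from the centre z to x. It is
  differentiated under the integral sign, and closedness turns the resulting integrand into a
  derivative in the segment parameter t.\<close>

lemma closed_form_exact_on_ball:
  fixes \<alpha> :: "'a::euclidean_space \<Rightarrow> 'a \<Rightarrow> real"
  assumes lin: "\<And>x. x \<in> ball z r \<Longrightarrow> linear (\<alpha> x)"
    and smooth: "\<And>v. smooth_on (\<lambda>x. \<alpha> x v) (ball z r)"
    and closed: "\<And>x a b. x \<in> ball z r \<Longrightarrow>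
      frechet_derivative (\<lambda>x. \<alpha> x a) (at x) b = frechet_derivative (\<lambda>x. \<alpha> x b) (at x) a"
  obtains f where "smooth_on f (ball z r)" "\<And>x. x \<in> ball z r \<Longrightarrow> (f has_derivative \<alpha> x) (at x)"
proof
  let ?B = "ball z r"
  define D where "D = (\<lambda>x v. frechet_derivative (\<lambda>x. \<alpha> x v) (at x))"
  define w where "w = (\<lambda>x t. z + t *\<^sub>R (x - z))"
  define g where "g = (\<lambda>x t. \<Sum>i\<in>Basis. ((x - z) \<bullet> i) * \<alpha> (w x t) i)"
  \<comment> \<open>The derivative of the integrand \<open>g\<close> in x. It is packed as a bounded
    linear map because \<open>leibniz_rule\<close> asks for joint continuity in that type;
    continuity is then tested on basis vectors.\<close>
  define g' where "g' = (\<lambda>x t. Blinfun (\<lambda>u. \<Sum>i\<in>Basis. ((x - z) \<bullet> i) * D (w x t) i (t *\<^sub>R u) + (u \<bullet> i) * \<alpha> (w x t) i))"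
  define f where "f = (\<lambda>x. integral (cbox 0 1) (g x))"
  have w: "w x t \<in> ?B" if "x \<in> ?B" "t \<in> cbox 0 1" for x t
  proof -
    have "t * norm (x - z) \<le> 1 * norm (x - z)" using that by (intro mult_right_mono) auto
    then show ?thesis using that by (auto simp: w_def dist_norm norm_minus_commute)
  qed
  have D: "((\<lambda>x. \<alpha> x v) has_derivative D x v) (at x)" if "x \<in> ?B" for x v
    unfolding D_def by (rule smooth_on_has_derivative[OF smooth that])
  have dw: "((\<lambda>x. w x t) has_derivative (\<lambda>u. t *\<^sub>R u)) (at x)" for x t
    unfolding w_def by (auto intro!: derivative_eq_intros)
  have bl: "bounded_linear (\<lambda>u. \<Sum>i\<in>Basis. ((x - z) \<bullet> i) * D (w x t) i (t *\<^sub>R u) + (u \<bullet> i) * \<alpha> (w x t) i)"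
    if "x \<in> ?B" "t \<in> cbox 0 1" for x t
  proof -
    have "bounded_linear (\<lambda>u. D (w x t) i (t *\<^sub>R u))" for i
      by (rule bounded_linear_compose[OF has_derivative_bounded_linear[OF D[OF w[OF that]]]
            bounded_linear_scaleR_right])
    then show ?thesis
      by (intro bounded_linear_sum bounded_linear_add
          bounded_linear_mult_const[OF bounded_linear_inner_left] bounded_linear_const_mult)
  qed
  have g'_eq: "blinfun_apply (g' x t) u = (\<Sum>i\<in>Basis. ((x - z) \<bullet> i) * D (w x t) i (t *\<^sub>R u) + (u \<bullet> i) * \<alpha> (w x t) i)"
    if "x \<in> ?B" "t \<in> cbox 0 1" for x t u
    unfolding g'_def by (subst bounded_linear_Blinfun_apply[OF bl[OF that]]) simp
  have dg: "((\<lambda>x. g x t) has_derivative blinfun_apply (g' x t)) (at x within ?B)"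
    if "x \<in> ?B" "t \<in> cbox 0 1" for x t
  proof -
    have "((\<lambda>x. \<alpha> (w x t) i) has_derivative (\<lambda>u. D (w x t) i (t *\<^sub>R u))) (at x)" for i
      using diff_chain_at[OF dw D[OF w[OF that]]] by (simp add: o_def)
    then have "((\<lambda>x. g x t) has_derivative (\<lambda>u. \<Sum>i\<in>Basis. ((x - z) \<bullet> i) * D (w x t) i (t *\<^sub>R u) + (u \<bullet> i) * \<alpha> (w x t) i)) (at x)"
      unfolding g_def by (auto intro!: derivative_eq_intros)
    moreover have "blinfun_apply (g' x t) = (\<lambda>u. \<Sum>i\<in>Basis. ((x - z) \<bullet> i) * D (w x t) i (t *\<^sub>R u) + (u \<bullet> i) * \<alpha> (w x t) i)"
      using g'_eq[OF that] by blast
    ultimately show ?thesis by (simp add: has_derivative_at_withinI)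
  qed
  have cw: "continuous_on (?B \<times> cbox 0 1) (\<lambda>y. F (w (fst y) (snd y)))"
    if "continuous_on ?B F" for F :: "'a \<Rightarrow> real"
    by (rule continuous_on_compose2[OF that]) (auto simp: w_def[symmetric] intro!: w,
        auto simp: w_def intro!: continuous_intros)
  have c\<alpha>: "continuous_on ?B (\<lambda>y. \<alpha> y i)" for i
    by (rule smooth_on_imp_continuous_on[OF smooth])
  have cD: "continuous_on ?B (\<lambda>y. D y i j)" for i j
    unfolding D_def by (rule smooth_on_imp_continuous_on[OF smooth_on_frechet_derivative[OF smooth]])
  have cont: "continuous_on (?B \<times> cbox 0 1) (\<lambda>(x, t). g' x t)"
  proof (rule continuous_on_blinfun_componentwise)
    fix j :: 'a assume "j \<in> Basis"
    have "D (w x t) i (t *\<^sub>R j) = t * D (w x t) i j" if "x \<in> ?B" "t \<in> cbox 0 1" for x t i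
      using linear_scale[OF has_derivative_linear[OF D[OF w[OF that]]]] by simp
    then have "blinfun_apply (case y of (x, t) \<Rightarrow> g' x t) j =
      (\<Sum>i\<in>Basis. ((fst y - z) \<bullet> i) * (snd y * D (w (fst y) (snd y)) i j) + (j \<bullet> i) * \<alpha> (w (fst y) (snd y)) i)"
      if "y \<in> ?B \<times> cbox 0 1" for y
      using that g'_eq by (auto simp: split_beta)
    then show "continuous_on (?B \<times> cbox 0 1) (\<lambda>y. blinfun_apply (case y of (x, t) \<Rightarrow> g' x t) j)"
      by (subst continuous_on_cong[OF refl], assumption)
        (intro continuous_intros cw[OF c\<alpha>] cw[OF cD])
  qed
  have cont1: "continuous_on (cbox 0 1) (\<lambda>t. F (w x t))" if "continuous_on ?B F" "x \<in> ?B" for F :: "'a \<Rightarrow> real" and x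
    by (rule continuous_on_compose2[OF that(1)]) (use w that in \<open>auto simp: w_def intro!: continuous_intros\<close>)
  have int: "g x integrable_on cbox 0 1" if "x \<in> ?B" for x
    unfolding g_def by (intro integrable_continuous continuous_intros cont1[OF c\<alpha> that])
  show der: "(f has_derivative \<alpha> x) (at x)" if x: "x \<in> ?B" for x
  proof -
    have "(f has_derivative integral (cbox 0 1) (g' x)) (at x within ?B)"
      unfolding f_def by (rule leibniz_rule[OF dg int cont x convex_ball])
    moreover have "blinfun_apply (integral (cbox 0 1) (g' x)) u = \<alpha> x u" for u
    proof -
      have "continuous_on (cbox 0 1) (\<lambda>t. case (x, t) of (x, t) \<Rightarrow> g' x t)"
        by (rule continuous_on_compose2[OF cont]) (use x in \<open>auto intro!: continuous_intros\<close>)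
      then have "blinfun_apply (integral (cbox 0 1) (g' x)) u = integral (cbox 0 1) (\<lambda>t. blinfun_apply (g' x t) u)"
        by (intro blinfun_apply_integral integrable_continuous) (simp add: split_beta)
      \<comment> \<open>By closedness the integrand is the derivative of t * \<alpha> (w x t) u,
        whose boundary values are \<alpha> x u at t = 1 and 0 at t = 0.\<close>
      moreover have "((\<lambda>t. blinfun_apply (g' x t) u) has_integral 1 *\<^sub>R \<alpha> (w x 1) u - 0 *\<^sub>R \<alpha> (w x 0) u) {0..1}"
      proof (rule fundamental_theorem_of_calculus)
        fix t :: real assume "t \<in> {0..1}"
        then have t: "t \<in> cbox 0 1" by simp
        note wt = w[OF x t]
        have lD: "linear (D (w x t) i)" for i
          by (rule has_derivative_linear[OF D[OF wt]])
        have "blinfun_apply (g' x t) u = t * (\<Sum>i\<in>Basis. ((x - z) \<bullet> i) * D (w x t) i u) + (\<Sum>i\<in>Basis. (u \<bullet> i) * \<alpha> (w x t) i)"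
          using linear_scale[OF lD] by (simp add: g'_eq[OF x t] sum.distrib sum_distrib_left mult.left_commute)
        also have "(\<Sum>i\<in>Basis. (u \<bullet> i) * \<alpha> (w x t) i) = \<alpha> (w x t) u"
          using linear_sum[OF lin[OF wt], of "\<lambda>i. (u \<bullet> i) *\<^sub>R i" Basis] linear_scale[OF lin[OF wt]]
          by (simp add: euclidean_representation)
        also have "(\<Sum>i\<in>Basis. ((x - z) \<bullet> i) * D (w x t) i u) = (\<Sum>i\<in>Basis. ((x - z) \<bullet> i) * D (w x t) u i)"
          using closed[OF wt] by (simp add: D_def)
        also have "\<dots> = D (w x t) u (x - z)"
          using linear_sum[OF lD[of u], of "\<lambda>i. ((x - z) \<bullet> i) *\<^sub>R i" Basis] linear_scale[OF lD]
          by (simp add: euclidean_representation)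
        finally have eq: "blinfun_apply (g' x t) u = t * D (w x t) u (x - z) + \<alpha> (w x t) u" .
        have "((\<lambda>t. \<alpha> (w x t) u) has_real_derivative D (w x t) u (x - z)) (at t)"
          using has_real_derivative_along_line[where f = "\<lambda>y. \<alpha> y u", OF D[OF wt, unfolded w_def]]
          by (simp add: w_def)
        then have "((\<lambda>t. t * \<alpha> (w x t) u) has_real_derivative blinfun_apply (g' x t) u) (at t)"
          unfolding eq by (auto intro!: derivative_eq_intros)
        then show "((\<lambda>t. t *\<^sub>R \<alpha> (w x t) u) has_vector_derivative blinfun_apply (g' x t) u) (at t within {0..1})"
          by (simp add: has_real_derivative_iff_has_vector_derivative has_vector_derivative_at_within)
      qed simp
      ultimately show ?thesis by (simp add: w_def integral_unique)
    qed
    then have "blinfun_apply (integral (cbox 0 1) (g' x)) = \<alpha> x" by blast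
    ultimately show ?thesis using at_within_open[OF x open_ball] by simp
  qed
  show "smooth_on f ?B"
    by (rule smooth_onI_derivative[OF open_ball der smooth])
qed

section \<open>The unit tangent bundle and the symplectic form\<close>

lemma mink_eq_inner: "mink x y = x \<bullet> y - 2 * (x $ Inr 2 * y $ Inr 2)"
  using sum.remove[of UNIV "Inr 2" "\<lambda>i. x $ i * y $ i"]
  by (simp add: mink_def inner_vec_def)

text \<open>Turns \<open>mink\<close> into the Euclidean inner product, so that bilinearity and the
  dimension of orthogonal complements can be taken from there.\<close>

definition time_reflection :: "'n::finite minkowski \<Rightarrow> 'n minkowski" where
  "time_reflection y = y - (2 * y $ Inr 2) *\<^sub>R axis (Inr 2) 1"

lemma mink_eq_inner_time_reflection: "mink x y = time_reflection x \<bullet> y"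
  by (simp add: time_reflection_def mink_eq_inner inner_diff_left inner_axis')

lemma bounded_linear_time_reflection: "bounded_linear time_reflection"
  unfolding time_reflection_def[abs_def]
  by (intro bounded_linear_sub bounded_linear_ident bounded_linear_compose[OF bounded_linear_scaleR_left]
      bounded_linear_mult_right bounded_linear_compose[OF bounded_linear_mult_right bounded_linear_vec_nth])

lemma bounded_bilinear_mink: "bounded_bilinear (mink :: 'n::finite minkowski \<Rightarrow> _)"
  unfolding mink_eq_inner_time_reflection[abs_def]
  by (rule bounded_bilinear.comp[OF bounded_bilinear_inner bounded_linear_time_reflection bounded_linear_ident])

interpretation mink: bounded_bilinear mink
  by (rule bounded_bilinear_mink)

lemmas smooth_on_mink = smooth_on_bounded_bilinear[OF bounded_bilinear_mink]

lemmas mink_simps = mink.add_left mink.add_right mink.diff_left mink.diff_right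
  mink.minus_left mink.minus_right mink.scaleR_left mink.scaleR_right mink.zero_left mink.zero_right

lemma mink_spatial:
  "mink x y + x $ Inr 2 * y $ Inr 2 = (x - (x $ Inr 2) *\<^sub>R axis (Inr 2) 1) \<bullet> (y - (y $ Inr 2) *\<^sub>R axis (Inr 2) 1)"
  by (simp add: mink_eq_inner inner_diff_left inner_diff_right inner_axis inner_axis' algebra_simps)

text \<open>\<open>mink x y\<close> plus the product of the time coordinates is the Euclidean
  product of the spatial parts, so this is Cauchy-Schwarz in space. The causal facts below are read
  off from it.\<close>

lemma mink_spatial_Cauchy_Schwarz:
  "(mink x y + x $ Inr 2 * y $ Inr 2)\<^sup>2 \<le> (mink x x + (x $ Inr 2)\<^sup>2) * (mink y y + (y $ Inr 2)\<^sup>2)"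
  unfolding power2_eq_square[of "_ $ _"] mink_spatial
  using Cauchy_Schwarz_ineq by blast

lemma mink_spatial_nonneg: "mink x x + (x $ Inr 2)\<^sup>2 \<ge> 0"
  unfolding power2_eq_square mink_spatial by simp

lemma mink_spatial_eq_0:
  assumes "mink x x + (x $ Inr 2)\<^sup>2 = 0" "x $ Inr 2 = 0" shows "x = 0"
  using assms unfolding power2_eq_square mink_spatial by simp

text \<open>With X and W the squared time coordinates of x and w, orthogonality turns Cauchy-Schwarz
  into \<open>mink w w\<close> + W \<le> X * \<open>mink w w\<close>, whose left side is
  nonnegative. A nonpositive \<open>mink w w\<close> would make everything vanish.\<close>

lemma mink_pos_orthogonal:
  assumes "x \<in> hyperboloid" "mink x w = 0" "w \<noteq> 0"
  shows "mink w w > 0"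
proof (rule ccontr)
  assume neg: "\<not> ?thesis"
  let ?X = "(x $ Inr 2)\<^sup>2" and ?W = "(w $ Inr 2)\<^sup>2"
  have X: "?X > 0" "mink x x = -1" using assms by (auto simp: hyperboloid_def)
  have "?X * ?W \<le> (?X - 1) * (mink w w + ?W)"
    using mink_spatial_Cauchy_Schwarz[of x w] assms(2) X by (simp add: power_mult_distrib algebra_simps)
  then have "mink w w + ?W \<le> ?X * mink w w" by (simp add: algebra_simps)
  also have "\<dots> \<le> 0" using X neg by (simp add: mult_le_0_iff)
  finally have 0: "mink w w + ?W = 0" using mink_spatial_nonneg[of w] by linarith
  moreover have "?X * mink w w \<ge> 0" using 0 \<open>mink w w + ?W \<le> ?X * mink w w\<close> by simp
  ultimately have "mink w w = 0" using X neg by (simp add: zero_le_mult_iff)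
  then show False using 0 mink_spatial_eq_0[of w] assms(3) by simp
qed

lemma mink_nonneg_orthogonal: "x \<in> hyperboloid \<Longrightarrow> mink x w = 0 \<Longrightarrow> mink w w \<ge> 0"
  using mink_pos_orthogonal[of x w] by (cases "w = 0") (auto simp: mink_simps)

lemma unit_tangent_iff:
  "(x, v) \<in> unit_tangent \<longleftrightarrow> mink x x = -1 \<and> x $ Inr 2 > 0 \<and> mink x v = 0 \<and> mink v v = 1"
  by (auto simp: unit_tangent_def hyperboloid_def)

text \<open>Geometrically, x + v and x - v are future directed; this keeps the geodesic flow on the
  upper sheet.\<close>

lemma unit_tangent_time_component:
  assumes "(x, v) \<in> unit_tangent" shows "\<bar>v $ Inr 2\<bar> < x $ Inr 2"
proof -
  have h: "mink x x = -1" "x $ Inr 2 > 0" "mink x v = 0" "mink v v = 1"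
    using assms by (auto simp: unit_tangent_iff)
  have "(v $ Inr 2)\<^sup>2 < (x $ Inr 2)\<^sup>2"
    using mink_spatial_Cauchy_Schwarz[of x v] h by (simp add: power_mult_distrib algebra_simps)
  then show ?thesis using h(2) by (metis abs_of_pos power2_abs power2_less_imp_less abs_ge_zero)
qed

text \<open>The sheets are told apart by the product with a point of the upper one: if the time
  coordinates had a product of at most 0, a negative Minkowski product would make the spatial
  product larger in absolute value than Cauchy-Schwarz allows.\<close>

lemma hyperboloid_sheet:
  assumes "y \<in> hyperboloid" "mink x x = -1" "mink x y < 0" shows "x \<in> hyperboloid"
proof (rule ccontr)
  assume "x \<notin> hyperboloid"
  then have x: "x $ Inr 2 \<le> 0" using assms(2) by (simp add: hyperboloid_def)
  have y: "y $ Inr 2 > 0" "mink y y = -1" using assms(1) by (auto simp: hyperboloid_def)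
  let ?X = "(x $ Inr 2)\<^sup>2" and ?Y = "(y $ Inr 2)\<^sup>2"
  have XY: "?X \<ge> 1" "?Y \<ge> 1" using mink_spatial_nonneg[of x] mink_spatial_nonneg[of y] assms(2) y by auto
  have "x $ Inr 2 * y $ Inr 2 \<le> 0" using x y by (simp add: mult_le_0_iff)
  then have "(x $ Inr 2 * y $ Inr 2)\<^sup>2 < (mink x y + x $ Inr 2 * y $ Inr 2)\<^sup>2"
    using assms(3) power_strict_mono[of "- (x $ Inr 2 * y $ Inr 2)" "- (mink x y + x $ Inr 2 * y $ Inr 2)" 2]
    unfolding power2_minus by simp
  also have "\<dots> \<le> (?X - 1) * (?Y - 1)"
    using mink_spatial_Cauchy_Schwarz[of x y] assms(2) y by (simp add: add.commute)
  finally show False using XY by (simp add: power_mult_distrib algebra_simps)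
qed

section \<open>The geodesic flow and its orbits\<close>

lemma geod_flow_simp:
  "geod_flow t z = (cosh t *\<^sub>R fst z + sinh t *\<^sub>R snd z, sinh t *\<^sub>R fst z + cosh t *\<^sub>R snd z)"
  by (simp add: geod_flow_def split_beta)

lemma geod_flow_0 [simp]: "geod_flow 0 z = z"
  by (simp add: geod_flow_simp)

lemma geod_flow_add: "geod_flow s (geod_flow t z) = geod_flow (s + t) z"
  by (simp add: geod_flow_simp cosh_add sinh_add algebra_simps)

lemma bounded_linear_geod_flow: "bounded_linear (geod_flow t)"
  unfolding geod_flow_simp[abs_def] by (intro bounded_linear_intros bounded_linear_fst bounded_linear_snd)

lemma geod_flow_unit_tangent:
  assumes "z \<in> unit_tangent" shows "geod_flow t z \<in> unit_tangent"
proof -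
  obtain x v where z: "z = (x, v)" by (cases z)
  have h: "mink x x = -1" "x $ Inr 2 > 0" "mink x v = 0" "mink v v = 1" "mink v x = 0"
    using assms by (auto simp: unit_tangent_iff z mink_commute)
  have cs: "cosh t * cosh t = 1 + sinh t * sinh t" using cosh_square_eq[of t] by (simp add: power2_eq_square)
  \<comment> \<open>This makes the time coordinate of the moved point positive.\<close>
  have "\<bar>sinh t * v $ Inr 2\<bar> \<le> cosh t * \<bar>v $ Inr 2\<bar>"
    unfolding abs_mult using sinh_le_cosh_real[of "\<bar>t\<bar>"] by (intro mult_right_mono) auto
  also have "\<dots> < cosh t * x $ Inr 2"
    using unit_tangent_time_component[of x v] assms z by simp
  finally show ?thesis
    using h cs by (auto simp: geod_flow_simp z unit_tangent_iff mink_simps algebra_simps)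
qed

lemma geod_proj_flow [simp]: "geod_proj (geod_flow t z) = geod_proj z"
proof -
  have "surj (\<lambda>s. s + t)" by (rule surjI[of _ "\<lambda>s. s - t"]) simp
  then have "range (\<lambda>s. geod_flow (s + t) z) = range (\<lambda>s. geod_flow s z)"
    using image_image[of "\<lambda>s. geod_flow s z" "\<lambda>s. s + t" UNIV] by simp
  then show ?thesis by (simp add: geod_proj_def geod_flow_add)
qed

lemma geod_proj_eqD:
  assumes "geod_proj z = geod_proj z'" obtains t where "z = geod_flow t z'"
proof -
  have "z \<in> geod_proj z" unfolding geod_proj_def by (metis geod_flow_0 rangeI)
  then show ?thesis using assms that by (auto simp: geod_proj_def)
qed

section \<open>Tangent spaces of the unit tangent bundle\<close>

lemma perp_iff: "w \<in> perp z \<longleftrightarrow> mink (fst z) w = 0 \<and> mink (snd z) w = 0"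
  by (auto simp: perp_def split_beta)

lemma subspace_perp: "subspace (perp z)"
  by (auto simp: subspace_def perp_iff mink_simps)

text \<open>The right side is the kernel of the differentials of the three equations <x,x> = -1,
  <x,v> = 0 and <v,v> = 1, so the sum defining \<open>tangent_T1\<close> is the geometric tangent
  space. The coefficient of the generator is <X1,v>, and the middle equation makes the vertical
  remainder orthogonal to x.\<close>

lemma tangent_T1_iff:
  assumes "z \<in> unit_tangent"
  shows "X \<in> tangent_T1 z \<longleftrightarrow> mink (fst z) (fst X) = 0 \<and>
    mink (fst X) (snd z) + mink (fst z) (snd X) = 0 \<and> mink (snd z) (snd X) = 0"
proof -
  obtain x v where z: "z = (x, v)" by (cases z)
  obtain X1 X2 where X: "X = (X1, X2)" by (cases X)
  have h: "mink x x = -1" "mink x v = 0" "mink v v = 1" "mink v x = 0"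
    using assms by (auto simp: unit_tangent_iff z mink_commute)
  show ?thesis
  proof
    assume "X \<in> tangent_T1 z"
    then show "mink (fst z) (fst X) = 0 \<and>
        mink (fst X) (snd z) + mink (fst z) (snd X) = 0 \<and> mink (snd z) (snd X) = 0"
      using h by (auto simp: tangent_T1_def z flow_gen_def hor_def ver_def perp_iff mink_simps mink_commute)
  next
    assume a: "mink (fst z) (fst X) = 0 \<and>
        mink (fst X) (snd z) + mink (fst z) (snd X) = 0 \<and> mink (snd z) (snd X) = 0"
    have "X = mink X1 v *\<^sub>R flow_gen z + hor (X1 - mink X1 v *\<^sub>R v) + ver (X2 - mink X1 v *\<^sub>R x)"
      by (simp add: X z flow_gen_def hor_def ver_def)
    moreover have "X1 - mink X1 v *\<^sub>R v \<in> perp z" "X2 - mink X1 v *\<^sub>R x \<in> perp z"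
      using a h by (auto simp: X z perp_iff mink_simps mink_commute)
    ultimately show "X \<in> tangent_T1 z" unfolding tangent_T1_def by blast
  qed
qed

lemma derivative_in_tangent_T1:
  assumes "(\<zeta> has_derivative \<zeta>') (at y)" "open N" "y \<in> N" "\<And>x. x \<in> N \<Longrightarrow> \<zeta> x \<in> unit_tangent"
  shows "\<zeta>' a \<in> tangent_T1 (\<zeta> y)"
proof -
  have z: "\<zeta> y \<in> unit_tangent" using assms by blast
  have h: "mink (fst (\<zeta> x)) (fst (\<zeta> x)) = -1 \<and> mink (fst (\<zeta> x)) (snd (\<zeta> x)) = 0 \<and> mink (snd (\<zeta> x)) (snd (\<zeta> x)) = 1"
    if "x \<in> N" for x using assms(4)[OF that] by (cases "\<zeta> x") (auto simp: unit_tangent_iff)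
  have const: "f' = (\<lambda>_. 0)" if "(f has_derivative f') (at y)" "\<And>x. x \<in> N \<Longrightarrow> f x = c" for f f' and c :: real
    using has_derivative_unique[OF has_derivative_transform_within_open[OF that(1) assms(2,3) that(2)] has_derivative_const]
    by auto
  note d1 = has_derivative_fst[OF assms(1)] and d2 = has_derivative_snd[OF assms(1)]
  show ?thesis
    using fun_cong[OF const[OF mink.FDERIV[OF d1 d1]], of "-1" a] fun_cong[OF const[OF mink.FDERIV[OF d1 d2]], of 0 a]
      fun_cong[OF const[OF mink.FDERIV[OF d2 d2]], of 1 a] h
    by (simp add: tangent_T1_iff[OF z] mink_commute)
qed

text \<open>Orthogonality to the generator just removes its coefficient. The product form shows that
  \<open>para_J\<close>, which swaps the two factors, preserves this space.\<close>

lemma flow_perp_eq: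
  assumes "z \<in> unit_tangent" shows "flow_perp z = perp z \<times> perp z"
proof -
  have 0: "(0 :: 'a minkowski) \<in> perp z" by (simp add: perp_iff mink_simps)
  have *: "para_sasaki z (s *\<^sub>R flow_gen z + hor w1 + ver w2) (flow_gen z) = s"
    if "w1 \<in> perp z" "w2 \<in> perp z" for s w1 w2
    using para_sasaki_decomposition[OF assms that(1) 0, of s w2 1 0]
    by (simp add: hor_def ver_def mink_simps zero_prod_def[symmetric])
  show ?thesis
  proof (intro equalityI subsetI)
    fix X assume "X \<in> flow_perp z"
    then obtain s w1 w2 where X: "X = s *\<^sub>R flow_gen z + hor w1 + ver w2" "w1 \<in> perp z" "w2 \<in> perp z"
      "para_sasaki z X (flow_gen z) = 0"
      by (auto simp: flow_perp_def tangent_T1_def)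
    then have "s = 0" using *[OF X(2,3)] by simp
    then show "X \<in> perp z \<times> perp z" using X by (simp add: hor_def ver_def)
  next
    fix X assume "X \<in> perp z \<times> perp z"
    then obtain w1 w2 where w: "X = (w1, w2)" "w1 \<in> perp z" "w2 \<in> perp z" by blast
    then have "X = 0 *\<^sub>R flow_gen z + hor w1 + ver w2" by (simp add: hor_def ver_def)
    then show "X \<in> flow_perp z"
      using *[OF w(2,3), of 0] w unfolding flow_perp_def tangent_T1_def by blast
  qed
qed

text \<open>\<open>perp z\<close> is the Euclidean orthogonal complement of the time reflections of
  x and v, which are independent by the values of <x,x>, <x,v> and <v,v>. The count gives
  \<open>flow_perp\<close> the dimension 2n of the space of geodesics.\<close>

lemma dim_perp:
  fixes z :: "'n::finite minkowski \<times> 'n minkowski"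
  assumes "z \<in> unit_tangent" shows "dim (perp z) = CARD('n)"
proof -
  obtain x v where z: "z = (x, v)" by (cases z)
  have h: "mink x x = -1" "mink x v = 0" "mink v v = 1"
    using assms by (auto simp: unit_tangent_iff z)
  let ?R = "time_reflection :: 'n minkowski \<Rightarrow> _"
  note R = mink_eq_inner_time_reflection
  have perp: "perp z = {w \<in> UNIV. \<forall>y\<in>span {?R x, ?R v}. orthogonal y w}"
  proof (intro equalityI subsetI)
    fix w assume "w \<in> perp z"
    then have "\<forall>y\<in>{?R x, ?R v}. y \<bullet> w = 0" by (simp add: perp_iff z R)
    then show "w \<in> {w \<in> UNIV. \<forall>y\<in>span {?R x, ?R v}. orthogonal y w}"
      using orthogonal_to_span[of _ "{?R x, ?R v}" w] by (auto simp: orthogonal_def inner_commute[of w])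
  qed (auto simp: perp_iff z R orthogonal_def span_base)
  have inj: "?R x \<noteq> ?R v" using h R by (metis mink_commute zero_neq_one)
  have "independent {?R x, ?R v}"
  proof -
    have "?R x \<noteq> 0" using h(1) R[of x x] by auto
    moreover have "?R v \<notin> span {?R x}"
    proof
      assume "?R v \<in> span {?R x}"
      then obtain k where "?R v = k *\<^sub>R ?R x" by (auto simp: span_singleton)
      then have "mink v v = k * mink x v" by (simp add: R)
      then show False using h by simp
    qed
    ultimately show ?thesis by (simp add: independent_insert insert_commute[of "?R x"])
  qed
  then have "dim {?R x, ?R v} = 2" using inj by (simp add: dim_eq_card_independent)
  then have "dim (perp z) + 2 = DIM('n minkowski)"
    using dim_subspace_orthogonal_to_vectors[OF subspace_span subspace_UNIV subset_UNIV, of "{?R x, ?R v}"]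
    by (simp add: perp dim_UNIV)
  then show ?thesis by simp
qed

section \<open>The differential of the projection to the space of geodesics\<close>

lemma geod_atlasD:
  assumes "(W, c) \<in> geod_atlas"
  shows "openin geod_top W" "inj_on c W"
    "smooth_on_subset (c \<circ> geod_proj) {z \<in> unit_tangent. geod_proj z \<in> W}"
    "z \<in> unit_tangent \<Longrightarrow> geod_proj z \<in> W \<Longrightarrow> proj_deriv c z ` tangent_T1 z = UNIV"
  using assms by (auto simp: geod_atlas_def)

text \<open>Derivatives within \<open>unit_tangent\<close> are not unique, since this set has empty
  interior, and \<open>proj_deriv\<close> is an arbitrary one of them. One exists because a local
  smooth extension F of \<open>c \<circ> geod_proj\<close> supplies it.\<close>

lemma proj_deriv_has_derivative:
  fixes z :: "'n::finite minkowski \<times> 'n minkowski"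
  assumes "openin geod_top W" "smooth_on_subset (c \<circ> geod_proj) {z \<in> unit_tangent. geod_proj z \<in> W}"
    and "z \<in> unit_tangent" "geod_proj z \<in> W"
  shows "((c \<circ> geod_proj) has_derivative proj_deriv c z) (at z within unit_tangent)"
proof -
  let ?S = "{z \<in> unit_tangent. geod_proj z \<in> W}"
  have "z \<in> ?S" using assms by blast
  from bspec[OF assms(2)[unfolded smooth_on_subset_def] this]
  obtain N F where F: "open N" "z \<in> N" "smooth_on F N" "\<forall>y\<in>?S \<inter> N. F y = (c \<circ> geod_proj) y"
    by (elim exE conjE)
  have "openin (top_of_set unit_tangent) ?S"
    using assms(1) unfolding openin_geod_top by (rule conjunct2)
  then obtain N' where N': "open N'" "?S = unit_tangent \<inter> N'" by (auto simp: openin_open)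
  have "(F has_derivative frechet_derivative F (at z)) (at z within unit_tangent \<inter> (N \<inter> N'))"
    using smooth_on_has_derivative[OF F(3,2)] by (rule has_derivative_at_withinI)
  moreover have "z \<in> unit_tangent \<inter> (N \<inter> N')" using F N' assms by auto
  moreover have "(c \<circ> geod_proj) y = F y" if "y \<in> unit_tangent \<inter> (N \<inter> N')" for y
    using that F(4) N'(2) by auto
  ultimately have "((c \<circ> geod_proj) has_derivative frechet_derivative F (at z)) (at z within unit_tangent \<inter> (N \<inter> N'))"
    by (blast intro: has_derivative_transform)
  moreover have "at z within unit_tangent \<inter> (N \<inter> N') = at z within unit_tangent"
    using F(1,2) N' \<open>z \<in> ?S\<close> by (intro at_within_nhd[of z "N \<inter> N'"]) auto
  ultimately show ?thesis
    unfolding proj_deriv_def by (metis differentiableI frechet_derivative_works)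
qed

text \<open>Along a map into \<open>unit_tangent\<close> the ambiguity of \<open>proj_deriv\<close>
  disappears: the composite is differentiated at an interior point of its domain, where the
  derivative is unique.\<close>

lemma proj_deriv_chain:
  assumes "openin geod_top W" "smooth_on_subset (c \<circ> geod_proj) {z \<in> unit_tangent. geod_proj z \<in> W}"
    and "(\<zeta> has_derivative \<zeta>') (at y)" "open N" "y \<in> N"
    "\<And>x. x \<in> N \<Longrightarrow> \<zeta> x \<in> unit_tangent" "geod_proj (\<zeta> y) \<in> W"
  shows "((\<lambda>x. c (geod_proj (\<zeta> x))) has_derivative (\<lambda>a. proj_deriv c (\<zeta> y) (\<zeta>' a))) (at y)"
proof -
  have "((c \<circ> geod_proj) has_derivative proj_deriv c (\<zeta> y)) (at (\<zeta> y) within \<zeta> ` N)"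
    using proj_deriv_has_derivative[OF assms(1,2) assms(6)[OF assms(5)] assms(7)]
    by (rule has_derivative_subset) (use assms(6) in blast)
  from diff_chain_within[OF has_derivative_at_withinI[OF assms(3)] this]
  show ?thesis using at_within_open[OF assms(5,4)] by (simp add: o_def)
qed

lemma linear_proj_deriv:
  assumes "(W, c) \<in> geod_atlas" "z \<in> unit_tangent" "geod_proj z \<in> W"
  shows "linear (proj_deriv c z)"
  using has_derivative_linear[OF proj_deriv_has_derivative[OF geod_atlasD(1,3)[OF assms(1)] assms(2,3)]] .

lemma geod_flow_has_derivative:
  "((\<lambda>t. geod_flow t z) has_derivative (\<lambda>h. h *\<^sub>R flow_gen (geod_flow s z))) (at s)"
  unfolding geod_flow_simp flow_gen_def
  by (auto intro!: derivative_eq_intros simp: algebra_simps)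

text \<open>Differentiate \<open>c \<circ> geod_proj\<close> along an orbit, where it is
  constant.\<close>

lemma proj_deriv_flow_gen:
  assumes "(W, c) \<in> geod_atlas" "z \<in> unit_tangent" "geod_proj z \<in> W"
  shows "proj_deriv c z (flow_gen z) = 0"
proof -
  have "((\<lambda>t. c (geod_proj (geod_flow t z))) has_derivative
      (\<lambda>h. proj_deriv c (geod_flow 0 z) (h *\<^sub>R flow_gen (geod_flow 0 z)))) (at 0)"
    by (rule proj_deriv_chain[OF geod_atlasD(1,3)[OF assms(1)] geod_flow_has_derivative open_UNIV UNIV_I])
      (simp_all add: assms geod_flow_unit_tangent)
  then have "((\<lambda>t. c (geod_proj z)) has_derivative (\<lambda>h::real. proj_deriv c z (h *\<^sub>R flow_gen z))) (at 0)"
    by simp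
  from fun_cong[OF has_derivative_unique[OF this has_derivative_const], of 1] show ?thesis by simp
qed

text \<open>An isometry between S and the target turns the restriction into a surjective
  endomorphism of a finite-dimensional space.\<close>

lemma linear_surj_on_imp_inj_on:
  fixes f :: "'a::euclidean_space \<Rightarrow> 'b::euclidean_space"
  assumes "linear f" "subspace S" "dim S = DIM('b)" "f ` S = UNIV"
  shows "inj_on f S"
proof -
  have d: "dim S = dim (UNIV :: 'b set)" using assms(3) by (simp add: dim_UNIV)
  obtain h and g :: "'b \<Rightarrow> 'a" where "linear g" "range g = S" and gh: "\<And>x. x \<in> S \<Longrightarrow> g (h x) = x"
    by (rule isometries_subspaces[OF assms(2) subspace_UNIV d]) (rule that; assumption)
  then have "surj (f \<circ> g)" using assms(4) by (metis image_comp)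
  then have "inj (f \<circ> g)"
    using linear_compose[OF \<open>linear g\<close> assms(1)] linear_surjective_imp_injective by blast
  then show ?thesis using gh by (intro inj_onI) (metis comp_apply injD)
qed

text \<open>The generator is mapped to 0, so dropping it from a preimage keeps surjectivity;
  equality of dimensions then gives injectivity. This makes \<open>geod_lift\<close> well
  defined.\<close>

lemma proj_deriv_flow_perp:
  fixes z :: "'n::finite minkowski \<times> 'n minkowski"
  assumes "(W, c) \<in> geod_atlas" "z \<in> unit_tangent" "geod_proj z \<in> W"
  shows "proj_deriv c z ` flow_perp z = UNIV" "inj_on (proj_deriv c z) (flow_perp z)"
proof -
  note lin = linear_proj_deriv[OF assms]
  show 1: "proj_deriv c z ` flow_perp z = UNIV"
  proof (intro equalityI subset_UNIV subsetI)
    fix y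
    obtain X where X: "X \<in> tangent_T1 z" "proj_deriv c z X = y"
      using geod_atlasD(4)[OF assms] by (metis UNIV_I imageE)
    then obtain s w1 w2 where w: "X = s *\<^sub>R flow_gen z + (w1, w2)" "w1 \<in> perp z" "w2 \<in> perp z"
      by (auto simp: tangent_T1_def hor_def ver_def add.assoc)
    then have "proj_deriv c z (w1, w2) = y"
      using X(2) proj_deriv_flow_gen[OF assms] by (simp add: linear_add[OF lin] linear_scale[OF lin])
    then show "y \<in> proj_deriv c z ` flow_perp z"
      using w flow_perp_eq[OF assms(2)] by blast
  qed
  have sub: "subspace (flow_perp z)"
    unfolding flow_perp_eq[OF assms(2)] by (intro subspace_Times subspace_perp)
  have "dim (flow_perp z) = DIM((real^'n) \<times> (real^'n))"
    unfolding flow_perp_eq[OF assms(2)]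
    by (simp add: dim_Times subspace_perp dim_perp[OF assms(2)])
  from linear_surj_on_imp_inj_on[OF lin sub this 1]
  show "inj_on (proj_deriv c z) (flow_perp z)" .
qed

lemma geod_lift_eq:
  assumes "(W, c) \<in> geod_atlas" "z \<in> unit_tangent" "geod_proj z \<in> W" "X \<in> flow_perp z"
  shows "geod_lift c z (proj_deriv c z X) = X"
  unfolding geod_lift_def
  using proj_deriv_flow_perp(2)[OF assms(1-3)] assms(4) by (intro the_equality) (auto dest: inj_onD)

text \<open>X and Y may have flow components: the form on the right ignores them, and so does
  \<open>proj_deriv\<close>. On \<open>flow_perp\<close> the swap of components by
  \<open>para_J\<close> turns the para-Sasaki product into this antisymmetric form.\<close>

lemma geod_Omega_proj_deriv:
  assumes "(W, c) \<in> geod_atlas" "z \<in> unit_tangent" "geod_proj z \<in> W" "geod_point (geod_proj z) = z"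
    and X: "X \<in> tangent_T1 z" and Y: "Y \<in> tangent_T1 z"
  shows "geod_Omega c (geod_proj z) (proj_deriv c z X) (proj_deriv c z Y) =
    mink (fst X) (snd Y) - mink (snd X) (fst Y)"
proof -
  note lin = linear_proj_deriv[OF assms(1-3)]
  obtain x v where z: "z = (x, v)" by (cases z)
  have h: "mink x x = -1" "mink x v = 0" "mink v v = 1" "mink v x = 0"
    using assms(2) by (auto simp: unit_tangent_iff z mink_commute)
  obtain s w1 w2 where w: "X = s *\<^sub>R flow_gen z + (w1, w2)" "w1 \<in> perp z" "w2 \<in> perp z"
    using X by (auto simp: tangent_T1_def hor_def ver_def add.assoc)
  obtain r u1 u2 where u: "Y = r *\<^sub>R flow_gen z + (u1, u2)" "u1 \<in> perp z" "u2 \<in> perp z"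
    using Y by (auto simp: tangent_T1_def hor_def ver_def add.assoc)
  have eq: "proj_deriv c z X = proj_deriv c z (w1, w2)" "proj_deriv c z Y = proj_deriv c z (u1, u2)"
    using proj_deriv_flow_gen[OF assms(1-3)] by (simp_all add: w(1) u(1) linear_add[OF lin] linear_scale[OF lin])
  have "(w1, w2) \<in> flow_perp z" "(u1, u2) \<in> flow_perp z" "(u2, u1) \<in> flow_perp z"
    using w u flow_perp_eq[OF assms(2)] by auto
  then have "geod_Omega c (geod_proj z) (proj_deriv c z X) (proj_deriv c z Y) = para_sasaki z (w1, w2) (u2, u1)"
    unfolding eq geod_Omega_def geod_metric_def geod_J_def assms(4)
    by (simp add: geod_lift_eq[OF assms(1-3)] para_J_def)
  also have "\<dots> = mink w1 u2 - mink w2 u1"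
    using para_sasaki_decomposition[OF assms(2) w(2) u(3), of 0 w2 0 u1] by (simp add: hor_def ver_def)
  also have "\<dots> = mink (fst X) (snd Y) - mink (snd X) (fst Y)"
    using w(2,3) u(2,3) h by (simp add: w(1) u(1) z flow_gen_def perp_iff mink_simps mink_commute)
  finally show ?thesis .
qed

text \<open>The lift need not pass through the point that \<open>geod_point\<close> picked on the
  orbit. Flowing it for a constant time t moves it there without changing H, and the form on the
  right is multiplied by cosh^2 t - sinh^2 t = 1.\<close>

lemma geod_Omega_pullback:
  assumes "(W, c) \<in> geod_atlas" "(\<zeta> has_derivative \<zeta>') (at y)" "open N" "y \<in> N"
    "\<And>x. x \<in> N \<Longrightarrow> \<zeta> x \<in> unit_tangent" "geod_proj (\<zeta> y) \<in> W"
    "(H has_derivative H') (at y)" "\<And>x. x \<in> N \<Longrightarrow> H x = c (geod_proj (\<zeta> x))"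
  shows "geod_Omega c (geod_proj (\<zeta> y)) (H' a) (H' b) =
    mink (fst (\<zeta>' a)) (snd (\<zeta>' b)) - mink (snd (\<zeta>' a)) (fst (\<zeta>' b))"
proof -
  define z where "z = geod_point (geod_proj (\<zeta> y))"
  have "z \<in> unit_tangent \<and> geod_proj z = geod_proj (\<zeta> y)"
    unfolding z_def geod_point_def by (rule someI[of _ "\<zeta> y"]) (use assms in blast)
  then have z: "z \<in> unit_tangent" "geod_proj z = geod_proj (\<zeta> y)" "geod_point (geod_proj z) = z"
    by (auto simp: z_def)
  obtain t where t: "z = geod_flow t (\<zeta> y)" using geod_proj_eqD[OF z(2)] .
  define \<eta> where "\<eta> = (\<lambda>x. geod_flow t (\<zeta> x))"
  have d: "(\<eta> has_derivative (\<lambda>a. geod_flow t (\<zeta>' a))) (at y)"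
    unfolding \<eta>_def by (rule bounded_linear.has_derivative[OF bounded_linear_geod_flow assms(2)])
  have ut: "\<And>x. x \<in> N \<Longrightarrow> \<eta> x \<in> unit_tangent"
    unfolding \<eta>_def using assms(5) by (rule geod_flow_unit_tangent)
  have W: "geod_proj (\<eta> y) \<in> W" using assms(6) by (simp add: \<eta>_def)
  have \<eta>y: "\<eta> y = z" by (simp add: t \<eta>_def)
  have "((\<lambda>x. c (geod_proj (\<eta> x))) has_derivative H') (at y)"
    by (rule has_derivative_transform_within_open[OF assms(7,3,4)]) (simp add: assms(8) \<eta>_def)
  from has_derivative_unique[OF this proj_deriv_chain[OF geod_atlasD(1,3)[OF assms(1)] d assms(3,4) ut W]]
  have H': "H' = (\<lambda>a. proj_deriv c z (geod_flow t (\<zeta>' a)))" unfolding \<eta>y .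
  have T: "geod_flow t (\<zeta>' a) \<in> tangent_T1 z" for a
    using derivative_in_tangent_T1[OF d assms(3,4) ut] \<eta>y by simp
  have cs: "cosh t * cosh t = 1 + sinh t * sinh t" using cosh_square_eq[of t] by (simp add: power2_eq_square)
  have "geod_Omega c (geod_proj (\<zeta> y)) (H' a) (H' b) =
      mink (fst (geod_flow t (\<zeta>' a))) (snd (geod_flow t (\<zeta>' b))) -
      mink (snd (geod_flow t (\<zeta>' a))) (fst (geod_flow t (\<zeta>' b)))"
    using geod_Omega_proj_deriv[OF assms(1) z(1) _ z(3) T T] assms(6) unfolding H' z(2) by simp
  also have "\<dots> = (cosh t * cosh t - sinh t * sinh t) *
      (mink (fst (\<zeta>' a)) (snd (\<zeta>' b)) - mink (snd (\<zeta>' a)) (fst (\<zeta>' b)))"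
    by (simp add: geod_flow_simp mink_simps algebra_simps)
  finally show ?thesis using cs by simp
qed

section \<open>Charts and local sections of the space of geodesics\<close>

text \<open>Both null vectors have positive time coordinate, and Cauchy-Schwarz in space bounds the
  product of such a vector with a point of the upper sheet.\<close>

lemma mink_null_future:
  assumes "z \<in> unit_tangent" "y \<in> hyperboloid"
  shows "mink (fst z + snd z) y < 0" "mink (fst z - snd z) y < 0"
proof -
  have *: "mink p y < 0" if "mink p p = 0" "p $ Inr 2 > 0" for p
  proof (rule ccontr)
    assume "\<not> ?thesis"
    have y: "mink y y = -1" "y $ Inr 2 > 0" using assms(2) by (auto simp: hyperboloid_def)
    then have "p $ Inr 2 * y $ Inr 2 > 0" using that by simp
    then have "(p $ Inr 2 * y $ Inr 2)\<^sup>2 \<le> (mink p y + p $ Inr 2 * y $ Inr 2)\<^sup>2"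
      using \<open>\<not> mink p y < 0\<close> by (intro power_mono) auto
    also have "\<dots> \<le> (p $ Inr 2)\<^sup>2 * ((y $ Inr 2)\<^sup>2 - 1)"
      using mink_spatial_Cauchy_Schwarz[of p y] that y by (simp add: algebra_simps)
    finally show False using that by (simp add: power_mult_distrib algebra_simps)
  qed
  obtain x v where z: "z = (x, v)" by (cases z)
  have h: "mink x x = -1" "mink x v = 0" "mink v v = 1" "mink v x = 0"
    using assms(1) by (auto simp: unit_tangent_iff z mink_commute)
  have t: "\<bar>v $ Inr 2\<bar> < x $ Inr 2" using assms(1) z unit_tangent_time_component by blast
  have "mink (x + v) y < 0"
    by (rule *) (use h t in \<open>simp_all add: mink_simps\<close>)
  moreover have "mink (x - v) y < 0"
    by (rule *) (use h t in \<open>simp_all add: mink_simps\<close>)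
  ultimately show "mink (fst z + snd z) y < 0" "mink (fst z - snd z) y < 0"
    by (simp_all add: z)
qed

text \<open>The geodesic through (x0, v0) is the centre of a chart; L and K identify the orthogonal
  complement of x0 and v0 with the coordinate space.\<close>

locale geodesic_frame =
  fixes x0 v0 :: "'n::finite minkowski" and L :: "'n minkowski \<Rightarrow> real^'n" and K :: "real^'n \<Rightarrow> 'n minkowski"
  assumes base: "(x0, v0) \<in> unit_tangent" and L: "linear L" and K: "linear K"
    and K_perp: "K a \<in> perp (x0, v0)" and LK: "L (K a) = a" and KL: "w \<in> perp (x0, v0) \<Longrightarrow> K (L w) = w"
begin

lemma base_simps: "mink x0 x0 = -1" "mink v0 v0 = 1" "mink x0 v0 = 0" "mink v0 x0 = 0"
  "mink x0 (K a) = 0" "mink v0 (K a) = 0" "mink (K a) x0 = 0" "mink (K a) v0 = 0"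
  using base K_perp[of a] by (auto simp: unit_tangent_iff perp_iff mink_commute)

definition perp_part :: "'n minkowski \<Rightarrow> 'n minkowski" where
  "perp_part w = w + mink w x0 *\<^sub>R x0 - mink w v0 *\<^sub>R v0"

lemma perp_part_perp: "perp_part w \<in> perp (x0, v0)"
  by (simp add: perp_part_def perp_iff mink_simps base_simps mink_commute)

lemma bounded_linear_perp_part: "bounded_linear perp_part"
  unfolding perp_part_def[abs_def]
  by (intro bounded_linear_add bounded_linear_sub bounded_linear_ident
      bounded_linear_compose[OF bounded_linear_scaleR_left] mink.bounded_linear_left)

text \<open>The null vectors \<open>x + v\<close> and \<open>x - v\<close> span the two ideal end points of the geodesic; the
  geodesic flow multiplies them by \<open>exp t\<close> and \<open>exp (-t)\<close>.\<close>

definition fut :: "'n minkowski \<times> 'n minkowski \<Rightarrow> real" where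
  "fut z = mink (fst z + snd z) v0"

definition past :: "'n minkowski \<times> 'n minkowski \<Rightarrow> real" where
  "past z = - mink (fst z - snd z) v0"

text \<open>Dividing by \<open>fut\<close> and \<open>past\<close> normalizes the null vectors to
  have product 1 and -1 with v0, which removes the dependence on the position along the orbit. The
  perpendicular parts that remain determine the two ideal end points.\<close>

definition coords :: "'n minkowski \<times> 'n minkowski \<Rightarrow> (real^'n) \<times> (real^'n)" where
  "coords z = (inverse (fut z) *\<^sub>R L (perp_part (fst z + snd z)),
     inverse (past z) *\<^sub>R L (perp_part (fst z - snd z)))"

text \<open>Geodesics that end in the hemisphere of the ideal sphere centred at the forward end of
  the base geodesic, seen from x0, and start in the opposite one.\<close>

definition dom :: "('n minkowski \<times> 'n minkowski) set" where
  "dom = {z \<in> unit_tangent. fut z > 0 \<and> past z > 0}"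

text \<open>The coefficient of x0 that makes \<open>ray s a\<close> a null vector for s = 1 and s =
  -1.\<close>

definition height :: "real^'n \<Rightarrow> real" where
  "height a = sqrt (1 + mink (K a) (K a))"

definition ray :: "real \<Rightarrow> real^'n \<Rightarrow> 'n minkowski" where
  "ray s a = s *\<^sub>R v0 + K a + height a *\<^sub>R x0"

text \<open>Multiplying both rays by this factor gives them the product -2 that x + v and x - v
  have.\<close>

definition scale :: "real^'n \<Rightarrow> real^'n \<Rightarrow> real" where
  "scale a b = inverse (sqrt (- mink (ray 1 a) (ray (-1) b) / 2))"

text \<open>The inverse of passing to x + v and x - v. Scaling both rays equally selects on each
  orbit the point where \<open>fut\<close> and \<open>past\<close> agree.\<close>

definition lift :: "(real^'n) \<times> (real^'n) \<Rightarrow> 'n minkowski \<times> 'n minkowski" where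
  "lift y = (let p = ray 1 (fst y); q = ray (-1) (snd y); k = scale (fst y) (snd y) / 2
     in (k *\<^sub>R (p + q), k *\<^sub>R (p - q)))"

lemma mink_K_nonneg: "mink (K a) (K a) \<ge> 0"
  using mink_nonneg_orthogonal[of x0 "K a"] base base_simps by (auto simp: unit_tangent_def)

lemma height_pos: "height a > 0" and height_square: "height a * height a = 1 + mink (K a) (K a)"
  using mink_K_nonneg[of a] by (auto simp: height_def intro: add_pos_nonneg)

lemma mink_ray_null: "s * s = 1 \<Longrightarrow> mink (ray s a) (ray s a) = 0"
  by (simp add: ray_def mink_simps base_simps height_square algebra_simps)

text \<open>With e and f the heights of a and b, the product is <K a, K b> - 1 - e * f. The bound <K
  a, K b> \<le> e * f comes from the nonnegative square of f * K a - e * K b. The radicand in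
  \<open>scale\<close> is thus positive.\<close>

lemma mink_ray_neg: "mink (ray 1 a) (ray (-1) b) < 0"
proof -
  let ?e = "height a" and ?f = "height b"
  have "mink x0 (?f *\<^sub>R K a - ?e *\<^sub>R K b) = 0" by (simp add: mink_simps base_simps)
  then have "mink (?f *\<^sub>R K a - ?e *\<^sub>R K b) (?f *\<^sub>R K a - ?e *\<^sub>R K b) \<ge> 0"
    using mink_nonneg_orthogonal base by (auto simp: unit_tangent_def)
  then have "2 * (?e * ?f) * mink (K a) (K b) \<le> (?f * ?f) * mink (K a) (K a) + (?e * ?e) * mink (K b) (K b)"
    by (simp add: mink_simps mink_commute[of "K b" "K a"] algebra_simps)
  also have "\<dots> \<le> 2 * ((?e * ?e) * (?f * ?f))"
    using mink_K_nonneg[of a] mink_K_nonneg[of b] by (simp add: height_square algebra_simps)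
  finally have "(2 * (?e * ?f)) * mink (K a) (K b) \<le> (2 * (?e * ?f)) * (?e * ?f)"
    by (simp add: algebra_simps)
  then have "mink (K a) (K b) \<le> ?e * ?f"
    using height_pos[of a] height_pos[of b] by (subst (asm) mult_le_cancel_left_pos) auto
  then show ?thesis by (simp add: ray_def mink_simps base_simps algebra_simps)
qed

lemma scale_pos: "scale a b > 0"
  and scale_square: "scale a b * scale a b * mink (ray 1 a) (ray (-1) b) = - 2"
proof -
  have k: "- mink (ray 1 a) (ray (-1) b) / 2 > 0" (is "?k > 0") using mink_ray_neg[of a b] by simp
  then show "scale a b > 0" by (simp add: scale_def)
  have "scale a b * scale a b = inverse ?k"
    unfolding scale_def using k
    by (metis inverse_mult_distrib real_sqrt_mult_self abs_of_pos)
  then show "scale a b * scale a b * mink (ray 1 a) (ray (-1) b) = - 2"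
    using k by (simp add: field_simps)
qed

lemma lift_simps:
  "fst (lift (a, b)) = (scale a b / 2) *\<^sub>R (ray 1 a + ray (-1) b)"
  "snd (lift (a, b)) = (scale a b / 2) *\<^sub>R (ray 1 a - ray (-1) b)"
  by (simp_all add: lift_def Let_def)

lemma lift_sum_diff:
  "fst (lift (a, b)) + snd (lift (a, b)) = scale a b *\<^sub>R ray 1 a"
  "fst (lift (a, b)) - snd (lift (a, b)) = scale a b *\<^sub>R ray (-1) b"
  unfolding lift_simps by (simp_all add: vec_eq_iff field_simps)

lemma lift_unit_tangent: "lift y \<in> unit_tangent"
proof -
  obtain a b where y: "y = (a, b)" by (cases y)
  let ?m = "mink (ray 1 a) (ray (-1) b)"
  have m: "mink (ray (-1) b) (ray 1 a) = ?m" by (rule mink_commute)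
  have s: "scale a b * (scale a b * ?m) = -2" using scale_square[of a b] by (simp add: mult.assoc)
  have 1: "mink (fst (lift y)) (fst (lift y)) = -1" "mink (fst (lift y)) (snd (lift y)) = 0"
    "mink (snd (lift y)) (snd (lift y)) = 1"
    using s by (simp_all add: y lift_simps mink_simps mink_ray_null m)
  have "mink (fst (lift y)) x0 = - (scale a b / 2) * (height a + height b)"
    by (simp add: y lift_simps ray_def mink_simps base_simps algebra_simps)
  also have "\<dots> < 0" using scale_pos[of a b] height_pos[of a] height_pos[of b] by (simp add: add_pos_pos)
  finally have "fst (lift y) \<in> hyperboloid"
    using hyperboloid_sheet[of x0] 1(1) base by (auto simp: unit_tangent_def)
  then show ?thesis using 1 by (cases "lift y") (auto simp: unit_tangent_def)
qed

lemma coords_lift: "coords (lift y) = y"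
proof -
  obtain a b where y: "y = (a, b)" by (cases y)
  have fp: "fut (lift y) = scale a b" "past (lift y) = scale a b"
    by (simp_all add: y fut_def past_def lift_sum_diff mink_simps) (simp_all add: ray_def mink_simps base_simps)
  have "perp_part (ray s c) = K c" for s c
    by (simp add: perp_part_def ray_def mink_simps base_simps)
  then show "coords (lift y) = y"
    using scale_pos[of a b] unfolding coords_def fp
    by (simp add: y lift_sum_diff linear_scale[OF bounded_linear.linear[OF bounded_linear_perp_part]]
        linear_scale[OF L] LK)
qed

lemma flow_sum_diff:
  "fst (geod_flow t z) + snd (geod_flow t z) = exp t *\<^sub>R (fst z + snd z)"
  "fst (geod_flow t z) - snd (geod_flow t z) = exp (- t) *\<^sub>R (fst z - snd z)"
  unfolding cosh_plus_sinh[symmetric] by (simp_all add: geod_flow_simp algebra_simps)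

lemma coords_flow: "coords (geod_flow t z) = coords z"
  and dom_flow: "z \<in> dom \<Longrightarrow> geod_flow t z \<in> dom"
proof -
  have f: "fut (geod_flow t z) = exp t * fut z" and p: "past (geod_flow t z) = exp (- t) * past z"
    by (simp_all add: fut_def past_def flow_sum_diff mink_simps algebra_simps)
  show "coords (geod_flow t z) = coords z"
    unfolding coords_def f p flow_sum_diff
    by (simp add: linear_scale[OF bounded_linear.linear[OF bounded_linear_perp_part]]
        linear_scale[OF L] exp_minus)
  show "geod_flow t z \<in> dom" if "z \<in> dom"
    using that by (simp add: dom_def f p geod_flow_unit_tangent)
qed

text \<open>The perpendicular and v0 components of a null vector determine its x0 component up to
  sign, and being future directed fixes that sign. Here s is 1 for x + v and -1 for x - v.\<close>

lemma ray_coords: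
  assumes "mink p p = 0" "mink p x0 < 0" "s * mink p v0 > 0" "s * s = 1"
  shows "ray s (inverse (s * mink p v0) *\<^sub>R L (perp_part p)) = inverse (s * mink p v0) *\<^sub>R p"
proof -
  define r where "r = inverse (s * mink p v0)"
  have "r * (s * mink p v0) = 1"
    unfolding r_def by (rule left_inverse) (use assms(3) in auto)
  then have r: "r > 0" "r * s * mink p v0 = 1"
    using assms(3) by (simp_all add: r_def mult.assoc del: inverse_mult_distrib)
  have K': "K (r *\<^sub>R L (perp_part p)) = r *\<^sub>R perp_part p"
    by (simp add: linear_scale[OF K] KL perp_part_perp)
  have m: "mink (perp_part p) (perp_part p) = (mink p x0)\<^sup>2 - (mink p v0)\<^sup>2"
    using assms(1) by (simp add: perp_part_def mink_simps base_simps mink_commute[of x0 p] mink_commute[of v0 p] power2_eq_square algebra_simps)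
  have "1 + mink (r *\<^sub>R perp_part p) (r *\<^sub>R perp_part p) = 1 + (r * mink p x0)\<^sup>2 - (r * mink p v0)\<^sup>2"
    by (simp only: mink.scaleR_left mink.scaleR_right m real_scaleR_def)
      (simp add: power2_eq_square algebra_simps)
  also have "(r * mink p v0)\<^sup>2 = (s * s) * (r * mink p v0)\<^sup>2" by (simp add: assms(4))
  also have "\<dots> = (r * s * mink p v0)\<^sup>2" by (simp add: power2_eq_square algebra_simps)
  finally have "height (r *\<^sub>R L (perp_part p)) = \<bar>r * mink p x0\<bar>"
    unfolding height_def K' r(2) by simp
  then have h: "height (r *\<^sub>R L (perp_part p)) = - r * mink p x0"
    using r(1) assms(2) by (simp add: abs_mult)
  have "r * mink p v0 = s"
    using r(2) assms(4) by (metis mult.commute mult.left_commute mult.right_neutral)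
  then have "ray s (r *\<^sub>R L (perp_part p)) = (r * mink p v0) *\<^sub>R v0 + r *\<^sub>R perp_part p - (r * mink p x0) *\<^sub>R x0"
    by (simp add: ray_def h K')
  then show ?thesis unfolding r_def[symmetric] by (simp add: perp_part_def algebra_simps)
qed

lemma lift_coords:
  assumes "z \<in> dom" obtains t where "lift (coords z) = geod_flow t z"
proof -
  obtain x v where z: "z = (x, v)" by (cases z)
  have h: "mink x x = -1" "mink x v = 0" "mink v v = 1" "mink v x = 0"
    using assms by (auto simp: unit_tangent_iff z mink_commute dom_def)
  define p q where "p = x + v" and "q = x - v"
  define l m where "l = fut z" and "m = past z"
  have lm: "l > 0" "m > 0" and lm_eq: "l = mink p v0" "m = - mink q v0"
    using assms by (auto simp: l_def m_def dom_def fut_def past_def p_def q_def z)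
  have pq: "mink p p = 0" "mink q q = 0" "mink p q = -2"
    using h by (simp_all add: p_def q_def mink_simps)
  have "mink p x0 < 0" "mink q x0 < 0"
    using mink_null_future[of z x0] assms base by (auto simp: z dom_def p_def q_def unit_tangent_def)
  then have r: "ray 1 (fst (coords z)) = inverse l *\<^sub>R p" "ray (-1) (snd (coords z)) = inverse m *\<^sub>R q"
    using ray_coords[of p 1] ray_coords[of q "-1"] pq lm
    by (simp_all add: coords_def z fut_def past_def p_def[symmetric] q_def[symmetric] lm_eq)
  have "scale (fst (coords z)) (snd (coords z)) = inverse (sqrt (inverse (l * m)))"
    unfolding scale_def r by (simp add: mink_simps pq)
  then have s: "scale (fst (coords z)) (snd (coords z)) = sqrt l * sqrt m"
    by (simp add: real_sqrt_inverse real_sqrt_mult)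
  \<comment> \<open>The rays are p / l and q / m, so \<open>scale\<close> leaves sqrt (m / l) times
    p and sqrt (l / m) times q, which is the effect of the flow for this time.\<close>
  define t where "t = ln (sqrt m / sqrt l)"
  have t: "exp t = sqrt m / sqrt l" "exp (- t) = sqrt l / sqrt m"
    using lm by (simp_all add: t_def exp_minus)
  have *: "sqrt l * sqrt m * inverse l = exp t" "sqrt l * sqrt m * inverse m = exp (- t)"
    using lm by (simp_all add: t field_simps)
  obtain a b where ab: "coords z = (a, b)" by (cases "coords z")
  have r': "ray 1 a = inverse l *\<^sub>R p" "ray (-1) b = inverse m *\<^sub>R q" and s': "scale a b = sqrt l * sqrt m"
    using r s ab by auto
  have pz: "fst z + snd z = p" "fst z - snd z = q" by (simp_all add: z p_def q_def)
  have sums: "fst (lift (coords z)) + snd (lift (coords z)) = fst (geod_flow t z) + snd (geod_flow t z)"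
    "fst (lift (coords z)) - snd (lift (coords z)) = fst (geod_flow t z) - snd (geod_flow t z)"
    unfolding flow_sum_diff pz ab lift_sum_diff r' s' scaleR_scaleR * by simp_all
  have "2 *\<^sub>R fst (lift (coords z)) = 2 *\<^sub>R fst (geod_flow t z)"
    using arg_cong2[OF sums, of "(+)"] by (simp add: scaleR_2)
  moreover have "2 *\<^sub>R snd (lift (coords z)) = 2 *\<^sub>R snd (geod_flow t z)"
    using arg_cong2[OF sums, of "(-)"] by (simp add: scaleR_2 algebra_simps)
  ultimately have "lift (coords z) = geod_flow t z" by (simp add: prod_eq_iff)
  then show ?thesis by (rule that)
qed

lemma smooth_on_lift: "smooth_on lift UNIV"
proof -
  note bl = linear_conv_bounded_linear[THEN iffD1]
  have sK: "smooth_on (\<lambda>y. K (f y)) UNIV" if "smooth_on f UNIV" for f :: "(real^'n) \<times> (real^'n) \<Rightarrow> _"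
    by (rule smooth_on_bounded_linear_compose[OF bl[OF K] open_UNIV that])
  have sr: "smooth_on (\<lambda>y. ray s (f y)) UNIV" if "smooth_on f UNIV" for s and f :: "(real^'n) \<times> (real^'n) \<Rightarrow> _"
    unfolding ray_def height_def using mink_K_nonneg
    by (intro smooth_on_add smooth_on_scaleR smooth_on_sqrt smooth_on_const smooth_on_mink sK that open_UNIV)
      (simp add: add_pos_nonneg)
  have s1: "smooth_on (\<lambda>y :: (real^'n) \<times> (real^'n). ray 1 (fst y)) UNIV"
    by (rule sr[OF smooth_on_bounded_linear[OF bounded_linear_fst open_UNIV]])
  have s2: "smooth_on (\<lambda>y :: (real^'n) \<times> (real^'n). ray (-1) (snd y)) UNIV"
    by (rule sr[OF smooth_on_bounded_linear[OF bounded_linear_snd open_UNIV]])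
  have ss: "smooth_on (\<lambda>y :: (real^'n) \<times> (real^'n). scale (fst y) (snd y)) UNIV"
    unfolding scale_def divide_inverse
    by (intro smooth_on_inverse smooth_on_sqrt smooth_on_mult smooth_on_uminus smooth_on_const
        smooth_on_mink s1 s2 open_UNIV) (use mink_ray_neg in auto)
  show ?thesis
    unfolding lift_def Let_def divide_inverse
    by (intro smooth_on_Pair smooth_on_scaleR smooth_on_add smooth_on_diff smooth_on_mult smooth_on_const s1 s2 ss open_UNIV)
qed

lemma smooth_on_coords: "smooth_on coords {z. fut z > 0 \<and> past z > 0}"
  and open_dom: "open {z. fut z > 0 \<and> past z > 0}"
proof -
  note bl = linear_conv_bounded_linear[THEN iffD1]
  have lin: "bounded_linear fut" "bounded_linear past"
    unfolding fut_def[abs_def] past_def[abs_def]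
    by (intro bounded_linear_minus bounded_linear_compose[OF mink.bounded_linear_left] bounded_linear_add
        bounded_linear_sub bounded_linear_fst bounded_linear_snd)+
  then show o: "open {z. fut z > 0 \<and> past z > 0}"
    by (intro open_Collect_conj open_Collect_less continuous_on_const linear_continuous_on)
  have b: "bounded_linear (\<lambda>z. L (perp_part (fst z + snd z)))" "bounded_linear (\<lambda>z. L (perp_part (fst z - snd z)))"
    by (intro bounded_linear_compose[OF bl[OF L]] bounded_linear_compose[OF bounded_linear_perp_part] bounded_linear_add
        bounded_linear_sub bounded_linear_fst bounded_linear_snd)+
  show "smooth_on coords {z. fut z > 0 \<and> past z > 0}"
    unfolding coords_def[abs_def]
    by (rule smooth_on_Pair[OF o
          smooth_on_scaleR[OF o smooth_on_inverse[OF o smooth_on_bounded_linear[OF lin(1) o]] smooth_on_bounded_linear[OF b(1) o]]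
          smooth_on_scaleR[OF o smooth_on_inverse[OF o smooth_on_bounded_linear[OF lin(2) o]] smooth_on_bounded_linear[OF b(2) o]]])
      auto
qed

text \<open>The choice made by \<open>geod_point\<close> is harmless because \<open>coords\<close>
  is constant along orbits.\<close>

definition geod_coords :: "'n geodesic \<Rightarrow> (real^'n) \<times> (real^'n)" where
  "geod_coords l = coords (geod_point l)"

lemma geod_coords_proj:
  assumes "z \<in> unit_tangent" shows "geod_coords (geod_proj z) = coords z"
proof -
  have "geod_proj (geod_point (geod_proj z)) = geod_proj z"
    unfolding geod_point_def using someI_ex[of "\<lambda>y. y \<in> unit_tangent \<and> geod_proj y = geod_proj z"] assms by blast
  then obtain t where "geod_point (geod_proj z) = geod_flow t z" by (rule geod_proj_eqD)
  then show ?thesis by (simp add: geod_coords_def coords_flow)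
qed

lemma geod_proj_dom_iff: "geod_proj z \<in> geod_proj ` dom \<longleftrightarrow> z \<in> dom"
proof
  assume "geod_proj z \<in> geod_proj ` dom"
  then obtain y where y: "y \<in> dom" "geod_proj z = geod_proj y" by blast
  obtain t where "z = geod_flow t y" using geod_proj_eqD[OF y(2)] .
  then show "z \<in> dom" using y(1) by (simp add: dom_flow)
qed simp

lemma geod_coords_chart: "(geod_proj ` dom, geod_coords) \<in> geod_atlas"
proof -
  let ?W = "geod_proj ` dom :: 'n geodesic set"
  have pre: "{z \<in> unit_tangent. geod_proj z \<in> ?W} = unit_tangent \<inter> {z. fut z > 0 \<and> past z > 0}"
    unfolding geod_proj_dom_iff by (auto simp: dom_def)
  have "?W \<subseteq> geodesics" by (auto simp: geodesics_def dom_def)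
  then have W: "openin geod_top ?W"
    unfolding openin_geod_top pre using open_dom by (auto simp: openin_open_Int)
  have sm: "smooth_on_subset (geod_coords \<circ> geod_proj) {z \<in> unit_tangent. geod_proj z \<in> ?W}"
    unfolding smooth_on_subset_def pre
    by (intro ballI exI[of _ "{z. fut z > 0 \<and> past z > 0}"] exI[of _ coords])
      (auto simp: open_dom smooth_on_coords geod_coords_proj)
  have inj: "inj_on geod_coords ?W"
  proof (rule inj_onI)
    fix k l assume "k \<in> ?W" "l \<in> ?W" and eq: "geod_coords k = geod_coords l"
    then obtain y z where yz: "k = geod_proj y" "y \<in> dom" "l = geod_proj z" "z \<in> dom" by blast
    then have "coords y = coords z" using eq geod_coords_proj by (auto simp: dom_def)
    then show "k = l" using lift_coords[OF yz(2)] lift_coords[OF yz(4)] yz geod_proj_flow by metis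
  qed
  have "proj_deriv geod_coords z ` tangent_T1 z = UNIV" if z: "z \<in> unit_tangent" "geod_proj z \<in> ?W" for z
  proof -
    have "z \<in> dom" using z(2) by (simp add: geod_proj_dom_iff)
    then obtain t where t: "lift (coords z) = geod_flow t z" by (rule lift_coords)
    \<comment> \<open>\<open>lift\<close> is a section through another point of the orbit; flowing
      back for time t makes it pass through z. Its coordinate expression is the identity, and
      differentiating this shows that \<open>proj_deriv\<close> is onto.\<close>
    define \<zeta> where "\<zeta> = (\<lambda>y. geod_flow (- t) (lift y))"
    have \<zeta>z: "\<zeta> (coords z) = z" by (simp add: \<zeta>_def t geod_flow_add)
    have ut: "\<zeta> y \<in> unit_tangent" for y by (simp add: \<zeta>_def geod_flow_unit_tangent lift_unit_tangent)
    have "smooth_on \<zeta> UNIV"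
      unfolding \<zeta>_def by (rule smooth_on_bounded_linear_compose[OF bounded_linear_geod_flow open_UNIV smooth_on_lift])
    then obtain \<zeta>' where d: "(\<zeta> has_derivative \<zeta>') (at (coords z))" using smooth_on_has_derivative by blast
    have W': "geod_proj (\<zeta> (coords z)) \<in> ?W" using z \<zeta>z by simp
    have "geod_coords (geod_proj (\<zeta> y)) = y" for y
      by (simp add: geod_coords_proj[OF ut]) (simp add: \<zeta>_def coords_flow coords_lift)
    then have "((\<lambda>y. y) has_derivative (\<lambda>a. proj_deriv geod_coords z (\<zeta>' a))) (at (coords z))"
      using proj_deriv_chain[OF W sm d open_UNIV UNIV_I ut W'] \<zeta>z by simp
    then have *: "proj_deriv geod_coords z (\<zeta>' a) = a" for a
      using has_derivative_unique[OF has_derivative_ident] by metis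
    have "\<zeta>' a \<in> tangent_T1 z" for a
      using derivative_in_tangent_T1[OF d open_UNIV UNIV_I ut] \<zeta>z by simp
    then show ?thesis using * by (metis UNIV_eq_I imageI)
  qed
  then show ?thesis using W inj sm by (auto simp: geod_atlas_def)
qed

end

text \<open>Composing s with c and G gives a smooth local lift of G to the unit tangent
  bundle.\<close>

lemma geod_chart_with_section:
  fixes z0 :: "'n::finite minkowski \<times> 'n minkowski"
  assumes "z0 \<in> unit_tangent"
  obtains W c s where "(W, c) \<in> geod_atlas" "geod_proj z0 \<in> W" "smooth_on s UNIV"
    "\<And>y. s y \<in> unit_tangent" "\<And>l. l \<in> W \<Longrightarrow> geod_proj (s (c l)) = l"
proof -
  obtain x0 v0 where z0: "z0 = (x0, v0)" by (cases z0)
  have d: "dim (perp (x0, v0)) = dim (UNIV :: (real^'n) set)"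
    using dim_perp assms z0 by (simp add: dim_UNIV)
  obtain L :: "'n minkowski \<Rightarrow> real^'n" and K where "linear L" "linear K" "range K = perp (x0, v0)"
    "\<And>w. w \<in> perp (x0, v0) \<Longrightarrow> K (L w) = w" "\<And>a. a \<in> UNIV \<Longrightarrow> L (K a) = a"
    by (rule isometries_subspaces[OF subspace_perp subspace_UNIV d]) (rule that; assumption)
  then interpret geodesic_frame x0 v0 L K
  proof unfold_locales
    show "(x0, v0) \<in> unit_tangent" using assms z0 by simp
    show "K a \<in> perp (x0, v0)" for a using \<open>range K = _\<close> by blast
  qed (simp_all add: linear_add linear_scale)
  have "z0 \<in> dom"
    using assms base_simps by (simp add: dom_def z0 fut_def past_def mink_simps)
  show ?thesis
  proof (rule that[OF geod_coords_chart _ smooth_on_lift lift_unit_tangent])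
    show "geod_proj z0 \<in> geod_proj ` dom" using \<open>z0 \<in> dom\<close> by blast
    fix l assume "l \<in> geod_proj ` dom"
    then obtain z where z: "z \<in> dom" "l = geod_proj z" by blast
    then have "geod_coords l = coords z" by (simp add: geod_coords_proj dom_def)
    then show "geod_proj (lift (geod_coords l)) = l" using lift_coords[OF z(1)] z(2) geod_proj_flow by metis
  qed
qed

section \<open>Legendrian lifts\<close>

text \<open>Kernel vectors of \<open>cosh t A + sinh t B\<close> for different \<open>t\<close> have \<open>mink\<close>-orthogonal, nonzero
  images under \<open>B\<close>, so only finitely many \<open>t\<close> have one.\<close>

lemma symmetric_pencil_injective:
  fixes A B :: "'a::euclidean_space \<Rightarrow> 'n::finite minkowski"
  assumes z: "z \<in> unit_tangent" and perp: "\<And>a. A a \<in> perp z" "\<And>a. B a \<in> perp z"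
    and sym: "\<And>a b. mink (A a) (B b) = mink (A b) (B a)"
    and ker: "\<And>a. A a = 0 \<Longrightarrow> B a = 0 \<Longrightarrow> a = 0"
  shows "\<exists>t. \<forall>a. cosh t *\<^sub>R A a + sinh t *\<^sub>R B a = 0 \<longrightarrow> a = 0"
proof (rule ccontr)
  assume "\<not> ?thesis"
  then obtain a where a: "\<And>t. cosh t *\<^sub>R A (a t) + sinh t *\<^sub>R B (a t) = 0" "\<And>t. a t \<noteq> 0" by metis
  define b where "b t = B (a t)" for t
  have eq: "cosh t *\<^sub>R A (a t) = - (sinh t *\<^sub>R b t)" for t
    using a(1)[of t] by (simp add: b_def add_eq_0_iff2)
  have nz: "b t \<noteq> 0" for t
  proof
    assume "b t = 0"
    then have "cosh t *\<^sub>R A (a t) = 0" using eq by simp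
    then show False using ker[of "a t"] a(2)[of t] \<open>b t = 0\<close> by (simp add: b_def)
  qed
  \<comment> \<open>Pair the kernel equation at t with b s and the one at s with b t. Symmetry
    identifies the two left sides, and eliminating them leaves sinh (t - s) times the
    product.\<close>
  have orth: "mink (b t) (b s) = 0" if "t \<noteq> s" for t s
  proof -
    have 1: "cosh t * mink (A (a t)) (b s) = - sinh t * mink (b t) (b s)" for t s
      using arg_cong[OF eq[of t], of "\<lambda>x. mink x (b s)"] by (simp add: mink_simps)
    have "mink (A (a t)) (b s) = mink (A (a s)) (b t)" unfolding b_def by (rule sym)
    then have "cosh s * (- sinh t * mink (b t) (b s)) = cosh t * (- sinh s * mink (b s) (b t))"
      using 1[of t s] 1[of s t] by (metis mult.left_commute)
    then have "sinh (t - s) * mink (b t) (b s) = 0"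
      by (simp add: sinh_diff mink_commute[of "b s"] algebra_simps)
    then show ?thesis using that by simp
  qed
  have pos: "mink (b t) (b t) \<noteq> 0" for t
  proof -
    have "fst z \<in> hyperboloid" "mink (fst z) (b t) = 0"
      using z perp(2) by (auto simp: unit_tangent_def b_def perp_iff)
    then show ?thesis using mink_pos_orthogonal[OF _ _ nz] by fastforce
  qed
  have inj: "inj b" using orth pos by (metis injI)
  \<comment> \<open>For an indefinite product orthogonality alone would not give independence; the
    nonzero squares from \<open>pos\<close> isolate each coefficient.\<close>
  have "independent (range b)"
    unfolding independent_explicit_finite_subsets
  proof (intro allI impI ballI)
    fix S u v assume S: "S \<subseteq> range b" "finite S" "(\<Sum>v\<in>S. u v *\<^sub>R v) = 0" "v \<in> S"
    have "0 = mink (\<Sum>w\<in>S. u w *\<^sub>R w) v" by (simp add: S(3) mink_simps)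
    also have "\<dots> = (\<Sum>w\<in>S. if w = v then u v * mink v v else 0)"
      unfolding mink.sum_left
    proof (rule sum.cong[OF refl])
      fix w assume "w \<in> S"
      obtain t s where "w = b t" "v = b s" using S(1,4) \<open>w \<in> S\<close> by blast
      then show "mink (u w *\<^sub>R w) v = (if w = v then u v * mink v v else 0)"
        using orth[of t s] by (auto simp: mink_simps)
    qed
    also have "\<dots> = u v * mink v v" using S(2,4) by simp
    finally show "u v = 0" using pos S(1,4) by auto
  qed
  then have "finite (range b)" by (rule independent_imp_finite)
  then have "finite (UNIV :: real set)" using inj by (rule finite_imageD)
  then show False using infinite_UNIV_char_0 by blast
qed

text \<open>The product rule produces second derivatives of \<sigma> paired with \<nu>; they are
  symmetric in a and b and cancel.\<close>

lemma exterior_derivative_contact_form: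
  fixes \<sigma> \<nu> :: "'a::euclidean_space \<Rightarrow> 'n::finite minkowski"
  assumes S: "open S" "x \<in> S" and "smooth_on \<sigma> S" "smooth_on \<nu> S"
  shows "frechet_derivative (\<lambda>x. mink (frechet_derivative \<sigma> (at x) a) (\<nu> x)) (at x) b -
      frechet_derivative (\<lambda>x. mink (frechet_derivative \<sigma> (at x) b) (\<nu> x)) (at x) a =
    mink (frechet_derivative \<sigma> (at x) a) (frechet_derivative \<nu> (at x) b) -
      mink (frechet_derivative \<sigma> (at x) b) (frechet_derivative \<nu> (at x) a)"
proof -
  have "frechet_derivative (\<lambda>x. mink (frechet_derivative \<sigma> (at x) a) (\<nu> x)) (at x) b =
      mink (frechet_derivative \<sigma> (at x) a) (frechet_derivative \<nu> (at x) b) +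
      mink (frechet_derivative (\<lambda>x. frechet_derivative \<sigma> (at x) a) (at x) b) (\<nu> x)" for a b
    by (subst frechet_derivative_eq[OF mink.FDERIV[OF smooth_on_has_derivative[OF smooth_on_frechet_derivative[OF assms(3)] S(2)]
            smooth_on_has_derivative[OF assms(4) S(2)]]]) simp
  moreover have "frechet_derivative (\<lambda>x. frechet_derivative \<sigma> (at x) a) (at x) b =
      frechet_derivative (\<lambda>x. frechet_derivative \<sigma> (at x) b) (at x) a"
    using symmetric_second_derivative[OF S] assms(3) unfolding smooth_on_def by blast
  ultimately show ?thesis by simp
qed

text \<open>The zero form has zero exterior derivative. For a hypersurface with normal \<nu> this is
  the symmetry of the second fundamental form.\<close>

lemma contact_form_zero_imp_symmetric:
  fixes \<sigma> \<nu> :: "'a::euclidean_space \<Rightarrow> 'n::finite minkowski"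
  assumes S: "open S" "x \<in> S" and "smooth_on \<sigma> S" "smooth_on \<nu> S"
    and zero: "\<And>y a. y \<in> S \<Longrightarrow> mink (frechet_derivative \<sigma> (at y) a) (\<nu> y) = 0"
  shows "mink (frechet_derivative \<sigma> (at x) a) (frechet_derivative \<nu> (at x) b) =
      mink (frechet_derivative \<sigma> (at x) b) (frechet_derivative \<nu> (at x) a)"
proof -
  have "frechet_derivative (\<lambda>x. mink (frechet_derivative \<sigma> (at x) a) (\<nu> x)) (at x) = (\<lambda>_. 0)" for a
    using frechet_derivative_cong[OF S, of "\<lambda>x. mink (frechet_derivative \<sigma> (at x) a) (\<nu> x)" "\<lambda>_. 0"] zero
    by (simp add: frechet_derivative_const)
  then show ?thesis using exterior_derivative_contact_form[OF assms(1-4), of a b] by simp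
qed

section \<open>Determinants of frames: orientation and injectivity\<close>

definition frame_matrix :: "'n::finite minkowski \<Rightarrow> ('n \<Rightarrow> 'n minkowski) \<Rightarrow> 'n minkowski \<Rightarrow> real^('n + 2)^('n + 2)" where
  "frame_matrix x w u = (\<chi> i j. (case j of Inl k \<Rightarrow> w k | Inr m \<Rightarrow> (if m = 1 then u else x)) $ i)"

lemma positive_basis_iff: "positive_basis \<epsilon> x w u \<longleftrightarrow> \<epsilon> * det (frame_matrix x w u) > 0"
  by (simp add: positive_basis_def frame_matrix_def)

lemma frame_matrix_mult:
  "frame_matrix x w u *v y = (\<Sum>k\<in>UNIV. y $ Inl k *\<^sub>R w k) + y $ Inr 1 *\<^sub>R u + y $ Inr 2 *\<^sub>R x"
proof -
  have "frame_matrix x w u *v y = (\<Sum>j\<in>UNIV. y $ j *\<^sub>R (case j of Inl k \<Rightarrow> w k | Inr m \<Rightarrow> (if m = 1 then u else x)))"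
    by (simp add: vec_eq_iff matrix_vector_mult_def frame_matrix_def sum_component mult.commute)
  also have "\<dots> = (\<Sum>k\<in>UNIV. y $ Inl k *\<^sub>R w k) + (\<Sum>m\<in>UNIV. y $ Inr m *\<^sub>R (if m = 1 then u else x))"
    unfolding UNIV_Plus_UNIV[symmetric] by (subst sum.Plus) simp_all
  also have "(\<Sum>m\<in>UNIV. y $ Inr m *\<^sub>R (if m = 1 then u else x)) = y $ Inr 1 *\<^sub>R u + y $ Inr 2 *\<^sub>R x"
    by (simp add: sum_2)
  finally show ?thesis by (simp add: add.assoc)
qed

lemma linear_axis_expansion:
  fixes W :: "real^'n::finite \<Rightarrow> 'b::real_vector"
  assumes "linear W" shows "(\<Sum>k\<in>UNIV. a $ k *\<^sub>R W (axis k 1)) = W a"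
proof -
  have "(\<Sum>k\<in>UNIV. a $ k *\<^sub>R axis k 1) = a"
    using basis_expansion[of a] by (simp add: scalar_mult_eq_scaleR)
  then show ?thesis
    using linear_sum[OF assms, of "\<lambda>k. a $ k *\<^sub>R axis k 1" UNIV] by (simp add: linear_scale[OF assms])
qed

lemma det_nonzero_iff_injective:
  fixes M :: "real^'n::finite^'n" shows "det M \<noteq> 0 \<longleftrightarrow> (\<forall>y. M *v y = 0 \<longrightarrow> y = 0)"
  by (metis invertible_det_nz invertible_left_inverse matrix_left_invertible_ker)

text \<open>Products with v and x isolate the coefficients of these two columns in a kernel vector;
  what remains lies in the kernel of W.\<close>

lemma det_frame_matrix_nonzero:
  fixes W :: "real^'n::finite \<Rightarrow> 'n minkowski"
  assumes "(x, v) \<in> unit_tangent" "linear W" "\<And>a. W a \<in> perp (x, v)" "\<And>a. W a = 0 \<Longrightarrow> a = 0"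
  shows "det (frame_matrix x (\<lambda>k. W (axis k 1)) v) \<noteq> 0"
  unfolding det_nonzero_iff_injective
proof (intro allI impI)
  fix y assume "frame_matrix x (\<lambda>k. W (axis k 1)) v *v y = 0"
  then have *: "W (\<chi> k. y $ Inl k) + y $ Inr 1 *\<^sub>R v + y $ Inr 2 *\<^sub>R x = 0"
    using linear_axis_expansion[OF assms(2), of "\<chi> k. y $ Inl k"] by (simp add: frame_matrix_mult)
  have h: "mink x x = -1" "mink x v = 0" "mink v v = 1" "mink v x = 0"
    using assms(1) by (auto simp: unit_tangent_iff mink_commute)
  have "mink x (W a) = 0" "mink v (W a) = 0" for a using assms(3) by (simp_all add: perp_iff)
  then have y: "y $ Inr 1 = 0" "y $ Inr 2 = 0"
    using arg_cong[OF *, of "mink v"] arg_cong[OF *, of "mink x"] h by (simp_all add: mink_simps)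
  then have "(\<chi> k. y $ Inl k) = 0" using * assms(4) by simp
  then have "y $ i = 0" for i
  proof (cases i)
    case (Inr m)
    then show ?thesis using y exhaust_2[of m] by auto
  qed (simp add: vec_eq_iff)
  then show "y = 0" by (simp add: vec_eq_iff)
qed

text \<open>With this, the sign of the determinant carries both immersivity and orientation to
  nearby points.\<close>

lemma det_frame_matrix_imp_injective:
  fixes W :: "real^'n::finite \<Rightarrow> 'n minkowski"
  assumes "linear W" "det (frame_matrix x (\<lambda>k. W (axis k 1)) v) \<noteq> 0" "W a = 0"
  shows "a = 0"
proof -
  define y :: "real^('n + 2)" where "y = (\<chi> i. case i of Inl k \<Rightarrow> a $ k | Inr m \<Rightarrow> 0)"
  have "frame_matrix x (\<lambda>k. W (axis k 1)) v *v y = 0"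
    using linear_axis_expansion[OF assms(1), of a] assms(3) by (simp add: frame_matrix_mult y_def)
  then have "y = 0" using assms(2) det_nonzero_iff_injective by blast
  then have "y $ Inl k = 0" for k by simp
  then show ?thesis by (simp add: y_def vec_eq_iff)
qed

text \<open>For e = -1 this is the effect of reflecting one chart coordinate, used to correct the
  sign of the frame.\<close>

lemma det_frame_matrix_scale_column:
  "det (frame_matrix x (\<lambda>k. (if k = k0 then e else 1) *\<^sub>R w k) u) = e * det (frame_matrix x w u)"
proof -
  define D :: "real^('a + 2)^('a + 2)" where
    "D = (\<chi> i j. if i = j then if j = Inl k0 then e else 1 else 0)"
  have "frame_matrix x (\<lambda>k. (if k = k0 then e else 1) *\<^sub>R w k) u = frame_matrix x w u ** D"
    by (auto simp: vec_eq_iff matrix_matrix_mult_def D_def frame_matrix_def if_distrib[of "(*) _"] mult.commute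
        split: sum.split cong: if_cong)
  moreover have "det D = e"
    by (subst det_diagonal) (simp_all add: D_def)
  ultimately show ?thesis by (simp add: det_mul)
qed

lemma continuous_on_det_frame_matrix:
  assumes "continuous_on S x" "\<And>k. continuous_on S (\<lambda>y. w y k)" "continuous_on S u"
  shows "continuous_on S (\<lambda>y. det (frame_matrix (x y) (w y) (u y)))"
proof -
  have "continuous_on S (\<lambda>y. frame_matrix (x y) (w y) (u y) $ i $ j)" for i j
    using assms
    by (cases j; cases "projr j = 1") (auto simp: frame_matrix_def intro!: continuous_intros)
  then show ?thesis
    unfolding det_def
    by (intro continuous_on_sum continuous_on_mult continuous_on_const continuous_on_prod)
qed

section \<open>The contact form under the flow and Legendrian lifts\<close>

lemma tangent_T1_contact_zero:
  assumes "z \<in> unit_tangent" "X \<in> tangent_T1 z" "mink (fst X) (snd z) = 0"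
  shows "fst X \<in> perp z" "snd X \<in> perp z"
  using assms by (auto simp: tangent_T1_iff perp_iff mink_commute)

lemma smooth_on_geod_flow:
  assumes "open S" "smooth_on \<tau> S" "smooth_on \<zeta> S"
  shows "smooth_on (\<lambda>x. geod_flow (\<tau> x) (\<zeta> x)) S"
  unfolding geod_flow_simp
  by (intro smooth_on_Pair smooth_on_add smooth_on_scaleR smooth_on_cosh smooth_on_sinh
      smooth_on_fst smooth_on_snd assms)

text \<open>A variable time contributes \<tau>' a times the generator, on which the contact form is
  1; so it adds the differential of \<tau> to the contact form.\<close>

lemma geod_flow_compose_has_derivative:
  assumes "(\<tau> has_derivative \<tau>') (at x)" "(\<zeta> has_derivative \<zeta>') (at x)"
  shows "((\<lambda>x. geod_flow (\<tau> x) (\<zeta> x)) has_derivative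
    (\<lambda>a. geod_flow (\<tau> x) (\<zeta>' a) + \<tau>' a *\<^sub>R flow_gen (geod_flow (\<tau> x) (\<zeta> x)))) (at x)"
proof -
  have "((cosh :: real \<Rightarrow> real) has_derivative (\<lambda>v. sinh y * v)) (at y)"
    "((sinh :: real \<Rightarrow> real) has_derivative (\<lambda>v. cosh y * v)) (at y)" for y
    by (auto intro!: derivative_eq_intros)
  from this[THEN diff_chain_at[OF assms(1)]]
  have "((\<lambda>x. cosh (\<tau> x)) has_derivative (\<lambda>a. sinh (\<tau> x) * \<tau>' a)) (at x)"
    "((\<lambda>x. sinh (\<tau> x)) has_derivative (\<lambda>a. cosh (\<tau> x) * \<tau>' a)) (at x)"
    by (simp_all add: o_def)
  then show ?thesis
    unfolding geod_flow_simp flow_gen_def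
    by (auto intro!: derivative_eq_intros assms(2) simp: algebra_simps)
qed

text \<open>Tangency removes <x,X1> and <v,X2> and ties <x,X2> to -<X1,v>, so the expansion leaves
  cosh^2 t - sinh^2 t times the original value.\<close>

lemma geod_flow_contact:
  assumes z: "z \<in> unit_tangent" and X: "X \<in> tangent_T1 z"
  shows "mink (fst (geod_flow t X)) (snd (geod_flow t z)) = mink (fst X) (snd z)"
proof -
  have h: "mink (fst z) (fst X) = 0" "mink (snd z) (snd X) = 0" "mink (fst z) (snd X) = - mink (fst X) (snd z)"
    using X unfolding tangent_T1_iff[OF z] by auto
  have "mink (fst (geod_flow t X)) (snd (geod_flow t z)) =
    (cosh t * cosh t - sinh t * sinh t) * mink (fst X) (snd z)"
    using h by (simp add: geod_flow_simp mink_simps mink_commute[of "fst X" "fst z"] mink_commute[of "snd X"] algebra_simps)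
  then show ?thesis using cosh_square_eq[of t] by (simp add: power2_eq_square)
qed

text \<open>The hypothesis \<open>imm\<close> expresses injectivity of the derivative of G at y0, as
  the generator spans the tangent kernel of the projection; \<open>lag\<close> is closedness of the
  contact form. The sign \<delta> is that of the frame at y0, which is constant once the ball is
  small.\<close>

lemma legendrian_lift:
  fixes \<zeta> :: "real^'n::finite \<Rightarrow> 'n minkowski \<times> 'n minkowski"
  assumes S: "open S" "y0 \<in> S" and \<zeta>: "smooth_on \<zeta> S" and ut: "\<And>x. x \<in> S \<Longrightarrow> \<zeta> x \<in> unit_tangent"
    and lag: "\<And>x a b. x \<in> S \<Longrightarrow> mink (fst (frechet_derivative \<zeta> (at x) a)) (snd (frechet_derivative \<zeta> (at x) b)) =
      mink (snd (frechet_derivative \<zeta> (at x) a)) (fst (frechet_derivative \<zeta> (at x) b))"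
    and imm: "\<And>a s. frechet_derivative \<zeta> (at y0) a = s *\<^sub>R flow_gen (\<zeta> y0) \<Longrightarrow> a = 0"
  obtains r \<eta> \<delta> where "r > 0" "ball y0 r \<subseteq> S" "smooth_on \<eta> (ball y0 r)" "\<delta> \<in> {1, -1}"
    "\<And>x. x \<in> ball y0 r \<Longrightarrow> \<eta> x \<in> unit_tangent \<and> geod_proj (\<eta> x) = geod_proj (\<zeta> x)"
    "\<And>x a. x \<in> ball y0 r \<Longrightarrow> mink (snd (\<eta> x)) (frechet_derivative (\<lambda>x. fst (\<eta> x)) (at x) a) = 0"
    "\<And>x. x \<in> ball y0 r \<Longrightarrow>
      \<delta> * det (frame_matrix (fst (\<eta> x)) (\<lambda>k. frechet_derivative (\<lambda>x. fst (\<eta> x)) (at x) (axis k 1)) (snd (\<eta> x))) > 0"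
proof -
  let ?D = "\<lambda>\<zeta> x. frechet_derivative \<zeta> (at x)"
  obtain r0 where r0: "r0 > 0" "ball y0 r0 \<subseteq> S" using S by (rule openE)
  let ?B = "ball y0 r0"
  have y0: "y0 \<in> ?B" using r0 by simp
  note \<zeta>B = smooth_on_mono[OF \<zeta> r0(2)] and utB = ut[OF subsetD[OF r0(2)]]
  have fs: "?D (\<lambda>x. fst (\<xi> x)) x = (\<lambda>a. fst (?D \<xi> x a))" "?D (\<lambda>x. snd (\<xi> x)) x = (\<lambda>a. snd (?D \<xi> x a))"
    if "smooth_on \<xi> ?B" "x \<in> ?B" for \<xi> :: "real^'n \<Rightarrow> 'n minkowski \<times> 'n minkowski" and x
    using smooth_on_has_derivative[OF that]
    by (auto intro!: frechet_derivative_eq has_derivative_fst has_derivative_snd)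
  have tan: "?D \<xi> x a \<in> tangent_T1 (\<xi> x)"
    if "smooth_on \<xi> ?B" "\<And>x. x \<in> ?B \<Longrightarrow> \<xi> x \<in> unit_tangent" "x \<in> ?B" for \<xi> :: "real^'n \<Rightarrow> 'n minkowski \<times> 'n minkowski" and x a
    using derivative_in_tangent_T1[OF smooth_on_has_derivative[OF that(1,3)] open_ball that(3,2)] .
  define \<alpha> where "\<alpha> x a = mink (fst (?D \<zeta> x a)) (snd (\<zeta> x))" for x a
  have \<alpha>_eq: "\<alpha> x a = mink (?D (\<lambda>x. fst (\<zeta> x)) x a) (snd (\<zeta> x))" if "x \<in> ?B" for x a
    by (simp add: \<alpha>_def fs[OF \<zeta>B that])
  obtain f where f: "smooth_on f ?B" "\<And>x. x \<in> ?B \<Longrightarrow> (f has_derivative \<alpha> x) (at x)"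
  proof (rule closed_form_exact_on_ball)
    show "linear (\<alpha> x)" if "x \<in> ?B" for x
      unfolding \<alpha>_def using smooth_on_has_derivative[OF \<zeta>B that]
      by (intro bounded_linear.linear bounded_linear_compose[OF mink.bounded_linear_left]
          bounded_linear_compose[OF bounded_linear_fst] has_derivative_bounded_linear)
    show "smooth_on (\<lambda>x. \<alpha> x v) ?B" for v
      unfolding \<alpha>_def
      by (intro smooth_on_mink smooth_on_fst smooth_on_snd smooth_on_frechet_derivative \<zeta>B open_ball)
    fix x a b assume x: "x \<in> ?B"
    have "?D (\<lambda>x. \<alpha> x a) x = ?D (\<lambda>x. mink (?D (\<lambda>x. fst (\<zeta> x)) x a) (snd (\<zeta> x))) x" for a
      by (rule frechet_derivative_cong[OF open_ball x \<alpha>_eq])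
    then show "?D (\<lambda>x. \<alpha> x a) x b = ?D (\<lambda>x. \<alpha> x b) x a"
      using exterior_derivative_contact_form[OF open_ball x smooth_on_fst[OF open_ball \<zeta>B] smooth_on_snd[OF open_ball \<zeta>B], of a b]
        lag[of x a b] x r0(2) by (auto simp: fs[OF \<zeta>B x] mink_commute)
  qed blast
  define \<xi> where "\<xi> x = geod_flow (- f x) (\<zeta> x)" for x
  have \<xi>: "smooth_on \<xi> ?B"
    unfolding \<xi>_def by (intro smooth_on_geod_flow smooth_on_uminus f(1) \<zeta>B open_ball)
  have ut\<xi>: "\<xi> x \<in> unit_tangent" if "x \<in> ?B" for x
    unfolding \<xi>_def by (rule geod_flow_unit_tangent[OF utB[OF that]])
  have D\<xi>: "?D \<xi> x a = geod_flow (- f x) (?D \<zeta> x a) - \<alpha> x a *\<^sub>R flow_gen (\<xi> x)" if x: "x \<in> ?B" for x a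
    using frechet_derivative_eq[OF geod_flow_compose_has_derivative[OF has_derivative_minus[OF f(2)[OF x]]
          smooth_on_has_derivative[OF \<zeta>B x]]]
    by (simp add: \<xi>_def[abs_def])
  have contact: "mink (fst (?D \<xi> x a)) (snd (\<xi> x)) = 0" if x: "x \<in> ?B" for x a
  proof -
    have "mink (snd (\<xi> x)) (snd (\<xi> x)) = 1" using ut\<xi>[OF x] by (cases "\<xi> x") (auto simp: unit_tangent_iff)
    moreover have "mink (fst (geod_flow (- f x) (?D \<zeta> x a))) (snd (\<xi> x)) = \<alpha> x a"
      unfolding \<xi>_def \<alpha>_def by (rule geod_flow_contact[OF utB[OF x] tan[OF \<zeta>B utB x]])
    ultimately show ?thesis by (simp add: D\<xi>[OF x] mink_simps flow_gen_def split_beta)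
  qed
  have perp: "fst (?D \<xi> x a) \<in> perp (\<xi> x)" "snd (?D \<xi> x a) \<in> perp (\<xi> x)" if "x \<in> ?B" for x a
    using tangent_T1_contact_zero[OF ut\<xi>[OF that] tan[OF \<xi> ut\<xi> that] contact[OF that]] by auto
  obtain t where t: "\<And>a. cosh t *\<^sub>R fst (?D \<xi> y0 a) + sinh t *\<^sub>R snd (?D \<xi> y0 a) = 0 \<Longrightarrow> a = 0"
  proof -
    have "\<exists>t. \<forall>a. cosh t *\<^sub>R fst (?D \<xi> y0 a) + sinh t *\<^sub>R snd (?D \<xi> y0 a) = 0 \<longrightarrow> a = 0"
    proof (rule symmetric_pencil_injective[OF ut\<xi>[OF y0] perp(1)[OF y0] perp(2)[OF y0]])
      show "mink (fst (?D \<xi> y0 a)) (snd (?D \<xi> y0 b)) = mink (fst (?D \<xi> y0 b)) (snd (?D \<xi> y0 a))" for a b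
        using contact_form_zero_imp_symmetric[OF open_ball y0 smooth_on_fst[OF open_ball \<xi>] smooth_on_snd[OF open_ball \<xi>]]
          contact unfolding fs[OF \<xi> y0] by (simp add: fs[OF \<xi>])
      fix a assume "fst (?D \<xi> y0 a) = 0" "snd (?D \<xi> y0 a) = 0"
      then have "?D \<xi> y0 a = 0" by (simp add: prod_eq_iff)
      then have "geod_flow (- f y0) (?D \<zeta> y0 a) = \<alpha> y0 a *\<^sub>R flow_gen (\<xi> y0)" by (simp add: D\<xi>[OF y0])
      \<comment> \<open>The flow is linear and carries the generator at \<zeta> y0 to the generator
        at \<xi> y0, so the motion can be undone below.\<close>
      also have "\<dots> = geod_flow (- f y0) (\<alpha> y0 a *\<^sub>R flow_gen (\<zeta> y0))"
        by (simp add: \<xi>_def geod_flow_simp flow_gen_def split_beta algebra_simps)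
      finally have "geod_flow (f y0) (geod_flow (- f y0) (?D \<zeta> y0 a)) =
          geod_flow (f y0) (geod_flow (- f y0) (\<alpha> y0 a *\<^sub>R flow_gen (\<zeta> y0)))"
        by (rule arg_cong)
      then have "?D \<zeta> y0 a = \<alpha> y0 a *\<^sub>R flow_gen (\<zeta> y0)" by (simp add: geod_flow_add)
      then show "a = 0" by (rule imm)
    qed
    then show ?thesis using that by blast
  qed
  \<comment> \<open>A constant time keeps the contact form zero. It is chosen for the single point
    y0; continuity of the determinant spreads injectivity to a ball.\<close>
  define \<eta> where "\<eta> x = geod_flow t (\<xi> x)" for x
  have \<eta>: "smooth_on \<eta> ?B"
    unfolding \<eta>_def by (rule smooth_on_bounded_linear_compose[OF bounded_linear_geod_flow open_ball \<xi>])
  have ut\<eta>: "\<eta> x \<in> unit_tangent" if "x \<in> ?B" for x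
    unfolding \<eta>_def by (rule geod_flow_unit_tangent[OF ut\<xi>[OF that]])
  have D\<eta>: "?D \<eta> x a = geod_flow t (?D \<xi> x a)" if "x \<in> ?B" for x a
    unfolding \<eta>_def[abs_def]
    using frechet_derivative_eq[OF bounded_linear.has_derivative[OF bounded_linear_geod_flow smooth_on_has_derivative[OF \<xi> that]]]
    by simp
  let ?W = "\<lambda>x. ?D (\<lambda>x. fst (\<eta> x)) x"
  let ?d = "\<lambda>x. det (frame_matrix (fst (\<eta> x)) (\<lambda>k. ?W x (axis k 1)) (snd (\<eta> x)))"
  have W: "?W x a = cosh t *\<^sub>R fst (?D \<xi> x a) + sinh t *\<^sub>R snd (?D \<xi> x a)" if "x \<in> ?B" for x a
    by (simp add: fs[OF \<eta> that] D\<eta>[OF that] geod_flow_simp)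
  have Wperp: "?W x a \<in> perp (fst (\<eta> x), snd (\<eta> x))" if "x \<in> ?B" for x a
    using perp[OF that, of a] unfolding W[OF that]
    by (simp add: \<eta>_def geod_flow_simp perp_iff mink_simps)
  have Wlin: "linear (?W x)" if "x \<in> ?B" for x
    by (rule has_derivative_linear[OF smooth_on_has_derivative[OF smooth_on_fst[OF open_ball \<eta>] that]])
  have "?d y0 \<noteq> 0"
    by (rule det_frame_matrix_nonzero[OF _ Wlin[OF y0] Wperp[OF y0]])
      (use ut\<eta>[OF y0] t W[OF y0] in auto)
  define \<delta> where "\<delta> = sgn (?d y0)"
  have \<delta>: "\<delta> \<in> {1, -1}" "\<delta> * ?d y0 > 0" using \<open>?d y0 \<noteq> 0\<close> by (auto simp: \<delta>_def sgn_if)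
  have "continuous_on ?B (\<lambda>x. \<delta> * ?d x)"
    by (intro continuous_on_mult continuous_on_const continuous_on_det_frame_matrix smooth_on_imp_continuous_on
        smooth_on_frechet_derivative smooth_on_fst smooth_on_snd \<eta> open_ball)
  then have "open (?B \<inter> (\<lambda>x. \<delta> * ?d x) -` {0<..})"
    by (intro continuous_open_preimage) auto
  moreover have "y0 \<in> ?B \<inter> (\<lambda>x. \<delta> * ?d x) -` {0<..}" using \<delta> y0 by simp
  ultimately obtain r where r: "r > 0" "ball y0 r \<subseteq> ?B \<inter> (\<lambda>x. \<delta> * ?d x) -` {0<..}" by (rule openE)
  show ?thesis
  proof (rule that[OF r(1) _ smooth_on_mono[OF \<eta>] \<delta>(1)])
    show "ball y0 r \<subseteq> S" "ball y0 r \<subseteq> ?B" using r(2) r0(2) by auto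
    fix x assume "x \<in> ball y0 r"
    then have x: "x \<in> ?B" "\<delta> * ?d x > 0" using r(2) by auto
    then show "\<delta> * ?d x > 0" by simp
    show "\<eta> x \<in> unit_tangent \<and> geod_proj (\<eta> x) = geod_proj (\<zeta> x)"
      using ut\<eta>[OF x(1)] by (simp add: \<eta>_def \<xi>_def)
    show "mink (snd (\<eta> x)) (?W x a) = 0" for a
      using Wperp[OF x(1), of a] by (simp add: perp_iff)
  qed
qed

section \<open>Gauss maps on manifolds\<close>

lemma smooth_atlasI:
  assumes "(\<Union>(U, \<phi>)\<in>A. U) = topspace X"
    and "\<And>U \<phi>. (U, \<phi>) \<in> A \<Longrightarrow> openin X U" "\<And>U \<phi>. (U, \<phi>) \<in> A \<Longrightarrow> open (\<phi> ` U)"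
    and "\<And>U \<phi>. (U, \<phi>) \<in> A \<Longrightarrow> homeomorphic_map (subtopology X U) (top_of_set (\<phi> ` U)) \<phi>"
    and "\<And>U \<phi> V \<psi>. (U, \<phi>) \<in> A \<Longrightarrow> (V, \<psi>) \<in> A \<Longrightarrow> smooth_on (\<psi> \<circ> inv_into U \<phi>) (\<phi> ` (U \<inter> V))"
  shows "smooth_atlas X A"
  unfolding smooth_atlas_def by (intro conjI ballI case_prodI2) (use assms in simp_all)

lemma smooth_atlasD:
  assumes "smooth_atlas X A"
  shows "(\<Union>(U, \<phi>)\<in>A. U) = topspace X"
    and "(U, \<phi>) \<in> A \<Longrightarrow> openin X U" "(U, \<phi>) \<in> A \<Longrightarrow> open (\<phi> ` U)"
    and "(U, \<phi>) \<in> A \<Longrightarrow> homeomorphic_map (subtopology X U) (top_of_set (\<phi> ` U)) \<phi>"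
    and "(U, \<phi>) \<in> A \<Longrightarrow> (V, \<psi>) \<in> A \<Longrightarrow> smooth_on (\<psi> \<circ> inv_into U \<phi>) (\<phi> ` (U \<inter> V))"
  using assms unfolding smooth_atlas_def by (simp_all add: case_prod_unfold) force+

lemma smooth_atlas_chart:
  assumes "smooth_atlas X A" "(U, \<phi>) \<in> A"
  shows chart_subset_topspace: "U \<subseteq> topspace X"
    and chart_inj_on: "inj_on \<phi> U"
    and chart_image_open: "openin X T \<Longrightarrow> T \<subseteq> U \<Longrightarrow> open (\<phi> ` T)"
    and chart_preimage_open: "open O' \<Longrightarrow> openin X {p \<in> U. \<phi> p \<in> O'}"
proof -
  have U: "openin X U" and h: "homeomorphic_map (subtopology X U) (top_of_set (\<phi> ` U)) \<phi>"
    by (rule smooth_atlasD(2)[OF assms], rule smooth_atlasD(4)[OF assms])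
  show sub: "U \<subseteq> topspace X" using U by (rule openin_subset)
  then have ts: "topspace (subtopology X U) = U" by auto
  show "inj_on \<phi> U" using homeomorphic_imp_injective_map[OF h] ts by simp
  show "open (\<phi> ` T)" if "openin X T" "T \<subseteq> U"
  proof -
    have "openin (subtopology X U) T"
      using that by (metis inf.absorb_iff1 openin_subtopology)
    then have "openin (top_of_set (\<phi> ` U)) (\<phi> ` T)"
      using homeomorphic_imp_open_map[OF h] by (simp add: open_map_def)
    then show ?thesis using smooth_atlasD(3)[OF assms] openin_open_eq by blast
  qed
  have "continuous_map (subtopology X U) (top_of_set (\<phi> ` U)) \<phi>"
    by (rule homeomorphic_imp_continuous_map[OF h])
  then have c: "continuous_map (subtopology X U) euclidean \<phi>"
    by (rule continuous_map_into_fulltopology)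
  show "openin X {p \<in> U. \<phi> p \<in> O'}" if "open O'"
    using openin_continuous_map_preimage[OF c, of O'] that openin_trans_full[OF _ U] unfolding ts by simp
qed

lemma smooth_atlas_subset:
  assumes "smooth_atlas X A" "B \<subseteq> A" "(\<Union>(U, \<phi>)\<in>B. U) = topspace X"
  shows "smooth_atlas X B"
  by (rule smooth_atlasI[OF assms(3)])
    (blast intro: smooth_atlasD(2-5)[OF assms(1)] subsetD[OF assms(2)])+

text \<open>\<open>restrict_atlas\<close> shrinks domains and keeps coordinate maps, so inverse
  charts before and after restriction have to be compared.\<close>

lemma inv_into_subset_eq:
  assumes "inj_on \<phi> V" "U \<subseteq> V" "y \<in> \<phi> ` U"
  shows "inv_into U \<phi> y = inv_into V \<phi> y"
  using assms by (metis imageE inj_on_subset inv_into_f_f subsetD)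

lemma smooth_atlas_restrict:
  assumes A: "smooth_atlas X A" and U: "openin X U"
  shows "smooth_atlas (subtopology X U) (restrict_atlas A U)"
proof -
  have chart: "openin (subtopology X U) V" "open (\<phi> ` V)"
      "homeomorphic_map (subtopology (subtopology X U) V) (top_of_set (\<phi> ` V)) \<phi>"
    if VA: "(V, \<phi>) \<in> restrict_atlas A U" for V \<phi>
  proof -
    obtain V0 where V: "V = U \<inter> V0" "(V0, \<phi>) \<in> A" using VA by (auto simp: restrict_atlas_def)
    have op: "openin X V0" by (rule smooth_atlasD(2)[OF A V(2)])
    show "openin (subtopology X U) V"
      using op V(1) by (metis inf_commute openin_subtopology)
    show "open (\<phi> ` V)" using chart_image_open[OF A V(2), of V] op U V(1) by auto
    have "V0 \<subseteq> topspace X" "inj_on \<phi> V0" using smooth_atlas_chart[OF A V(2)] by auto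
    then have "homeomorphic_map (subtopology (subtopology X V0) V) (subtopology (top_of_set (\<phi> ` V0)) (\<phi> ` V)) \<phi>"
      using V(1) by (intro homeomorphic_map_subtopologies smooth_atlasD(4)[OF A V(2)]) auto
    moreover have "subtopology (subtopology X V0) V = subtopology (subtopology X U) V"
      using V(1) by (simp add: subtopology_subtopology inf.absorb2 inf.left_commute inf_commute)
    moreover have "\<phi> ` V0 \<inter> \<phi> ` V = \<phi> ` V" using V(1) by auto
    ultimately show "homeomorphic_map (subtopology (subtopology X U) V) (top_of_set (\<phi> ` V)) \<phi>"
      by (simp add: subtopology_subtopology)
  qed
  have trans: "smooth_on (\<psi> \<circ> inv_into V \<phi>) (\<phi> ` (V \<inter> W))"
    if VA: "(V, \<phi>) \<in> restrict_atlas A U" "(W, \<psi>) \<in> restrict_atlas A U" for V \<phi> W \<psi>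
  proof -
    obtain V0 W0 where V: "V = U \<inter> V0" "(V0, \<phi>) \<in> A" and W: "W = U \<inter> W0" "(W0, \<psi>) \<in> A"
      using VA by (auto simp: restrict_atlas_def)
    have o: "open (\<phi> ` (V \<inter> W))"
      using chart_image_open[OF A V(2), of "V \<inter> W"] smooth_atlasD(2)[OF A V(2)] smooth_atlasD(2)[OF A W(2)] U V(1) W(1)
      by auto
    have "smooth_on (\<psi> \<circ> inv_into V0 \<phi>) (\<phi> ` (V \<inter> W))"
      by (rule smooth_on_mono[OF smooth_atlasD(5)[OF A V(2) W(2)]]) (use V(1) W(1) in auto)
    then show ?thesis
      by (rule smooth_on_cong[OF o, rotated])
        (use inv_into_subset_eq[OF chart_inj_on[OF A V(2)], of V] V(1) in auto)
  qed
  have "(\<Union>(V, \<phi>)\<in>restrict_atlas A U. V) = U \<inter> (\<Union>(V, \<phi>)\<in>A. V)"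
    by (auto simp: restrict_atlas_def)
  then have "(\<Union>(V, \<phi>)\<in>restrict_atlas A U. V) = topspace (subtopology X U)"
    unfolding smooth_atlasD(1)[OF A] by auto
  then show ?thesis by (intro smooth_atlasI chart trans)
qed

lemma inv_into_linear_involution:
  assumes "inj_on \<phi> U" "\<And>x. \<rho> (\<rho> x) = x" "y \<in> (\<rho> \<circ> \<phi>) ` U"
  shows "inv_into U (\<rho> \<circ> \<phi>) y = inv_into U \<phi> (\<rho> y)"
proof -
  obtain p where p: "p \<in> U" "y = \<rho> (\<phi> p)" using assms(3) by auto
  have "inj_on (\<rho> \<circ> \<phi>) U"
    using assms(1) by (metis (no_types, lifting) assms(2) comp_apply inj_on_def)
  then have "inv_into U (\<rho> \<circ> \<phi>) y = p" using p by (metis comp_apply inv_into_f_f)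
  then show ?thesis using p assms(1,2) by simp
qed

lemma open_image_linear_involution:
  fixes \<rho> :: "'e::euclidean_space \<Rightarrow> 'e"
  assumes "bounded_linear \<rho>" "\<And>x. \<rho> (\<rho> x) = x" "open S"
  shows "open (\<rho> ` S)"
proof -
  have "\<rho> ` S = \<rho> -` S" using assms(2) by (metis (no_types, lifting) bij_betw_def involuntory_imp_bij bij_vimage_eq_inv_image inv_equality)
  then show ?thesis using assms(1,3) by (metis linear_continuous_on open_vimage)
qed

text \<open>Makes a chart of the opposite orientation available in the same smooth structure. Each
  chart of the enlarged atlas is an old one followed by the identity or \<rho>, so all transitions
  are old ones composed with linear maps.\<close>

lemma smooth_atlas_insert_linear_involution:
  fixes \<rho> :: "'e::euclidean_space \<Rightarrow> 'e"
  assumes A: "smooth_atlas X A" "(U, \<phi>) \<in> A" and \<rho>: "bounded_linear \<rho>" "\<And>x. \<rho> (\<rho> x) = x"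
  shows "smooth_atlas X (insert (U, \<rho> \<circ> \<phi>) A)"
proof -
  have o: "open (\<phi> ` T)" if "T = V \<inter> W" "(V, \<phi>) \<in> A" "(W, \<psi>) \<in> A" for T V W \<phi> \<psi>
    using chart_image_open[OF A(1) that(2), of T] smooth_atlasD(2)[OF A(1)] that by (metis inf_le1 openin_Int)
  have trans: "smooth_on ((\<rho>2 \<circ> \<psi>) \<circ> inv_into V (\<rho>1 \<circ> \<phi>)) ((\<rho>1 \<circ> \<phi>) ` (V \<inter> W))"
    if "(V, \<phi>) \<in> A" "(W, \<psi>) \<in> A" "\<rho>1 \<in> {id, \<rho>}" "\<rho>2 \<in> {id, \<rho>}" for V W \<phi> \<psi> \<rho>1 \<rho>2
  proof -
    have \<rho>i: "bounded_linear \<rho>1" "\<And>x. \<rho>1 (\<rho>1 x) = x" "bounded_linear \<rho>2"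
      using that(3,4) \<rho> by (auto simp: id_def)
    let ?T = "(\<rho>1 \<circ> \<phi>) ` (V \<inter> W)"
    have oT: "open ?T"
      using open_image_linear_involution[OF \<rho>i(1,2) o[OF refl that(1,2)]] by (simp add: image_comp)
    have "smooth_on ((\<psi> \<circ> inv_into V \<phi>) \<circ> \<rho>1) ?T"
      by (rule smooth_on_compose[OF oT o[OF refl that(1,2)] _ smooth_atlasD(5)[OF A(1) that(1,2)] smooth_on_bounded_linear[OF \<rho>i(1) oT]])
        (auto simp: \<rho>i(2))
    then have "smooth_on (\<lambda>y. \<rho>2 (((\<psi> \<circ> inv_into V \<phi>) \<circ> \<rho>1) y)) ?T"
      by (rule smooth_on_bounded_linear_compose[OF \<rho>i(3) oT])
    then show ?thesis
      by (rule smooth_on_cong[OF oT, rotated])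
        (use inv_into_linear_involution[OF chart_inj_on[OF A(1) that(1)] \<rho>i(2)] in auto)
  qed
  have homeo: "homeomorphic_map (subtopology X U) (top_of_set ((\<rho> \<circ> \<phi>) ` U)) (\<rho> \<circ> \<phi>)"
  proof (rule homeomorphic_map_compose[OF smooth_atlasD(4)[OF A]])
    have "homeomorphic_maps euclidean euclidean \<rho> \<rho>"
      using \<rho> by (simp add: homeomorphic_maps_def linear_continuous_on)
    then have "homeomorphic_map euclidean euclidean \<rho>" using homeomorphic_map_maps by blast
    then show "homeomorphic_map (top_of_set (\<phi> ` U)) (top_of_set ((\<rho> \<circ> \<phi>) ` U)) \<rho>"
      by (rule homeomorphic_map_subtopologies) auto
  qed
  have op: "open ((\<rho> \<circ> \<phi>) ` U)"
    using open_image_linear_involution[OF \<rho> smooth_atlasD(3)[OF A]] by (simp add: image_comp)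
  have form: "\<exists>\<rho>1\<in>{id, \<rho>}. \<exists>\<phi>1. \<phi>' = \<rho>1 \<circ> \<phi>1 \<and> (V, \<phi>1) \<in> A"
    if "(V, \<phi>') \<in> insert (U, \<rho> \<circ> \<phi>) A" for V \<phi>'
  proof (cases "(V, \<phi>') \<in> A")
    case True
    then show ?thesis by (intro bexI[of _ id] exI[of _ \<phi>']) auto
  next
    case False
    then show ?thesis using that A(2) by (intro bexI[of _ \<rho>] exI[of _ \<phi>]) auto
  qed
  have "smooth_on (\<psi> \<circ> inv_into V \<phi>') (\<phi>' ` (V \<inter> W))"
    if VW: "(V, \<phi>') \<in> insert (U, \<rho> \<circ> \<phi>) A" "(W, \<psi>) \<in> insert (U, \<rho> \<circ> \<phi>) A" for V \<phi>' W \<psi>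
  proof -
    obtain \<rho>1 \<phi>1 where 1: "\<rho>1 \<in> {id, \<rho>}" "\<phi>' = \<rho>1 \<circ> \<phi>1" "(V, \<phi>1) \<in> A" using form[OF VW(1)] by blast
    obtain \<rho>2 \<psi>1 where 2: "\<rho>2 \<in> {id, \<rho>}" "\<psi> = \<rho>2 \<circ> \<psi>1" "(W, \<psi>1) \<in> A" using form[OF VW(2)] by blast
    show ?thesis using trans[OF 1(3) 2(3) 1(1) 2(1)] unfolding 1(2) 2(2) .
  qed
  moreover have "(\<Union>(V, \<psi>)\<in>insert (U, \<rho> \<circ> \<phi>) A. V) = U \<union> (\<Union>(V, \<psi>)\<in>A. V)"
    by simp
  then have "(\<Union>(V, \<psi>)\<in>insert (U, \<rho> \<circ> \<phi>) A. V) = topspace X"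
    unfolding smooth_atlasD(1)[OF A(1)] using chart_subset_topspace[OF A] by blast
  moreover have "openin X V \<and> open (\<phi>' ` V) \<and> homeomorphic_map (subtopology X V) (top_of_set (\<phi>' ` V)) \<phi>'"
    if "(V, \<phi>') \<in> insert (U, \<rho> \<circ> \<phi>) A" for V \<phi>'
  proof (cases "(V, \<phi>') \<in> A")
    case True
    then show ?thesis using smooth_atlasD(2-4)[OF A(1)] by simp
  next
    case False
    then show ?thesis using that op homeo smooth_atlasD(2)[OF A] by simp
  qed
  ultimately show ?thesis
    by (intro smooth_atlasI) simp_all
qed

text \<open>By the chain rule the derivative of the reverse transition is a left inverse.\<close>

lemma transition_has_injective_derivative:
  assumes A: "smooth_atlas X A" "(U, \<phi>) \<in> A" "(V, \<psi>) \<in> A" and p: "p \<in> U \<inter> V"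
  obtains T where "((\<psi> \<circ> inv_into U \<phi>) has_derivative T) (at (\<phi> p))" "inj T"
proof -
  have o: "open (\<phi> ` (U \<inter> V))"
    using chart_image_open[OF A(1,2), of "U \<inter> V"] smooth_atlasD(2)[OF A(1,2)] smooth_atlasD(2)[OF A(1,3)] by auto
  obtain T where T: "((\<psi> \<circ> inv_into U \<phi>) has_derivative T) (at (\<phi> p))"
    using smooth_on_has_derivative[OF smooth_atlasD(5)[OF A]] p by blast
  have inv: "inv_into U \<phi> (\<phi> q) = q" if "q \<in> U" for q using chart_inj_on[OF A(1,2)] that by simp
  have inv': "inv_into V \<psi> (\<psi> q) = q" if "q \<in> V" for q using chart_inj_on[OF A(1,3)] that by simp
  obtain T' where T': "((\<phi> \<circ> inv_into V \<psi>) has_derivative T') (at (\<psi> p))"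
    using smooth_on_has_derivative[OF smooth_atlasD(5)[OF A(1,3,2)]] p by blast
  then have "((\<phi> \<circ> inv_into V \<psi>) \<circ> (\<psi> \<circ> inv_into U \<phi>) has_derivative T' \<circ> T) (at (\<phi> p))"
    by (intro diff_chain_at[OF T]) (use p inv in simp)
  then have "((\<lambda>y. y) has_derivative T' \<circ> T) (at (\<phi> p))"
    by (rule has_derivative_transform_within_open[OF _ o]) (use p inv inv' in auto)
  then have "T' \<circ> T = (\<lambda>y. y)" using has_derivative_unique[OF _ has_derivative_ident] by blast
  then have "inj T" by (metis (no_types, lifting) comp_apply injI)
  then show ?thesis using T that by blast
qed

text \<open>The hypersurface is constructed in one chart but must be smooth in every chart of the
  restricted atlas; the two expressions differ by a transition map.\<close>

lemma smooth_map_through_chart: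
  fixes g :: "'e::euclidean_space \<Rightarrow> 'f::euclidean_space"
  assumes A: "smooth_atlas X A" "(topspace X, \<phi>) \<in> A" and g: "smooth_on g (\<phi> ` topspace X)"
  shows "smooth_map X A euclidean euclidean_atlas (g \<circ> \<phi>)"
  unfolding smooth_map_def
proof (intro conjI ballI, safe)
  have "continuous_map (subtopology X (topspace X)) (top_of_set (\<phi> ` topspace X)) \<phi>"
    using smooth_atlasD(4)[OF A] by (rule homeomorphic_imp_continuous_map)
  then have "continuous_map X (top_of_set (\<phi> ` topspace X)) \<phi>" by simp
  moreover have "continuous_map (top_of_set (\<phi> ` topspace X)) euclidean g"
    using smooth_on_imp_continuous_on[OF g] by simp
  ultimately show "continuous_map X euclidean (g \<circ> \<phi>)" by (rule continuous_map_compose)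
next
  fix V \<psi> W and c :: "'f \<Rightarrow> 'f" assume V: "(V, \<psi>) \<in> A" and W: "(W, c) \<in> euclidean_atlas"
  have VX: "V \<subseteq> topspace X" by (rule chart_subset_topspace[OF A(1) V])
  have t: "smooth_on (\<phi> \<circ> inv_into V \<psi>) (\<psi> ` V)"
    using smooth_atlasD(5)[OF A(1) V A(2)] VX by (simp add: Int_absorb2)
  have "smooth_on (g \<circ> (\<phi> \<circ> inv_into V \<psi>)) (\<psi> ` V)"
    by (rule smooth_on_compose[OF smooth_atlasD(3)[OF A(1) V] smooth_atlasD(3)[OF A] _ g t])
      (use VX chart_inj_on[OF A(1) V] in auto)
  then show "smooth_on (c \<circ> (g \<circ> \<phi>) \<circ> inv_into V \<psi>) (\<psi> ` {p \<in> V. (g \<circ> \<phi>) p \<in> W})"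
    using W by (simp add: euclidean_atlas_def comp_assoc)
qed

text \<open>Changing the chart precomposes the derivative with the injective T, so immersivity and
  orthogonality to the normal pass from one chart to all.\<close>

lemma chart_deriv_through_chart:
  fixes g :: "'e::euclidean_space \<Rightarrow> 'f::euclidean_space"
  assumes A: "smooth_atlas X A" "(topspace X, \<phi>) \<in> A" "(V, \<psi>) \<in> A" and g: "smooth_on g (\<phi> ` topspace X)"
    and p: "p \<in> V"
  obtains T where "chart_deriv V \<psi> id (g \<circ> \<phi>) p = (\<lambda>a. frechet_derivative g (at (\<phi> p)) (T a))" "inj T" "linear T"
proof -
  have pX: "p \<in> topspace X" using chart_subset_topspace[OF A(1,3)] p by blast
  obtain T where T: "((\<phi> \<circ> inv_into V \<psi>) has_derivative T) (at (\<psi> p))" "inj T"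
    using transition_has_injective_derivative[OF A(1,3,2)] p pX by blast
  have "(g has_derivative frechet_derivative g (at (\<phi> p))) (at ((\<phi> \<circ> inv_into V \<psi>) (\<psi> p)))"
    using smooth_on_has_derivative[OF g] pX p chart_inj_on[OF A(1,3)] by simp
  from diff_chain_at[OF T(1) this]
  have "chart_deriv V \<psi> id (g \<circ> \<phi>) p = (\<lambda>a. frechet_derivative g (at (\<phi> p)) (T a))"
    unfolding chart_deriv_def by (subst frechet_derivative_eq) (simp_all add: o_def)
  then show ?thesis using T has_derivative_linear that by blast
qed

section \<open>Lagrangian immersions and Gauss maps\<close>

lemma topspace_geod_top: "topspace geod_top \<subseteq> geodesics"
  using openin_topspace openin_geod_top by blast

lemma smooth_map_into_euclidean:
  assumes "smooth_map X A euclidean euclidean_atlas f" "(V, \<phi>) \<in> A"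
  shows "smooth_on (f \<circ> inv_into V \<phi>) (\<phi> ` V)"
  using assms unfolding smooth_map_def euclidean_atlas_def by fastforce

lemma gauss_maps_imp_lagrangian:
  fixes A :: "('a, real^'n::finite) chart set" and G :: "'a \<Rightarrow> 'n geodesic"
  assumes A: "smooth_atlas X A" and G: "smooth_map X A geod_top geod_atlas G"
    and gauss: "\<And>p. p \<in> topspace X \<Longrightarrow> \<exists>U B \<sigma> \<nu>. openin X U \<and> p \<in> U \<and>
       hyp_immersion (subtopology X U) (restrict_atlas A U) \<sigma> \<and>
       unit_normal_field \<epsilon> (subtopology X U) (restrict_atlas A U) B \<sigma> \<nu> \<and>
       (\<forall>q\<in>U. G q = gauss_map \<sigma> \<nu> q)"
  shows "lagrangian A G"
  unfolding lagrangian_def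
proof clarify
  fix V \<phi> W c p a b
  assume V: "(V, \<phi>) \<in> A" and W: "(W, c) \<in> geod_atlas" and p: "p \<in> V" "G p \<in> W"
  note VX = chart_subset_topspace[OF A V] and inj = chart_inj_on[OF A V]
  obtain U B \<sigma> \<nu> where *: "openin X U \<and> p \<in> U \<and>
       hyp_immersion (subtopology X U) (restrict_atlas A U) \<sigma> \<and>
       unit_normal_field \<epsilon> (subtopology X U) (restrict_atlas A U) B \<sigma> \<nu> \<and>
       (\<forall>q\<in>U. G q = gauss_map \<sigma> \<nu> q)"
    using gauss[OF subsetD[OF VX p(1)]] by (elim exE)
  then have U: "openin X U" "p \<in> U"
    and \<sigma>: "hyp_immersion (subtopology X U) (restrict_atlas A U) \<sigma>"
    and \<nu>: "unit_normal_field \<epsilon> (subtopology X U) (restrict_atlas A U) B \<sigma> \<nu>"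
    and Gq: "\<And>q. q \<in> U \<Longrightarrow> G q = gauss_map \<sigma> \<nu> q"
    by simp_all
  have UV: "(U \<inter> V, \<phi>) \<in> restrict_atlas A U" using V unfolding restrict_atlas_def by force
  define S where "S = \<phi> ` {q \<in> U \<inter> V. G q \<in> W}"
  have "openin X {q \<in> topspace X. G q \<in> W}"
    using G geod_atlasD(1)[OF W] by (auto simp: smooth_map_def intro: openin_continuous_map_preimage)
  then have "openin X (U \<inter> V \<inter> {q \<in> topspace X. G q \<in> W})"
    by (intro openin_Int U smooth_atlasD(2)[OF A V])
  moreover have "U \<inter> V \<inter> {q \<in> topspace X. G q \<in> W} = {q \<in> U \<inter> V. G q \<in> W}" using VX by auto
  ultimately have S: "open S" unfolding S_def by (intro chart_image_open[OF A V]) auto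
  have pS: "\<phi> p \<in> S" using p U by (auto simp: S_def)
  \<comment> \<open>The conditions on \<sigma> and \<nu> refer to the restricted atlas, hence to the
    inverse chart on U \<inter> V; \<open>chart_deriv\<close> of G uses the one on V. They agree on
    S.\<close>
  define s where "s = \<sigma> \<circ> inv_into (U \<inter> V) \<phi>"
  define n where "n = \<nu> \<circ> inv_into (U \<inter> V) \<phi>"
  have "smooth_on s (\<phi> ` (U \<inter> V))" "smooth_on n (\<phi> ` (U \<inter> V))"
    using \<sigma> \<nu> smooth_map_into_euclidean[OF _ UV]
    by (auto simp: s_def n_def hyp_immersion_def immersion_def unit_normal_field_def)
  then have sm: "smooth_on s S" "smooth_on n S"
    by (auto simp: S_def elim!: smooth_on_mono)
  have inv: "inv_into (U \<inter> V) \<phi> (\<phi> q) = q" if "q \<in> U \<inter> V" for q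
    using inj that by (metis inf_le2 inj_on_subset inv_into_f_f)
  have ts: "topspace (subtopology X U) = U" using openin_subset[OF U(1)] by auto
  have ut: "(s y, n y) \<in> unit_tangent \<and> geod_proj (s y, n y) = G (inv_into V \<phi> y)" if yS: "y \<in> S" for y
  proof -
    obtain q where q: "q \<in> U \<inter> V" "y = \<phi> q" using yS by (auto simp: S_def)
    have "(\<sigma> q, \<nu> q) \<in> unit_tangent" using \<nu> q(1) ts by (auto simp: unit_normal_field_def)
    then show ?thesis using q inv[OF q(1)] Gq[of q] inj by (simp add: s_def n_def gauss_map_def)
  qed
  have contact: "mink (frechet_derivative s (at y) a) (n y) = 0" if yS: "y \<in> S" for y a
  proof -
    obtain q where q: "q \<in> U \<inter> V" "y = \<phi> q" using yS by (auto simp: S_def)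
    have "mink (\<nu> q) (chart_deriv (U \<inter> V) \<phi> id \<sigma> q a) = 0"
      using \<nu> UV q(1) unfolding unit_normal_field_def by blast
    then show ?thesis
      using inv[OF q(1)] by (simp add: chart_deriv_def q(2) s_def n_def mink_commute)
  qed
  have "smooth_on (c \<circ> G \<circ> inv_into V \<phi>) (\<phi> ` {q \<in> V. G q \<in> W})"
    using G V W unfolding smooth_map_def by blast
  then have H: "((c \<circ> G \<circ> inv_into V \<phi>) has_derivative chart_deriv V \<phi> c G p) (at (\<phi> p))"
    unfolding chart_deriv_def by (rule smooth_on_has_derivative) (use p in blast)
  have d: "((\<lambda>y. (s y, n y)) has_derivative
      (\<lambda>a. (frechet_derivative s (at (\<phi> p)) a, frechet_derivative n (at (\<phi> p)) a))) (at (\<phi> p))"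
    using sm pS by (intro has_derivative_Pair smooth_on_has_derivative)
  have Gp: "geod_proj (s (\<phi> p), n (\<phi> p)) = G p" using ut[OF pS] p(1) inj by simp
  have "geod_Omega c (geod_proj (s (\<phi> p), n (\<phi> p))) (chart_deriv V \<phi> c G p a) (chart_deriv V \<phi> c G p b) =
      mink (frechet_derivative s (at (\<phi> p)) a) (frechet_derivative n (at (\<phi> p)) b) -
      mink (frechet_derivative n (at (\<phi> p)) a) (frechet_derivative s (at (\<phi> p)) b)"
    using geod_Omega_pullback[OF W d S pS _ _ H, of a b] ut p(2) Gp by simp
  also have "\<dots> = 0"
    using contact_form_zero_imp_symmetric[OF S pS sm contact, of a b] by (simp add: mink_commute)
  finally show "geod_Omega c (G p) (chart_deriv V \<phi> c G p a) (chart_deriv V \<phi> c G p b) = 0"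
    unfolding Gp .
qed

lemma lagrangian_imp_gauss_map:
  fixes A :: "('a, real^'n::finite) chart set" and G :: "'a \<Rightarrow> 'n geodesic"
  assumes A: "smooth_atlas X A" and G: "immersion X A geod_top geod_atlas G" and L: "lagrangian A G"
    and p: "p \<in> topspace X" and \<epsilon>: "\<epsilon> \<in> {1, -1}"
  obtains U B \<sigma> \<nu> where "openin X U" "p \<in> U"
    "orientation (subtopology X U) (restrict_atlas A U) B"
    "hyp_immersion (subtopology X U) (restrict_atlas A U) \<sigma>"
    "unit_normal_field \<epsilon> (subtopology X U) (restrict_atlas A U) B \<sigma> \<nu>"
    "\<And>q. q \<in> U \<Longrightarrow> G q = gauss_map \<sigma> \<nu> q"
proof -
  let ?D = "\<lambda>f x. frechet_derivative f (at x)"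
  have Gs: "smooth_map X A geod_top geod_atlas G" using G by (simp add: immersion_def)
  have Gc: "continuous_map X geod_top G" using Gs by (simp add: smooth_map_def)
  obtain V \<phi> where V: "(V, \<phi>) \<in> A" "p \<in> V" using p unfolding smooth_atlasD(1)[OF A, symmetric] by auto
  note VX = chart_subset_topspace[OF A V(1)] and inj = chart_inj_on[OF A V(1)]
  have inv: "inv_into V \<phi> (\<phi> q) = q" if "q \<in> V" for q using inj that by simp
  have "G p \<in> geodesics"
    using continuous_map_image_subset_topspace[OF Gc] p topspace_geod_top by blast
  then obtain z0 where z0: "z0 \<in> unit_tangent" "G p = geod_proj z0" by (auto simp: geodesics_def)
  obtain W c s where W: "(W, c) \<in> geod_atlas" "geod_proj z0 \<in> W" and s: "smooth_on s UNIV"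
    "\<And>y. s y \<in> unit_tangent" "\<And>l. l \<in> W \<Longrightarrow> geod_proj (s (c l)) = l"
    by (rule geod_chart_with_section[OF z0(1)]) (rule that; assumption)
  define S where "S = \<phi> ` {q \<in> V. G q \<in> W}"
  have "openin X {q \<in> topspace X. G q \<in> W}"
    using Gc geod_atlasD(1)[OF W(1)] by (rule openin_continuous_map_preimage)
  then have "openin X (V \<inter> {q \<in> topspace X. G q \<in> W})"
    by (intro openin_Int smooth_atlasD(2)[OF A V(1)])
  moreover have "V \<inter> {q \<in> topspace X. G q \<in> W} = {q \<in> V. G q \<in> W}" using VX by auto
  ultimately have S: "open S" unfolding S_def by (intro chart_image_open[OF A V(1)]) auto
  have pS: "\<phi> p \<in> S" using V(2) W(2) z0(2) by (auto simp: S_def)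
  define h where "h = c \<circ> G \<circ> inv_into V \<phi>"
  define \<zeta> where "\<zeta> = s \<circ> h"
  have h: "smooth_on h S" unfolding h_def S_def using Gs V(1) W(1) unfolding smooth_map_def by blast
  have \<zeta>: "smooth_on \<zeta> S" unfolding \<zeta>_def by (rule smooth_on_compose[OF S open_UNIV subset_UNIV s(1) h])
  have ut: "\<zeta> y \<in> unit_tangent" for y by (simp add: \<zeta>_def s(2))
  have proj: "geod_proj (\<zeta> (\<phi> q)) = G q" if "q \<in> V" "G q \<in> W" for q
    using that inv s(3) by (simp add: \<zeta>_def h_def)
  have h_eq: "h y = c (geod_proj (\<zeta> y))" if yS: "y \<in> S" for y
    using yS inv proj by (auto simp: S_def h_def)
  have lag: "mink (fst (?D \<zeta> y a)) (snd (?D \<zeta> y b)) = mink (snd (?D \<zeta> y a)) (fst (?D \<zeta> y b))" if yS: "y \<in> S" for y a b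
  proof -
    obtain q where q: "q \<in> V" "G q \<in> W" "y = \<phi> q" using yS by (auto simp: S_def)
    have "geod_Omega c (geod_proj (\<zeta> y)) (?D h y a) (?D h y b) =
        mink (fst (?D \<zeta> y a)) (snd (?D \<zeta> y b)) - mink (snd (?D \<zeta> y a)) (fst (?D \<zeta> y b))"
      by (rule geod_Omega_pullback[OF W(1) smooth_on_has_derivative[OF \<zeta> yS] S yS ut _ smooth_on_has_derivative[OF h yS] h_eq])
        (simp_all add: q proj)
    moreover have "geod_Omega c (G q) (?D h y a) (?D h y b) = 0"
      using L V(1) W(1) q unfolding lagrangian_def h_def chart_deriv_def by fastforce
    ultimately show ?thesis using proj[OF q(1,2)] by (simp add: q(3))
  qed
  \<comment> \<open>A vector that the lift sends to the flow direction is killed by the derivative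
    of h, the coordinate expression of G, which is injective.\<close>
  have imm: "a = 0" if a: "?D \<zeta> (\<phi> p) a = t *\<^sub>R flow_gen (\<zeta> (\<phi> p))" for a t
  proof -
    have pW: "geod_proj (\<zeta> (\<phi> p)) \<in> W" using proj[of p] V(2) W(2) z0(2) by simp
    have "(h has_derivative (\<lambda>a. proj_deriv c (\<zeta> (\<phi> p)) (?D \<zeta> (\<phi> p) a))) (at (\<phi> p))"
      by (rule has_derivative_transform_within_open[OF proj_deriv_chain[OF geod_atlasD(1,3)[OF W(1)] smooth_on_has_derivative[OF \<zeta> pS] S pS ut pW] S pS])
        (simp add: h_eq)
    then have D: "?D h (\<phi> p) = (\<lambda>a. proj_deriv c (\<zeta> (\<phi> p)) (?D \<zeta> (\<phi> p) a))" by (rule frechet_derivative_eq)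
    have "?D h (\<phi> p) a = 0"
      unfolding D a linear_scale[OF linear_proj_deriv[OF W(1) ut pW]] proj_deriv_flow_gen[OF W(1) ut pW] by simp
    moreover have "?D h (\<phi> p) 0 = 0"
      using linear_0[OF has_derivative_linear[OF smooth_on_has_derivative[OF h pS]]] .
    moreover have "inj (?D h (\<phi> p))"
      using G V W z0(2) unfolding immersion_def chart_deriv_def h_def by fastforce
    ultimately show "a = 0" by (metis injD)
  qed
  obtain r \<eta> \<delta> where r: "r > 0" "ball (\<phi> p) r \<subseteq> S" and \<eta>: "smooth_on \<eta> (ball (\<phi> p) r)" and \<delta>: "\<delta> \<in> {1, -1}"
    and \<eta>ut: "\<And>x. x \<in> ball (\<phi> p) r \<Longrightarrow> \<eta> x \<in> unit_tangent \<and> geod_proj (\<eta> x) = geod_proj (\<zeta> x)"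
    and contact: "\<And>x a. x \<in> ball (\<phi> p) r \<Longrightarrow> mink (snd (\<eta> x)) (?D (\<lambda>x. fst (\<eta> x)) x a) = 0"
    and det: "\<And>x. x \<in> ball (\<phi> p) r \<Longrightarrow>
      \<delta> * det (frame_matrix (fst (\<eta> x)) (\<lambda>k. ?D (\<lambda>x. fst (\<eta> x)) x (axis k 1)) (snd (\<eta> x))) > 0"
    by (rule legendrian_lift[OF S pS \<zeta> ut lag imm]) (assumption | rule that; assumption)+
  let ?B = "ball (\<phi> p) r"
  define U where "U = {q \<in> V. \<phi> q \<in> ?B}"
  have UX: "openin X U" unfolding U_def by (rule chart_preimage_open[OF A V(1) open_ball])
  have pU: "p \<in> U" using V(2) r(1) by (simp add: U_def)
  have \<phi>U: "\<phi> ` U = ?B" using r(2) by (auto simp: U_def S_def)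
  have ts: "topspace (subtopology X U) = U" using openin_subset[OF UX] by auto
  define g where "g = (\<lambda>x. fst (\<eta> x))"
  define n where "n = (\<lambda>x. snd (\<eta> x))"
  have g: "smooth_on g ?B" and n: "smooth_on n ?B"
    unfolding g_def n_def by (intro smooth_on_fst smooth_on_snd \<eta> open_ball)+
  have lin: "linear (?D g x)" if "x \<in> ?B" for x
    by (rule has_derivative_linear[OF smooth_on_has_derivative[OF g that]])
  let ?A = "restrict_atlas A U"
  have AU: "smooth_atlas (subtopology X U) ?A" by (rule smooth_atlas_restrict[OF A UX])
  have UA: "(U, \<phi>) \<in> ?A" using V(1) unfolding restrict_atlas_def U_def by (force simp: image_iff)
  then have UA': "(topspace (subtopology X U), \<phi>) \<in> ?A" unfolding ts .
  have gU: "smooth_on g (\<phi> ` topspace (subtopology X U))" and nU: "smooth_on n (\<phi> ` topspace (subtopology X U))"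
    unfolding ts \<phi>U by (rule g, rule n)
  \<comment> \<open>In the chart \<phi> the frame has sign \<delta>, but sign \<epsilon> is
    required. Multiplying one column by e repairs this, since \<epsilon> * e = \<delta>.\<close>
  define e where "e = \<epsilon> * \<delta>"
  \<comment> \<open>\<open>\<rho>\<close> is the identity or a reflection in one coordinate, whichever makes the frame positive.\<close>
  define k0 :: 'n where "k0 = undefined"
  define \<rho> :: "real^'n \<Rightarrow> real^'n" where "\<rho> = (\<lambda>x. \<chi> k. (if k = k0 then e else 1) * x $ k)"
  have e: "e * e = 1" "\<epsilon> * e = \<delta>" using \<epsilon> \<delta> by (auto simp: e_def)
  have \<rho>\<rho>: "\<rho> (\<rho> x) = x" for x using e by (simp add: \<rho>_def vec_eq_iff mult.assoc[symmetric])
  have "linear \<rho>" by (auto simp: \<rho>_def linear_iff vec_eq_iff algebra_simps)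
  then have \<rho>: "bounded_linear \<rho>" by (simp add: linear_conv_bounded_linear)
  have \<rho>_axis: "\<rho> (axis k 1) = (if k = k0 then e else 1) *\<^sub>R axis k 1" for k
    by (simp add: \<rho>_def vec_eq_iff axis_def)
  define \<sigma> where "\<sigma> = g \<circ> \<phi>"
  define \<nu> where "\<nu> = n \<circ> \<phi>"
  \<comment> \<open>With a single chart the only transition is the identity, of determinant 1, so
    orienting U reduces to compatibility of this chart with the restricted atlas.\<close>
  define B where "B = {(U, \<rho> \<circ> \<phi>)}"
  have AB: "smooth_atlas (subtopology X U) (?A \<union> B)"
    using smooth_atlas_insert_linear_involution[OF AU UA \<rho> \<rho>\<rho>] by (simp add: B_def)
  have injU: "inj_on (\<rho> \<circ> \<phi>) U"
    by (rule chart_inj_on[OF AB]) (simp add: B_def)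
  have invU: "inv_into U (\<rho> \<circ> \<phi>) (\<rho> (\<phi> q)) = q" if "q \<in> U" for q
    using inv_into_f_f[OF injU that] by simp
  have o: "open ((\<rho> \<circ> \<phi>) ` U)"
    by (rule smooth_atlasD(3)[OF AB]) (simp add: B_def)
  have orient: "orientation (subtopology X U) ?A B"
    unfolding orientation_def
  proof (intro conjI AB)
    show "smooth_atlas (subtopology X U) B"
      by (rule smooth_atlas_subset[OF AB]) (simp_all add: B_def ts del: topspace_subtopology)
    have "det (matrix (chart_deriv U (\<rho> \<circ> \<phi>) (\<rho> \<circ> \<phi>) id q)) > 0" if "q \<in> U" for q
    proof -
      have "((\<rho> \<circ> \<phi>) \<circ> id \<circ> inv_into U (\<rho> \<circ> \<phi>) has_derivative (\<lambda>x. x)) (at ((\<rho> \<circ> \<phi>) q))"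
        by (rule has_derivative_transform_within_open[OF has_derivative_ident o])
          (use that in \<open>auto simp: invU\<close>)
      then have "chart_deriv U (\<rho> \<circ> \<phi>) (\<rho> \<circ> \<phi>) id q = id"
        unfolding chart_deriv_def id_def by (rule frechet_derivative_eq)
      then show ?thesis by (simp add: matrix_id_mat_1)
    qed
    then show "\<forall>(U, \<phi>)\<in>B. \<forall>(V, \<psi>)\<in>B. \<forall>p\<in>U \<inter> V. 0 < det (matrix (chart_deriv U \<phi> \<psi> id p))"
      by (simp add: B_def)
  qed
  have sub: "V' \<subseteq> U" if "(V', \<psi>) \<in> ?A" for V' \<psi>
    using chart_subset_topspace[OF AU that] ts by simp
  have inB: "\<phi> q \<in> ?B" if "q \<in> U" for q using that \<phi>U by blast
  have inj_g: "a = 0" if "x \<in> ?B" "?D g x a = 0" for x a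
    using det_frame_matrix_imp_injective[OF lin[OF that(1)], of "fst (\<eta> x)" "snd (\<eta> x)"] det[OF that(1)] that(2)
    unfolding g_def by fastforce
  have hyp: "hyp_immersion (subtopology X U) ?A \<sigma>"
    unfolding hyp_immersion_def immersion_def
  proof (intro conjI)
    show "smooth_map (subtopology X U) ?A euclidean euclidean_atlas \<sigma>"
      unfolding \<sigma>_def by (rule smooth_map_through_chart[OF AU UA' gU])
    show "\<sigma> ` topspace (subtopology X U) \<subseteq> hyperboloid"
      unfolding ts using \<eta>ut inB by (force simp: \<sigma>_def g_def unit_tangent_def)
    show "\<forall>(V', \<psi>)\<in>?A. \<forall>(Y, c')\<in>euclidean_atlas. \<forall>q\<in>V'. \<sigma> q \<in> Y \<longrightarrow> inj (chart_deriv V' \<psi> c' \<sigma> q)"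
    proof clarify
      fix V' \<psi> Y q and c' :: "'n minkowski \<Rightarrow> 'n minkowski" assume V': "(V', \<psi>) \<in> ?A" and Y: "(Y, c') \<in> euclidean_atlas" and q: "q \<in> V'"
      obtain T where T: "chart_deriv V' \<psi> id (g \<circ> \<phi>) q = (\<lambda>a. ?D g (\<phi> q) (T a))" "inj T" "linear T"
        by (rule chart_deriv_through_chart[OF AU UA' V' gU q]) (rule that; assumption)
      have qB: "\<phi> q \<in> ?B" using sub[OF V'] q inB by blast
      have "linear (\<lambda>a. ?D g (\<phi> q) (T a))" using linear_compose[OF T(3) lin[OF qB]] by (simp add: o_def)
      moreover have "a = 0" if "?D g (\<phi> q) (T a) = 0" for a
        using inj_g[OF qB that] T(2,3) by (metis injD linear_0)
      ultimately have "inj (\<lambda>a. ?D g (\<phi> q) (T a))" by (simp add: linear_injective_0)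
      then show "inj (chart_deriv V' \<psi> c' \<sigma> q)"
        using Y T(1) by (simp add: euclidean_atlas_def \<sigma>_def)
    qed
  qed
  have norm: "unit_normal_field \<epsilon> (subtopology X U) ?A B \<sigma> \<nu>"
    unfolding unit_normal_field_def
  proof (intro conjI)
    show "smooth_map (subtopology X U) ?A euclidean euclidean_atlas \<nu>"
      unfolding \<nu>_def by (rule smooth_map_through_chart[OF AU UA' nU])
    show "\<forall>q\<in>topspace (subtopology X U). (\<sigma> q, \<nu> q) \<in> unit_tangent"
      using \<eta>ut inB unfolding ts by (simp add: \<sigma>_def \<nu>_def g_def n_def)
    show "\<forall>(V', \<psi>)\<in>?A. \<forall>q\<in>V'. \<forall>a. mink (\<nu> q) (chart_deriv V' \<psi> id \<sigma> q a) = 0"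
    proof clarify
      fix V' \<psi> q a assume V': "(V', \<psi>) \<in> ?A" and q: "q \<in> V'"
      obtain T where T: "chart_deriv V' \<psi> id (g \<circ> \<phi>) q = (\<lambda>a. ?D g (\<phi> q) (T a))"
        by (rule chart_deriv_through_chart[OF AU UA' V' gU q]) (rule that; assumption)
      have "\<phi> q \<in> ?B" using sub[OF V'] q inB by blast
      then show "mink (\<nu> q) (chart_deriv V' \<psi> id \<sigma> q a) = 0"
        using contact T by (simp add: \<sigma>_def \<nu>_def n_def g_def)
    qed
    show "\<forall>(V', \<psi>)\<in>B. \<forall>q\<in>V'. positive_basis \<epsilon> (\<sigma> q) (\<lambda>k. chart_deriv V' \<psi> id \<sigma> q (axis k 1)) (\<nu> q)"
    proof clarify
      fix V' \<psi> q assume "(V', \<psi>) \<in> B" "q \<in> V'"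
      then have eq: "V' = U" "\<psi> = \<rho> \<circ> \<phi>" and q: "q \<in> U" by (auto simp: B_def)
      have x: "\<phi> q \<in> ?B" by (rule inB[OF q])
      \<comment> \<open>In the chart \<open>\<rho> \<circ> \<phi>\<close> the map \<sigma> reads
        \<open>g \<circ> \<rho>\<close>, because \<rho> is its own inverse.\<close>
      have "(g has_derivative ?D g (\<phi> q)) (at (\<rho> ((\<rho> \<circ> \<phi>) q)))"
        using smooth_on_has_derivative[OF g x] by (simp add: \<rho>\<rho>)
      from diff_chain_at[OF bounded_linear_imp_has_derivative[OF \<rho>] this]
      have "(\<sigma> \<circ> inv_into U (\<rho> \<circ> \<phi>) has_derivative ?D g (\<phi> q) \<circ> \<rho>) (at ((\<rho> \<circ> \<phi>) q))"
        by (rule has_derivative_transform_within_open[OF _ o])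
          (use q in \<open>auto simp: \<sigma>_def \<rho>\<rho> invU\<close>)
      then have "chart_deriv U (\<rho> \<circ> \<phi>) id \<sigma> q = ?D g (\<phi> q) \<circ> \<rho>"
        unfolding chart_deriv_def by (subst frechet_derivative_eq) auto
      then have cd: "chart_deriv U (\<rho> \<circ> \<phi>) id \<sigma> q (axis k 1) = (if k = k0 then e else 1) *\<^sub>R ?D g (\<phi> q) (axis k 1)" for k
        by (simp add: \<rho>_axis linear_scale[OF lin[OF x]] del: scaleR_eq_0_iff)
      have "\<epsilon> * (e * det (frame_matrix (\<sigma> q) (\<lambda>k. ?D g (\<phi> q) (axis k 1)) (\<nu> q))) > 0"
        using det[OF x] by (simp add: mult.assoc[symmetric] e(2) \<sigma>_def \<nu>_def n_def g_def)
      then show "positive_basis \<epsilon> (\<sigma> q) (\<lambda>k. chart_deriv V' \<psi> id \<sigma> q (axis k 1)) (\<nu> q)"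
        unfolding positive_basis_iff eq cd det_frame_matrix_scale_column .
    qed
  qed
  have "G q = gauss_map \<sigma> \<nu> q" if q: "q \<in> U" for q
  proof -
    have "\<phi> q \<in> S" "q \<in> V" using inB[OF q] r(2) q by (auto simp: U_def)
    then have "G q \<in> W" using inj by (auto simp: S_def dest: inj_onD)
    then show ?thesis
      using \<eta>ut[OF inB[OF q]] proj[OF \<open>q \<in> V\<close>] by (simp add: gauss_map_def \<sigma>_def \<nu>_def g_def n_def)
  qed
  then show ?thesis using that[OF UX pU orient hyp norm] by blast
qed

theorem theorem1:
  fixes X :: "'a topology"
    and A :: "('a, real^'n::finite) chart set"
    and G :: "'a \<Rightarrow> 'n geodesic"
    and \<epsilon> :: real
  assumes "\<epsilon> \<in> {1, -1}"
    and "smooth_manifold X A"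
    and "immersion X A geod_top geod_atlas G"
  shows "lagrangian A G \<longleftrightarrow>
    (\<forall>p\<in>topspace X. \<exists>U B \<sigma> \<nu>.
       openin X U \<and> p \<in> U \<and>
       orientation (subtopology X U) (restrict_atlas A U) B \<and>
       hyp_immersion (subtopology X U) (restrict_atlas A U) \<sigma> \<and>
       unit_normal_field \<epsilon> (subtopology X U) (restrict_atlas A U) B \<sigma> \<nu> \<and>
       (\<forall>q\<in>U. G q = gauss_map \<sigma> \<nu> q))"
  (is "_ \<longleftrightarrow> ?R")
proof
  have A: "smooth_atlas X A" using assms(2) by (simp add: smooth_manifold_def)
  show ?R if "lagrangian A G"
  proof
    fix p assume "p \<in> topspace X"
    then obtain U B \<sigma> \<nu> where "openin X U" "p \<in> U"
      "orientation (subtopology X U) (restrict_atlas A U) B"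
      "hyp_immersion (subtopology X U) (restrict_atlas A U) \<sigma>"
      "unit_normal_field \<epsilon> (subtopology X U) (restrict_atlas A U) B \<sigma> \<nu>"
      "\<And>q. q \<in> U \<Longrightarrow> G q = gauss_map \<sigma> \<nu> q"
      by (rule lagrangian_imp_gauss_map[OF A assms(3) \<open>lagrangian A G\<close> _ assms(1)]) (rule that; assumption)
    then show "\<exists>U B \<sigma> \<nu>. openin X U \<and> p \<in> U \<and>
       orientation (subtopology X U) (restrict_atlas A U) B \<and>
       hyp_immersion (subtopology X U) (restrict_atlas A U) \<sigma> \<and>
       unit_normal_field \<epsilon> (subtopology X U) (restrict_atlas A U) B \<sigma> \<nu> \<and>
       (\<forall>q\<in>U. G q = gauss_map \<sigma> \<nu> q)"
      by (intro exI conjI ballI)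
  qed
  have G: "smooth_map X A geod_top geod_atlas G" using assms(3) by (simp add: immersion_def)
  show "lagrangian A G" if ?R
  proof (rule gauss_maps_imp_lagrangian[OF A G, of \<epsilon>])
    fix p assume "p \<in> topspace X"
    from bspec[OF that this] show "\<exists>U B \<sigma> \<nu>. openin X U \<and> p \<in> U \<and>
       hyp_immersion (subtopology X U) (restrict_atlas A U) \<sigma> \<and>
       unit_normal_field \<epsilon> (subtopology X U) (restrict_atlas A U) B \<sigma> \<nu> \<and>
       (\<forall>q\<in>U. G q = gauss_map \<sigma> \<nu> q)"
      by (elim exE conjE) (intro exI conjI; assumption)
  qed
qed

end
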